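(* Let $S$ be a multiplicative subset of $R$, $\varphi:R\to\hat R$ the canonical embedding and $T=\varphi(S)$, so that $\hat R\otimes_R R_S\cong\hat R_T$ as rings. Then the simple-$\mathcal F_S$-divisible $R$-submodules $N$ of $E=E(R/\mathfrak m)$ correspond bijectively to the maximal ideals of $\hat R\otimes_R R_S\cong \hat R_T$, via $N\mapsto \mathrm{Ann}_{\hat R}(N)\hat R_T$, with inverse $P\hat R_T\mapsto \mathrm{Ann}_E(P)$ (for $P\in\mathrm{Spec}(\hat R)$ with $P\cap T=\emptyset$ and $P\hat R_T$ maximal).
   Context: $R$ is a commutative Noetherian local ring with maximal ideal $\mathfrak m$, $\hat R$ its $\mathfrak m$-adic completion, $E(R/\mathfrak m)$ the injective hull of $R/\mathfrak m$ (naturally an $\hat R$-module). $\mathcal F_S=\{\mathfrak a\subseteq R\text{ ideal}: \mathfrak a\cap S\ne\emptyset\}$. A module $X$ is $\mathcal F_S$-divisible if $\mathfrak aX=X$ for all $\mathfrak a\in\mathcal F_S$; $N$ is simple-$\mathcal F_S$-divisible if $N\ne0$, $N$ is $\mathcal F_S$-divisible, and no submodule $0\neq V\subsetneq N$ is $\mathcal F_S$-divisible. *)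

theory Defs
  imports "HOL-Algebra.Module" "HOL-Algebra.Ideal_Product" "HOL-Algebra.Ring_Divisibility"
          "HOL-Algebra.QuotRing"
begin

definition local_ring :: "('a, 'b) ring_scheme \<Rightarrow> bool" where
  "local_ring R \<longleftrightarrow> cring R \<and> (\<exists>!I. maximalideal I R)"

definition max_ideal :: "('a, 'b) ring_scheme \<Rightarrow> 'a set" where
  "max_ideal R = (THE I. maximalideal I R)"

primrec ideal_pow :: "('a, 'b) ring_scheme \<Rightarrow> 'a set \<Rightarrow> nat \<Rightarrow> 'a set" where
  "ideal_pow R I 0 = carrier R"
| "ideal_pow R I (Suc n) = ideal_prod R I (ideal_pow R I n)"

abbreviation mpow :: "('a, 'b) ring_scheme \<Rightarrow> nat \<Rightarrow> 'a set" where
  "mpow R n \<equiv> ideal_pow R (max_ideal R) n"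

definition compl_carrier :: "('a, 'b) ring_scheme \<Rightarrow> (nat \<Rightarrow> 'a set) set" where
  "compl_carrier R = {f. \<forall>n. f n \<in> carrier (R Quot (mpow R n)) \<and> f (Suc n) \<subseteq> f n}"

definition compl_mult :: "('a, 'b) ring_scheme \<Rightarrow> (nat \<Rightarrow> 'a set) \<Rightarrow> (nat \<Rightarrow> 'a set) \<Rightarrow> (nat \<Rightarrow> 'a set)" where
  "compl_mult R f g = (\<lambda>n. f n \<otimes>\<^bsub>R Quot (mpow R n)\<^esub> g n)"

definition compl_add :: "('a, 'b) ring_scheme \<Rightarrow> (nat \<Rightarrow> 'a set) \<Rightarrow> (nat \<Rightarrow> 'a set) \<Rightarrow> (nat \<Rightarrow> 'a set)" where
  "compl_add R f g = (\<lambda>n. f n \<oplus>\<^bsub>R Quot (mpow R n)\<^esub> g n)"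

definition compl_one :: "('a, 'b) ring_scheme \<Rightarrow> (nat \<Rightarrow> 'a set)" where
  "compl_one R = (\<lambda>n. \<one>\<^bsub>R Quot (mpow R n)\<^esub>)"

definition compl_zero :: "('a, 'b) ring_scheme \<Rightarrow> (nat \<Rightarrow> 'a set)" where
  "compl_zero R = (\<lambda>n. \<zero>\<^bsub>R Quot (mpow R n)\<^esub>)"

definition completion :: "('a, 'b) ring_scheme \<Rightarrow> (nat \<Rightarrow> 'a set) ring" where
  "completion R = \<lparr> partial_object.carrier = compl_carrier R, monoid.mult = compl_mult R, monoid.one = compl_one R,
                     ring.zero = compl_zero R, ring.add = compl_add R \<rparr>"

definition canon :: "('a, 'b) ring_scheme \<Rightarrow> 'a \<Rightarrow> (nat \<Rightarrow> 'a set)" where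
  "canon R r = (\<lambda>n. mpow R n +>\<^bsub>R\<^esub> r)"

definition mult_subset :: "('a, 'b) ring_scheme \<Rightarrow> 'a set \<Rightarrow> bool" where
  "mult_subset A S \<longleftrightarrow> S \<subseteq> carrier A \<and> \<one>\<^bsub>A\<^esub> \<in> S \<and> (\<forall>s\<in>S. \<forall>t\<in>S. s \<otimes>\<^bsub>A\<^esub> t \<in> S)"

definition loc_rel :: "('a, 'b) ring_scheme \<Rightarrow> 'a set \<Rightarrow> (('a \<times> 'a) \<times> ('a \<times> 'a)) set" where
  "loc_rel A S = {((a, s), (b, t)). a \<in> carrier A \<and> s \<in> S \<and> b \<in> carrier A \<and> t \<in> S \<and>
      (\<exists>u\<in>S. u \<otimes>\<^bsub>A\<^esub> ((a \<otimes>\<^bsub>A\<^esub> t) \<ominus>\<^bsub>A\<^esub> (b \<otimes>\<^bsub>A\<^esub> s)) = \<zero>\<^bsub>A\<^esub>)}"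

definition frac :: "('a, 'b) ring_scheme \<Rightarrow> 'a set \<Rightarrow> 'a \<Rightarrow> 'a \<Rightarrow> ('a \<times> 'a) set" where
  "frac A S a s = loc_rel A S `` {(a, s)}"

definition localization :: "('a, 'b) ring_scheme \<Rightarrow> 'a set \<Rightarrow> (('a \<times> 'a) set) ring" where
  "localization A S =
    \<lparr> partial_object.carrier = (carrier A \<times> S) // loc_rel A S,
      monoid.mult = (\<lambda>X Y. \<Union>{frac A S (a \<otimes>\<^bsub>A\<^esub> b) (s \<otimes>\<^bsub>A\<^esub> t) | a s b t. (a, s) \<in> X \<and> (b, t) \<in> Y}),
      monoid.one = frac A S \<one>\<^bsub>A\<^esub> \<one>\<^bsub>A\<^esub>,
      ring.zero = frac A S \<zero>\<^bsub>A\<^esub> \<one>\<^bsub>A\<^esub>,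
      ring.add = (\<lambda>X Y. \<Union>{frac A S ((a \<otimes>\<^bsub>A\<^esub> t) \<oplus>\<^bsub>A\<^esub> (b \<otimes>\<^bsub>A\<^esub> s)) (s \<otimes>\<^bsub>A\<^esub> t)
                        | a s b t. (a, s) \<in> X \<and> (b, t) \<in> Y}) \<rparr>"

definition ext_ideal :: "('a, 'b) ring_scheme \<Rightarrow> 'a set \<Rightarrow> 'a set \<Rightarrow> ('a \<times> 'a) set set" where
  "ext_ideal A S I = genideal (localization A S) ((\<lambda>a. frac A S a \<one>\<^bsub>A\<^esub>) ` I)"

text \<open>Injectivity via Baer's criterion (module-theoretic quantification over all modules
  of all types is not expressible in HOL).\<close>
definition injective_module :: "('a, 'b) ring_scheme \<Rightarrow> ('a, 'c, 'd) module_scheme \<Rightarrow> bool" where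
  "injective_module R M \<longleftrightarrow>
    (\<forall>I f. ideal I R \<and> (\<forall>a\<in>I. f a \<in> carrier M)
       \<and> (\<forall>a\<in>I. \<forall>b\<in>I. f (a \<oplus>\<^bsub>R\<^esub> b) = f a \<oplus>\<^bsub>M\<^esub> f b)
       \<and> (\<forall>r\<in>carrier R. \<forall>a\<in>I. f (r \<otimes>\<^bsub>R\<^esub> a) = r \<odot>\<^bsub>M\<^esub> f a)
     \<longrightarrow> (\<exists>x\<in>carrier M. \<forall>a\<in>I. f a = a \<odot>\<^bsub>M\<^esub> x))"

text \<open>M is an injective hull of R/m: M is injective and an essential extension of a
  submodule R u with Ann(u) = m (so R u is isomorphic to R/m).\<close>
definition injective_hull_residue :: "('a, 'b) ring_scheme \<Rightarrow> ('a, 'c, 'd) module_scheme \<Rightarrow> bool" where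
  "injective_hull_residue R M \<longleftrightarrow> injective_module R M \<and>
    (\<exists>u\<in>carrier M. u \<noteq> \<zero>\<^bsub>M\<^esub> \<and> {r \<in> carrier R. r \<odot>\<^bsub>M\<^esub> u = \<zero>\<^bsub>M\<^esub>} = max_ideal R \<and>
       (\<forall>U. submodule U R M \<and> U \<noteq> {\<zero>\<^bsub>M\<^esub>} \<longrightarrow>
            U \<inter> {r \<odot>\<^bsub>M\<^esub> u | r. r \<in> carrier R} \<noteq> {\<zero>\<^bsub>M\<^esub>}))"

text \<open>The natural action of the completion on an m-torsion module:
  xi . e = r e, where r represents xi modulo m^n and m^n e = 0.\<close>
definition hat_smult :: "('a, 'b) ring_scheme \<Rightarrow> ('a, 'c, 'd) module_scheme
                          \<Rightarrow> (nat \<Rightarrow> 'a set) \<Rightarrow> 'c \<Rightarrow> 'c" where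
  "hat_smult R M xi e =
     (SOME r. \<exists>n. r \<in> xi n \<and> (\<forall>a\<in>mpow R n. a \<odot>\<^bsub>M\<^esub> e = \<zero>\<^bsub>M\<^esub>)) \<odot>\<^bsub>M\<^esub> e"

definition ann_hat :: "('a, 'b) ring_scheme \<Rightarrow> ('a, 'c, 'd) module_scheme \<Rightarrow> 'c set
                       \<Rightarrow> (nat \<Rightarrow> 'a set) set" where
  "ann_hat R M N = {xi \<in> carrier (completion R). \<forall>e\<in>N. hat_smult R M xi e = \<zero>\<^bsub>M\<^esub>}"

definition ann_mod :: "('a, 'b) ring_scheme \<Rightarrow> ('a, 'c, 'd) module_scheme \<Rightarrow> (nat \<Rightarrow> 'a set) set
                       \<Rightarrow> 'c set" where
  "ann_mod R M P = {e \<in> carrier M. \<forall>xi\<in>P. hat_smult R M xi e = \<zero>\<^bsub>M\<^esub>}"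

definition ideal_smult :: "('a, 'b) ring_scheme \<Rightarrow> ('a, 'c, 'd) module_scheme \<Rightarrow> 'a set \<Rightarrow> 'c set \<Rightarrow> 'c set" where
  "ideal_smult R M I X = \<Inter>{U. submodule U R M \<and> {r \<odot>\<^bsub>M\<^esub> x | r x. r \<in> I \<and> x \<in> X} \<subseteq> U}"

definition FS_divisible :: "('a, 'b) ring_scheme \<Rightarrow> 'a set \<Rightarrow> ('a, 'c, 'd) module_scheme \<Rightarrow> 'c set \<Rightarrow> bool" where
  "FS_divisible R S M X \<longleftrightarrow> (\<forall>I. ideal I R \<and> I \<inter> S \<noteq> {} \<longrightarrow> ideal_smult R M I X = X)"

definition simple_FS_divisible :: "('a, 'b) ring_scheme \<Rightarrow> 'a set \<Rightarrow> ('a, 'c, 'd) module_scheme \<Rightarrow> 'c set \<Rightarrow> bool" where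
  "simple_FS_divisible R S M N \<longleftrightarrow> submodule N R M \<and> N \<noteq> {\<zero>\<^bsub>M\<^esub>} \<and> FS_divisible R S M N \<and>
     \<not> (\<exists>V. submodule V R M \<and> V \<noteq> {\<zero>\<^bsub>M\<^esub>} \<and> V \<subset> N \<and> FS_divisible R S M V)"

end

theory Submission
  imports Defs
begin

text \<open>
  The proof is Matlis duality: sending a submodule \<open>N\<close> of \<open>E\<close> to its annihilator in the completion
  is an order-reversing bijection onto the ideals of the completion. Under it, \<open>s N = N\<close> says that
  \<open>(Ann N : s) = Ann N\<close>, so the divisible submodules correspond to the \<open>T\<close>-saturated ideals, i.e. to
  the ideals of the localization at \<open>T\<close>, and the simple ones to the maximal ideals.

  The duality itself is obtained without lengths or tensor products. Adding one simple factor at a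
  time shows that a submodule \<open>N\<close> of \<open>E\<close> killed by a power of the maximal ideal equals the
  annihilator of \<open>Ann N\<close>, and that every homomorphism \<open>N \<rightarrow> E\<close> is multiplication by a ring element;
  passing to the limit, for every submodule \<open>N\<close> of \<open>E\<close> every homomorphism \<open>N \<rightarrow> E\<close> is multiplication
  by an element of the completion. This makes finitely generated ideals of the completion equal to
  their double annihilators, hence closed, and closedness forces all ideals to be finitely generated.
\<close>

section \<open>Finitely generated ideals\<close>

text \<open>The injectivity hypothesis concerns maps out of ideals of R only, and it enters at a
  single place: for maps from I + R r to E that separate r from I (\<open>cogenerator\<close>). Over
  the completion no homomorphism is ever extended. When a generator x is adjoined to an ideal J with
  N = Ann J, an element y killing everything in N that x kills defines the map x e |-> y e on the
  submodule x N of E; this map is already multiplication by some c, so y - c x kills N and lies in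
  J. Such an induction reaches finitely generated ideals only, which is why the completion must be
  shown Noetherian before the duality is available for all ideals. The obstacle there is that the
  kernel of the projection of the completion to R/m^n is not known in advance to be generated by the
  image of m^n. Double annihilators settle n = 1, and beyond that closedness is used only in the
  form: an element of G + (x^n) for every n lies in G. That suits the removal of one generator x of
  m at a time.\<close>

lemma (in cring) ideal_memI:
  assumes "I \<subseteq> carrier R" "\<zero> \<in> I"
    and "\<And>a b. a \<in> I \<Longrightarrow> b \<in> I \<Longrightarrow> a \<oplus> b \<in> I"
    and "\<And>r a. r \<in> carrier R \<Longrightarrow> a \<in> I \<Longrightarrow> r \<otimes> a \<in> I"
  shows "ideal I R"
proof (rule idealI[OF ring_axioms])
  have neg: "\<ominus> a \<in> I" if "a \<in> I" for a
  proof -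
    have "\<ominus> a = \<ominus> \<one> \<otimes> a"
      using that assms(1) by (simp add: l_minus subset_iff)
    then show ?thesis
      using assms(4)[OF _ that, of "\<ominus> \<one>"] by simp
  qed
  show "subgroup I (add_monoid R)"
    using assms neg by (intro add.subgroupI) auto
  fix a x assume "a \<in> I" "x \<in> carrier R"
  then show "x \<otimes> a \<in> I" "a \<otimes> x \<in> I"
    using assms m_comm[of a x] by (auto simp: subset_iff)
qed

lemma idealD:
  fixes R (structure)
  assumes "ideal I R"
  shows "I \<subseteq> carrier R" "\<And>a. a \<in> I \<Longrightarrow> a \<in> carrier R" "\<zero> \<in> I"
    and "\<And>a b. a \<in> I \<Longrightarrow> b \<in> I \<Longrightarrow> a \<oplus> b \<in> I"
    and "\<And>a. a \<in> I \<Longrightarrow> \<ominus> a \<in> I"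
    and "\<And>a b. a \<in> I \<Longrightarrow> b \<in> I \<Longrightarrow> a \<ominus> b \<in> I"
    and "\<And>r a. r \<in> carrier R \<Longrightarrow> a \<in> I \<Longrightarrow> r \<otimes> a \<in> I"
    and "\<And>r a. r \<in> carrier R \<Longrightarrow> a \<in> I \<Longrightarrow> a \<otimes> r \<in> I"
    and "\<one> \<in> I \<Longrightarrow> I = carrier R"
proof -
  interpret ideal I R by fact
  show "I \<subseteq> carrier R" "\<And>a. a \<in> I \<Longrightarrow> a \<in> carrier R" "\<zero> \<in> I"
    "\<And>a b. a \<in> I \<Longrightarrow> b \<in> I \<Longrightarrow> a \<oplus> b \<in> I" "\<And>a. a \<in> I \<Longrightarrow> \<ominus> a \<in> I"
    "\<And>r a. r \<in> carrier R \<Longrightarrow> a \<in> I \<Longrightarrow> r \<otimes> a \<in> I"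
    "\<And>r a. r \<in> carrier R \<Longrightarrow> a \<in> I \<Longrightarrow> a \<otimes> r \<in> I"
    using a_subset by (auto intro: I_l_closed I_r_closed)
  show "\<And>a b. a \<in> I \<Longrightarrow> b \<in> I \<Longrightarrow> a \<ominus> b \<in> I"
    by (simp add: a_minus_def)
  show "\<one> \<in> I \<Longrightarrow> I = carrier R"
    by (rule one_imp_carrier)
qed

definition adjoin :: "('a, 'b) ring_scheme \<Rightarrow> 'a set \<Rightarrow> 'a \<Rightarrow> 'a set" where
  "adjoin R I x = {i \<oplus>\<^bsub>R\<^esub> a \<otimes>\<^bsub>R\<^esub> x | i a. i \<in> I \<and> a \<in> carrier R}"

lemma adjoinI: "i \<in> I \<Longrightarrow> a \<in> carrier R \<Longrightarrow> y = i \<oplus>\<^bsub>R\<^esub> a \<otimes>\<^bsub>R\<^esub> x \<Longrightarrow> y \<in> adjoin R I x"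
  by (auto simp: adjoin_def)

context cring
begin

lemma adjoin_ideal:
  assumes "ideal I R" "x \<in> carrier R"
  shows "ideal (adjoin R I x) R"
proof (rule ideal_memI)
  note I = idealD[OF assms(1)]
  show "adjoin R I x \<subseteq> carrier R"
    using I(2) assms(2) by (auto simp: adjoin_def)
  show "\<zero> \<in> adjoin R I x"
    using I(3) assms(2) by (auto intro!: adjoinI[of \<zero> _ \<zero>])
  fix y assume "y \<in> adjoin R I x"
  then obtain i a where y: "i \<in> I" "a \<in> carrier R" "y = i \<oplus> a \<otimes> x"
    by (auto simp: adjoin_def)
  {
    fix z assume "z \<in> adjoin R I x"
    then obtain j b where z: "j \<in> I" "b \<in> carrier R" "z = j \<oplus> b \<otimes> x"
      by (auto simp: adjoin_def)
    have "y \<oplus> z = (i \<oplus> j) \<oplus> (a \<oplus> b) \<otimes> x"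
      unfolding y(3) z(3) using I(2)[OF y(1)] I(2)[OF z(1)] y(2) z(2) assms(2) by algebra
    then show "y \<oplus> z \<in> adjoin R I x"
      using I(4) y z by (intro adjoinI[of "i \<oplus> j" _ "a \<oplus> b"]) auto
  }
  {
    fix r assume r: "r \<in> carrier R"
    have "r \<otimes> y = r \<otimes> i \<oplus> (r \<otimes> a) \<otimes> x"
      unfolding y(3) using I(2)[OF y(1)] y(2) r assms(2) by algebra
    then show "r \<otimes> y \<in> adjoin R I x"
      using I(7) y r by (intro adjoinI[of "r \<otimes> i" _ "r \<otimes> a"]) auto
  }
qed

lemma adjoin_superset: "ideal I R \<Longrightarrow> x \<in> carrier R \<Longrightarrow> I \<subseteq> adjoin R I x"
  using idealD(2)[of I R] by (auto intro!: adjoinI[of _ _ \<zero>])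

lemma adjoin_self: "ideal I R \<Longrightarrow> x \<in> carrier R \<Longrightarrow> x \<in> adjoin R I x"
  using idealD(3)[of I R] by (auto intro!: adjoinI[of \<zero> _ \<one>])

lemma adjoin_minimal:
  assumes "ideal J R" "I \<subseteq> J" "x \<in> J"
  shows "adjoin R I x \<subseteq> J"
  using idealD[OF assms(1)] assms(2,3) by (auto simp: adjoin_def)

end

text \<open>Inductive rather than by a finite generating set: the later arguments adjoin one
  generator at a time, which is exactly the induction rule.\<close>

inductive fg_ideal :: "('a, 'b) ring_scheme \<Rightarrow> 'a set \<Rightarrow> bool" for R where
  fg_zero: "fg_ideal R {\<zero>\<^bsub>R\<^esub>}"
| fg_adjoin: "fg_ideal R I \<Longrightarrow> x \<in> carrier R \<Longrightarrow> fg_ideal R (adjoin R I x)"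

context cring
begin

lemma fg_ideal_imp_ideal: "fg_ideal R I \<Longrightarrow> ideal I R"
  by (induction rule: fg_ideal.induct) (auto intro: zeroideal adjoin_ideal)

lemma fg_ideal_Idl:
  assumes "finite A" "A \<subseteq> carrier R"
  shows "fg_ideal R (Idl A)"
  using assms
proof (induction A rule: finite_induct)
  case empty
  have "Idl {} = {\<zero>}"
    using genideal_minimal[OF zeroideal, of "{}"] idealD(3)[OF genideal_ideal[of "{}"]] by auto
  then show ?case by (simp add: fg_zero)
next
  case (insert x A)
  have A: "ideal (Idl A) R" "A \<subseteq> Idl A"
    using insert by (auto intro!: genideal_ideal genideal_self)
  have "Idl (insert x A) = adjoin R (Idl A) x"
  proof
    show "Idl (insert x A) \<subseteq> adjoin R (Idl A) x"
      using A insert.prems adjoin_self[OF A(1), of x] adjoin_superset[OF A(1), of x]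
      by (intro genideal_minimal adjoin_ideal) auto
    show "adjoin R (Idl A) x \<subseteq> Idl (insert x A)"
      using insert.prems genideal_self[of "insert x A"]
      by (intro adjoin_minimal genideal_ideal genideal_minimal) auto
  qed
  then show ?case
    using insert by (auto intro: fg_adjoin)
qed

text \<open>Compactness of finitely generated ideals: each new generator lies in some stage, and the
  larger of two stages contains both.\<close>

lemma fg_ideal_in_directed_Union:
  assumes "fg_ideal R I" "I \<subseteq> (\<Union>n::nat. F n)"
    and "\<And>n. ideal (F n) R" "\<And>n. F n \<subseteq> F (Suc n)"
  shows "\<exists>n. I \<subseteq> F n"
  using assms(1,2)
proof (induction rule: fg_ideal.induct)
  case fg_zero
  then show ?case using idealD(3)[OF assms(3)] by auto
next
  case (fg_adjoin I x)
  have I: "ideal I R"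
    using fg_adjoin by (simp add: fg_ideal_imp_ideal)
  obtain n where n: "I \<subseteq> F n"
    using fg_adjoin adjoin_superset[OF I] by blast
  obtain k where k: "x \<in> F k"
    using fg_adjoin adjoin_self[OF I] by blast
  have "F n \<subseteq> F (max n k)" "F k \<subseteq> F (max n k)"
    using lift_Suc_mono_le[of F, OF assms(4)] by auto
  then show ?case
    using n k by (intro exI[of _ "max n k"] adjoin_minimal assms(3)) auto
qed

text \<open>Write each generator of \<open>L\<close> as i + a x with i in \<open>I\<close>; the
  finitely many parts i generate \<open>G\<close>.\<close>

lemma fg_ideal_sum_principal_lift:
  assumes I: "ideal I R" and x: "x \<in> carrier R"
    and fg: "fg_ideal R L" and L: "L \<subseteq> adjoin R I x"
  shows "\<exists>G. fg_ideal R G \<and> G \<subseteq> I \<and> L \<subseteq> adjoin R G x"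
  using fg L
proof (induction rule: fg_ideal.induct)
  case fg_zero
  then show ?case
    using idealD(3)[OF I] idealD(3)[OF adjoin_ideal[OF zeroideal x]]
    by (intro exI[of _ "{\<zero>}"]) (auto intro: fg_ideal.fg_zero)
next
  case (fg_adjoin L y)
  have LI: "ideal L R"
    using fg_adjoin by (simp add: fg_ideal_imp_ideal)
  obtain G where G: "fg_ideal R G" "G \<subseteq> I" "L \<subseteq> adjoin R G x"
    using fg_adjoin adjoin_superset[OF LI] by blast
  have GI: "ideal G R" using G by (simp add: fg_ideal_imp_ideal)
  obtain i a where y: "i \<in> I" "a \<in> carrier R" "y = i \<oplus> a \<otimes> x"
    using fg_adjoin.prems adjoin_self[OF LI fg_adjoin.hyps(2)] unfolding adjoin_def by blast
  have i: "i \<in> carrier R" using y idealD[OF I] by auto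
  have G': "ideal (adjoin R G i) R" using GI i by (rule adjoin_ideal)
  have "adjoin R L y \<subseteq> adjoin R (adjoin R G i) x"
  proof (rule adjoin_minimal)
    show "ideal (adjoin R (adjoin R G i) x) R"
      using G' x by (rule adjoin_ideal)
    have "adjoin R G x \<subseteq> adjoin R (adjoin R G i) x"
      using adjoin_superset[OF GI i] by (auto simp: adjoin_def)
    then show "L \<subseteq> adjoin R (adjoin R G i) x" using G by auto
    show "y \<in> adjoin R (adjoin R G i) x"
      using adjoin_self[OF GI i] y by (auto intro: adjoinI)
  qed
  moreover have "adjoin R G i \<subseteq> I"
    using I G y by (intro adjoin_minimal) auto
  ultimately show ?case
    using G i by (intro exI[of _ "adjoin R G i"]) (auto intro: fg_ideal.fg_adjoin)
qed

end

text \<open>The ascending chain condition as well-founded induction along strict reverse inclusion: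
  an infinite ascending chain would contain its own union, by
  \<open>ideal_chain_is_trivial\<close>.\<close>

lemma (in noetherian_ring) noetherian_induct [consumes 1, case_names step]:
  assumes "ideal I R"
    and step: "\<And>I. ideal I R \<Longrightarrow> (\<And>J. ideal J R \<Longrightarrow> I \<subset> J \<Longrightarrow> P J) \<Longrightarrow> P I"
  shows "P I"
proof -
  define r where "r = {(J, I). ideal I R \<and> ideal J R \<and> I \<subset> J}"
  have "wf r"
    unfolding wf_iff_no_infinite_down_chain
  proof
    assume "\<exists>f. \<forall>i. (f (Suc i), f i) \<in> r"
    then obtain f :: "nat \<Rightarrow> _" where f: "\<And>i. ideal (f i) R" "\<And>i. f i \<subset> f (Suc i)"
      unfolding r_def by blast
    have mono: "f i \<subseteq> f j" if "i \<le> j" for i j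
      using lift_Suc_mono_le[of f] f(2) that by blast
    have "\<Union>(range f) \<in> range f"
    proof (rule ideal_chain_is_trivial)
      show "subset.chain {I. ideal I R} (range f)"
        unfolding subset_chain_def using f(1) mono nat_le_linear by blast
    qed simp
    then obtain k where "\<Union>(range f) = f k" by auto
    then show False using f(2)[of k] by blast
  qed
  then show ?thesis
    using assms(1)
  proof (induction I rule: wf_induct_rule)
    case (less I)
    show ?case
      by (rule step[OF less.prems]) (auto intro: less.IH simp: r_def less.prems)
  qed
qed

section \<open>Colon ideals by powers of one element\<close>

context cring
begin

text \<open>Generators of \<open>G\<close> together with \<open>x\<close> times those of
  \<open>H\<close> suffice. With \<open>H\<close> the colon ideal of x^(n+1) this is the descent to
  the colon ideal of x^n.\<close>

lemma fg_ideal_sum_mult: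
  assumes "fg_ideal R H" "fg_ideal R G" "x \<in> carrier R"
  shows "fg_ideal R {g \<oplus> x \<otimes> h | g h. g \<in> G \<and> h \<in> H}"
  using assms(1)
proof (induction rule: fg_ideal.induct)
  case fg_zero
  have "{g \<oplus> x \<otimes> h | g h. g \<in> G \<and> h \<in> {\<zero>}} = G"
    using idealD(2)[OF fg_ideal_imp_ideal[OF assms(2)]] assms(3) by force
  then show ?case using assms(2) by simp
next
  case (fg_adjoin H z)
  note G = idealD(2)[OF fg_ideal_imp_ideal[OF assms(2)]]
  note H = idealD(2)[OF fg_ideal_imp_ideal[OF fg_adjoin.hyps(1)]]
  have eq: "g \<oplus> x \<otimes> (h \<oplus> a \<otimes> z) = (g \<oplus> x \<otimes> h) \<oplus> a \<otimes> (x \<otimes> z)"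
    if "g \<in> G" "h \<in> H" "a \<in> carrier R" for g h a
    using G[OF that(1)] H[OF that(2)] that(3) assms(3) fg_adjoin.hyps(2) by algebra
  have "{g \<oplus> x \<otimes> h | g h. g \<in> G \<and> h \<in> adjoin R H z} =
      adjoin R {g \<oplus> x \<otimes> h | g h. g \<in> G \<and> h \<in> H} (x \<otimes> z)"
  proof (intro equalityI subsetI)
    fix y assume "y \<in> {g \<oplus> x \<otimes> h | g h. g \<in> G \<and> h \<in> adjoin R H z}"
    then obtain g h a where "g \<in> G" "h \<in> H" "a \<in> carrier R" "y = g \<oplus> x \<otimes> (h \<oplus> a \<otimes> z)"
      unfolding adjoin_def by blast
    then show "y \<in> adjoin R {g \<oplus> x \<otimes> h | g h. g \<in> G \<and> h \<in> H} (x \<otimes> z)"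
      using eq unfolding adjoin_def by blast
  next
    fix y assume "y \<in> adjoin R {g \<oplus> x \<otimes> h | g h. g \<in> G \<and> h \<in> H} (x \<otimes> z)"
    then obtain g h a where gha: "g \<in> G" "h \<in> H" "a \<in> carrier R"
      "y = (g \<oplus> x \<otimes> h) \<oplus> a \<otimes> (x \<otimes> z)"
      unfolding adjoin_def by blast
    then have "y = g \<oplus> x \<otimes> (h \<oplus> a \<otimes> z)" using eq by simp
    then show "y \<in> {g \<oplus> x \<otimes> h | g h. g \<in> G \<and> h \<in> adjoin R H z}"
      using gha unfolding adjoin_def by blast
  qed
  then show ?case
    using fg_ideal.fg_adjoin[OF fg_adjoin.IH, of "x \<otimes> z"] assms(3) fg_adjoin.hyps(2) by simp
qed

text \<open>The ascending chain of colon ideals \<open>(I : x\<^sup>n)\<close> stabilises modulo \<open>x\<close>. Once it has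
  done so, \<open>(I : x\<^sup>n)\<close> is generated modulo arbitrarily high powers of \<open>x\<close> by finitely many
  elements, hence by closedness generated by them; from there one descends to \<open>n = 0\<close>.\<close>

lemma fg_ideal_if_fg_above:
  assumes I: "ideal I R" and x: "x \<in> carrier R"
    and cl: "\<And>G y. fg_ideal R G \<Longrightarrow> y \<in> carrier R \<Longrightarrow>
        (\<And>n. \<exists>g\<in>G. \<exists>a\<in>carrier R. y = g \<oplus> x [^] (n::nat) \<otimes> a) \<Longrightarrow> y \<in> G"
    and above: "\<And>J. ideal J R \<Longrightarrow> I \<subseteq> J \<Longrightarrow> x \<in> J \<Longrightarrow> fg_ideal R J"
  shows "fg_ideal R I"
proof -
  define C where "C n = {a \<in> carrier R. x [^] (n::nat) \<otimes> a \<in> I}" for n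
  note Id = idealD[OF I]
  have C: "ideal (C n) R" for n
  proof (rule ideal_memI)
    fix r a assume ra: "r \<in> carrier R" "a \<in> C n"
    have "x [^] n \<otimes> (r \<otimes> a) = r \<otimes> (x [^] n \<otimes> a)"
      using ra x by (simp add: C_def m_lcomm)
    then show "r \<otimes> a \<in> C n"
      using ra Id(7) by (simp add: C_def)
  qed (use Id x in \<open>auto simp: C_def r_distr\<close>)
  have C_Suc: "a \<in> C (Suc n) \<longleftrightarrow> a \<in> carrier R \<and> x \<otimes> a \<in> C n" for a n
    using x by (auto simp: C_def m_assoc m_comm m_lcomm)
  have "C n \<subseteq> C (Suc n)" for n
    using idealD(2)[OF C] idealD(7)[OF C x] by (auto simp: C_Suc)
  then have C_mono: "C n \<subseteq> C k" if "n \<le> k" for n k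
    by (rule lift_Suc_mono_le[OF _ that])
  have C0: "C 0 = I"
    using Id(2) by (auto simp: C_def)
  \<comment> \<open>The colon ideals are not known to be finitely generated, but with x adjoined
    they contain both I and x, so \<open>above\<close> applies to each of them and to their union;
    hence this chain becomes stationary.\<close>
  define L where "L n = adjoin R (C n) x" for n
  have L: "ideal (L n) R" "C n \<subseteq> L n" "x \<in> L n" for n
    unfolding L_def using adjoin_ideal[OF C x] adjoin_superset[OF C x] adjoin_self[OF C x] by auto
  have L_Suc: "L n \<subseteq> L (Suc n)" for n
    using C_mono[of n "Suc n"] by (auto simp: L_def adjoin_def)
  have L_fg: "fg_ideal R (L n)" for n
    using L(2)[of n] C_mono[of 0 n] by (intro above[OF L(1) _ L(3)]) (simp add: C0)
  have "ideal (\<Union>n. L n) R"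
  proof (rule ideal_memI)
    fix a b assume "a \<in> (\<Union>n. L n)" "b \<in> (\<Union>n. L n)"
    then obtain n k where nk: "a \<in> L n" "b \<in> L k" by blast
    have "L n \<subseteq> L (max n k)" "L k \<subseteq> L (max n k)"
      using lift_Suc_mono_le[of L, OF L_Suc] by auto
    then have "a \<oplus> b \<in> L (max n k)"
      using nk idealD(4)[OF L(1)] by blast
    then show "a \<oplus> b \<in> (\<Union>n. L n)" by blast
  next
    show "(\<Union>n. L n) \<subseteq> carrier R" using idealD(1)[OF L(1)] by (rule UN_least)
    show "\<zero> \<in> (\<Union>n. L n)" using idealD(3)[OF L(1)] by (intro UN_I[of 0]) auto
    fix r a assume "r \<in> carrier R" "a \<in> (\<Union>n. L n)"
    then show "r \<otimes> a \<in> (\<Union>n. L n)" using idealD(7)[OF L(1)] by auto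
  qed
  then have "fg_ideal R (\<Union>n. L n)"
    using L(2)[of 0] L(3) C0 by (intro above) auto
  then obtain N where N: "(\<Union>n. L n) \<subseteq> L N"
    using fg_ideal_in_directed_Union[OF _ subset_refl, of L] L(1) L_Suc by blast
  have lift: "\<exists>G. fg_ideal R G \<and> G \<subseteq> C n \<and> L n \<subseteq> adjoin R G x" for n
    by (rule fg_ideal_sum_principal_lift[OF C x L_fg]) (simp add: L_def)
  \<comment> \<open>The cofactor of x falls into the next colon ideal by itself, because x a = y - g
    is a difference of elements of \<open>C n\<close>.\<close>
  have split: "\<exists>g\<in>G. \<exists>a\<in>C (Suc n). y = g \<oplus> x \<otimes> a"
    if G: "G \<subseteq> C n" and y: "y \<in> C n" "y \<in> adjoin R G x" for G n y
  proof -
    obtain g a where ga: "g \<in> G" "a \<in> carrier R" "y = g \<oplus> a \<otimes> x"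
      using y(2) unfolding adjoin_def by blast
    have g: "g \<in> carrier R" "g \<in> C n" using ga G idealD(2)[OF C] by auto
    have "x \<otimes> a = y \<ominus> g"
      using ga g x unfolding ga(3) by algebra
    then have "a \<in> C (Suc n)"
      using C_Suc idealD(6)[OF C y(1) g(2)] ga by simp
    then show ?thesis
      using ga x by (intro bexI[of _ g] bexI[of _ a]) (simp_all add: m_comm)
  qed
  obtain G where G: "fg_ideal R G" "G \<subseteq> C N" "L N \<subseteq> adjoin R G x"
    using lift by blast
  note Gd = idealD[OF fg_ideal_imp_ideal[OF G(1)]]
  \<comment> \<open>From index N on the ideals \<open>L n\<close> no longer grow, so the same G
    serves every \<open>C n\<close> with n at least N. Each use of \<open>split\<close> moves the
    remainder to \<open>C (Suc n)\<close> and peels off one more factor x.\<close>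
  have approx: "\<exists>g\<in>G. \<exists>a\<in>carrier R. y = g \<oplus> x [^] (k::nat) \<otimes> a"
    if "y \<in> C n" "N \<le> n" for k n y
    using that
  proof (induction k arbitrary: n y)
    case 0
    then show ?case
      using Gd(3) idealD(2)[OF C] by (intro bexI[of _ \<zero>] bexI[of _ y]) auto
  next
    case (Suc k)
    have "y \<in> adjoin R G x"
      using Suc.prems L(2) N G(3) by blast
    then obtain g a where ga: "g \<in> G" "a \<in> C (Suc n)" "y = g \<oplus> x \<otimes> a"
      using split[of G n y] Suc.prems G(2) C_mono by blast
    obtain h b where hb: "h \<in> G" "b \<in> carrier R" "a = h \<oplus> x [^] k \<otimes> b"
      using Suc.IH[OF ga(2)] Suc.prems by auto
    have "y = (g \<oplus> x \<otimes> h) \<oplus> x [^] Suc k \<otimes> b"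
      using ga(1) hb(1,2) x Gd(2)[OF ga(1)] Gd(2)[OF hb(1)] unfolding ga(3) hb(3)
      by (simp add: r_distr a_assoc m_assoc[symmetric] m_comm)
    moreover have "g \<oplus> x \<otimes> h \<in> G"
      using Gd(4,7) ga hb x by simp
    ultimately show ?case using hb(2) by blast
  qed
  have "C N \<subseteq> G"
    using cl[OF G(1)] approx[of _ N] idealD(2)[OF C] by blast
  then have "fg_ideal R (C N)"
    using G by (simp add: subset_antisym)
  moreover have "fg_ideal R (C n)" if H: "fg_ideal R (C (Suc n))" for n
  proof -
    obtain G where G: "fg_ideal R G" "G \<subseteq> C n" "L n \<subseteq> adjoin R G x"
      using lift by blast
    have "C n = {g \<oplus> x \<otimes> h | g h. g \<in> G \<and> h \<in> C (Suc n)}"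
    proof (intro equalityI subsetI)
      fix y assume "y \<in> C n"
      then show "y \<in> {g \<oplus> x \<otimes> h | g h. g \<in> G \<and> h \<in> C (Suc n)}"
        using split[OF G(2)] L(2) G(3) by blast
    next
      fix y assume "y \<in> {g \<oplus> x \<otimes> h | g h. g \<in> G \<and> h \<in> C (Suc n)}"
      then show "y \<in> C n"
        using G(2) by (auto simp: C_Suc intro!: idealD(4)[OF C])
    qed
    then show ?thesis
      using fg_ideal_sum_mult[OF H G(1) x] by simp
  qed
  ultimately have "fg_ideal R (C 0)"
    by (induction N) auto
  then show ?thesis by (simp add: C0)
qed

end

section \<open>Ideals of a localization\<close>

locale localized_ring = cring A for A (structure) +
  fixes T
  assumes mult_T: "mult_subset A T"
begin

abbreviation Loc where "Loc \<equiv> localization A T"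

lemma T_carrier: "t \<in> T \<Longrightarrow> t \<in> carrier A"
  and one_T: "\<one> \<in> T"
  and T_mult: "s \<in> T \<Longrightarrow> t \<in> T \<Longrightarrow> s \<otimes> t \<in> T"
  using mult_T by (auto simp: mult_subset_def)

text \<open>Subtraction-free form, so that the equalities below can be multiplied together and
  rearranged by the ring laws.\<close>

lemma loc_rel_iff:
  "((a, s), (b, t)) \<in> loc_rel A T \<longleftrightarrow> a \<in> carrier A \<and> s \<in> T \<and> b \<in> carrier A \<and> t \<in> T \<and>
     (\<exists>u\<in>T. u \<otimes> (a \<otimes> t) = u \<otimes> (b \<otimes> s))"
proof -
  have "u \<otimes> (a \<otimes> t \<ominus> b \<otimes> s) = \<zero> \<longleftrightarrow> u \<otimes> (a \<otimes> t) = u \<otimes> (b \<otimes> s)"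
    if "a \<in> carrier A" "s \<in> T" "b \<in> carrier A" "t \<in> T" "u \<in> T" for u
  proof -
    have "u \<otimes> (a \<otimes> t \<ominus> b \<otimes> s) = u \<otimes> (a \<otimes> t) \<ominus> u \<otimes> (b \<otimes> s)"
      using that T_carrier by (simp add: a_minus_def r_distr r_minus)
    then show ?thesis
      using that T_carrier by simp
  qed
  then show ?thesis
    unfolding loc_rel_def by blast
qed

lemma loc_rel_equiv: "equiv (carrier A \<times> T) (loc_rel A T)"
proof (rule equivI)
  show "loc_rel A T \<subseteq> (carrier A \<times> T) \<times> (carrier A \<times> T)"
    by (auto simp: loc_rel_def)
  show "refl_on (carrier A \<times> T) (loc_rel A T)"
    unfolding refl_on_def using one_T by (auto simp: loc_rel_iff)
  show "sym (loc_rel A T)"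
    by (rule symI) (clarsimp simp: loc_rel_iff, metis)
  show "trans (loc_rel A T)"
  proof (rule transI)
    fix x y z assume xy: "(x, y) \<in> loc_rel A T" and yz: "(y, z) \<in> loc_rel A T"
    obtain a s b t c r where x: "x = (a, s)" "y = (b, t)" "z = (c, r)"
      by (cases x, cases y, cases z)
    obtain u where u: "u \<in> T" "u \<otimes> (a \<otimes> t) = u \<otimes> (b \<otimes> s)"
      using xy by (auto simp: x loc_rel_iff)
    obtain v where v: "v \<in> T" "v \<otimes> (b \<otimes> r) = v \<otimes> (c \<otimes> t)"
      using yz by (auto simp: x loc_rel_iff)
    have m: "a \<in> carrier A" "s \<in> T" "b \<in> carrier A" "t \<in> T" "c \<in> carrier A" "r \<in> T"
      using xy yz by (auto simp: x loc_rel_iff)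
    note c = m(1,3,5) m(2,4,6)[THEN T_carrier] u(1)[THEN T_carrier] v(1)[THEN T_carrier]
    \<comment> \<open>The witness carries the middle denominator t besides u and v, since t may be a
      zero divisor and cannot be cancelled.\<close>
    have "(u \<otimes> v \<otimes> t) \<otimes> (a \<otimes> r) = (v \<otimes> r) \<otimes> (u \<otimes> (a \<otimes> t))"
      using c by (simp add: m_ac)
    also have "\<dots> = (u \<otimes> s) \<otimes> (v \<otimes> (b \<otimes> r))"
      unfolding u(2) using c by (simp add: m_ac)
    also have "\<dots> = (u \<otimes> v \<otimes> t) \<otimes> (c \<otimes> s)"
      unfolding v(2) using c by (simp add: m_ac)
    finally have "(u \<otimes> v \<otimes> t) \<otimes> (a \<otimes> r) = (u \<otimes> v \<otimes> t) \<otimes> (c \<otimes> s)" .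
    moreover have "u \<otimes> v \<otimes> t \<in> T"
      using u v m T_mult by simp
    ultimately show "(x, z) \<in> loc_rel A T"
      using m by (auto simp: x loc_rel_iff)
  qed
qed

lemma frac_eq_iff:
  assumes "a \<in> carrier A" "s \<in> T" "b \<in> carrier A" "t \<in> T"
  shows "frac A T a s = frac A T b t \<longleftrightarrow> (\<exists>u\<in>T. u \<otimes> (a \<otimes> t) = u \<otimes> (b \<otimes> s))"
  unfolding frac_def using eq_equiv_class_iff[OF loc_rel_equiv, of "(a, s)" "(b, t)"] assms
  by (simp add: loc_rel_iff)

lemma frac_eqI:
  assumes "a \<in> carrier A" "s \<in> T" "b \<in> carrier A" "t \<in> T" "a \<otimes> t = b \<otimes> s"
  shows "frac A T a s = frac A T b t"
  using assms one_T by (auto simp: frac_eq_iff)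

lemma mem_frac_iff:
  assumes "a \<in> carrier A" "s \<in> T"
  shows "(b, t) \<in> frac A T a s \<longleftrightarrow> b \<in> carrier A \<and> t \<in> T \<and> frac A T b t = frac A T a s"
proof -
  have "(b, t) \<in> frac A T a s \<longleftrightarrow> b \<in> carrier A \<and> t \<in> T \<and> (\<exists>u\<in>T. u \<otimes> (a \<otimes> t) = u \<otimes> (b \<otimes> s))"
    by (simp add: frac_def loc_rel_iff assms)
  then show ?thesis
    using frac_eq_iff[OF assms, of b t] by auto
qed

lemma carrier_Loc: "carrier Loc = {frac A T a s | a s. a \<in> carrier A \<and> s \<in> T}"
  by (auto simp: localization_def quotient_def frac_def)

lemma LocE:
  assumes "x \<in> carrier Loc"
  obtains a s where "a \<in> carrier A" "s \<in> T" "x = frac A T a s"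
  using assms by (auto simp: carrier_Loc)

lemma frac_closed: "a \<in> carrier A \<Longrightarrow> s \<in> T \<Longrightarrow> frac A T a s \<in> carrier Loc"
  by (auto simp: carrier_Loc)

lemma Loc_one: "\<one>\<^bsub>Loc\<^esub> = frac A T \<one> \<one>"
  and Loc_zero: "\<zero>\<^bsub>Loc\<^esub> = frac A T \<zero> \<one>"
  by (simp_all add: localization_def)

text \<open>The product is defined as a union over all representatives; the resulting class is
  independent of them, so the union is over a single set.\<close>

lemma Loc_mult:
  assumes as: "a \<in> carrier A" "s \<in> T" and bt: "b \<in> carrier A" "t \<in> T"
  shows "frac A T a s \<otimes>\<^bsub>Loc\<^esub> frac A T b t = frac A T (a \<otimes> b) (s \<otimes> t)"
proof -
  have "frac A T (a' \<otimes> b') (s' \<otimes> t') = frac A T (a \<otimes> b) (s \<otimes> t)"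
    if a's': "(a', s') \<in> frac A T a s" and b't': "(b', t') \<in> frac A T b t" for a' s' b' t'
  proof -
    have m: "a' \<in> carrier A" "s' \<in> T" "b' \<in> carrier A" "t' \<in> T"
      using a's' b't' assms by (auto simp: mem_frac_iff)
    obtain u where u: "u \<in> T" "u \<otimes> (a' \<otimes> s) = u \<otimes> (a \<otimes> s')"
      using a's' as by (auto simp: mem_frac_iff frac_eq_iff)
    obtain v where v: "v \<in> T" "v \<otimes> (b' \<otimes> t) = v \<otimes> (b \<otimes> t')"
      using b't' bt by (auto simp: mem_frac_iff frac_eq_iff)
    note c = as bt m assms(2,4)[THEN T_carrier] m(2,4)[THEN T_carrier] u(1)[THEN T_carrier] v(1)[THEN T_carrier]
    have "(u \<otimes> v) \<otimes> ((a' \<otimes> b') \<otimes> (s \<otimes> t)) = (u \<otimes> (a' \<otimes> s)) \<otimes> (v \<otimes> (b' \<otimes> t))"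
      using c by (simp add: m_ac)
    also have "\<dots> = (u \<otimes> v) \<otimes> ((a \<otimes> b) \<otimes> (s' \<otimes> t'))"
      unfolding u(2) v(2) using c by (simp add: m_ac)
    finally show ?thesis
      using u v c by (subst frac_eq_iff) (auto intro: T_mult)
  qed
  moreover have "(a, s) \<in> frac A T a s" "(b, t) \<in> frac A T b t"
    using assms by (auto simp: mem_frac_iff)
  ultimately have "{frac A T (a' \<otimes> b') (s' \<otimes> t') | a' s' b' t'. (a', s') \<in> frac A T a s \<and> (b', t') \<in> frac A T b t}
      = {frac A T (a \<otimes> b) (s \<otimes> t)}"
    by blast
  then show ?thesis by (simp add: localization_def)
qed

lemma Loc_add:
  assumes as: "a \<in> carrier A" "s \<in> T" and bt: "b \<in> carrier A" "t \<in> T"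
  shows "frac A T a s \<oplus>\<^bsub>Loc\<^esub> frac A T b t = frac A T (a \<otimes> t \<oplus> b \<otimes> s) (s \<otimes> t)"
proof -
  have "frac A T (a' \<otimes> t' \<oplus> b' \<otimes> s') (s' \<otimes> t') = frac A T (a \<otimes> t \<oplus> b \<otimes> s) (s \<otimes> t)"
    if a's': "(a', s') \<in> frac A T a s" and b't': "(b', t') \<in> frac A T b t" for a' s' b' t'
  proof -
    have m: "a' \<in> carrier A" "s' \<in> T" "b' \<in> carrier A" "t' \<in> T"
      using a's' b't' assms by (auto simp: mem_frac_iff)
    obtain u where u: "u \<in> T" "u \<otimes> (a' \<otimes> s) = u \<otimes> (a \<otimes> s')"
      using a's' as by (auto simp: mem_frac_iff frac_eq_iff)
    obtain v where v: "v \<in> T" "v \<otimes> (b' \<otimes> t) = v \<otimes> (b \<otimes> t')"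
      using b't' bt by (auto simp: mem_frac_iff frac_eq_iff)
    note c = as bt m assms(2,4)[THEN T_carrier] m(2,4)[THEN T_carrier] u(1)[THEN T_carrier] v(1)[THEN T_carrier]
    have "(u \<otimes> v) \<otimes> ((a' \<otimes> t' \<oplus> b' \<otimes> s') \<otimes> (s \<otimes> t))
        = (u \<otimes> (a' \<otimes> s)) \<otimes> (v \<otimes> t \<otimes> t') \<oplus> (v \<otimes> (b' \<otimes> t)) \<otimes> (u \<otimes> s \<otimes> s')"
      using c by (simp add: m_ac l_distr r_distr)
    also have "\<dots> = (u \<otimes> v) \<otimes> ((a \<otimes> t \<oplus> b \<otimes> s) \<otimes> (s' \<otimes> t'))"
      unfolding u(2) v(2) using c by (simp add: m_ac l_distr r_distr)
    finally show ?thesis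
      using u v c by (subst frac_eq_iff) (auto intro: T_mult)
  qed
  moreover have "(a, s) \<in> frac A T a s" "(b, t) \<in> frac A T b t"
    using assms by (auto simp: mem_frac_iff)
  ultimately have "{frac A T (a' \<otimes> t' \<oplus> b' \<otimes> s') (s' \<otimes> t') | a' s' b' t'.
      (a', s') \<in> frac A T a s \<and> (b', t') \<in> frac A T b t} = {frac A T (a \<otimes> t \<oplus> b \<otimes> s) (s \<otimes> t)}"
    by blast
  then show ?thesis by (simp add: localization_def)
qed

lemma Loc_cring: "cring Loc"
proof (rule cringI)
  show "abelian_group Loc"
  proof (rule abelian_groupI)
    fix x y z assume xyz: "x \<in> carrier Loc" "y \<in> carrier Loc" "z \<in> carrier Loc"
    obtain a s where x: "a \<in> carrier A" "s \<in> T" "x = frac A T a s" using xyz(1) by (rule LocE)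
    obtain b t where y: "b \<in> carrier A" "t \<in> T" "y = frac A T b t" using xyz(2) by (rule LocE)
    obtain c r where z: "c \<in> carrier A" "r \<in> T" "z = frac A T c r" using xyz(3) by (rule LocE)
    note c = x(1,2) y(1,2) z(1,2) T_carrier[OF x(2)] T_carrier[OF y(2)] T_carrier[OF z(2)]
      T_mult[OF x(2) y(2)] T_mult[OF y(2) z(2)] T_mult[OF T_mult[OF x(2) y(2)] z(2)]
      T_mult[OF x(2) T_mult[OF y(2) z(2)]] T_mult[OF y(2) x(2)]
    show "x \<oplus>\<^bsub>Loc\<^esub> y \<in> carrier Loc"
      using c by (simp add: x(3) y(3) Loc_add frac_closed)
    show "x \<oplus>\<^bsub>Loc\<^esub> y = y \<oplus>\<^bsub>Loc\<^esub> x"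
      using c by (simp add: x(3) y(3) Loc_add a_comm m_comm)
    show "x \<oplus>\<^bsub>Loc\<^esub> y \<oplus>\<^bsub>Loc\<^esub> z = x \<oplus>\<^bsub>Loc\<^esub> (y \<oplus>\<^bsub>Loc\<^esub> z)"
      using c by (simp add: x(3) y(3) z(3) Loc_add l_distr r_distr m_ac a_ac)
  next
    fix x assume "x \<in> carrier Loc"
    then obtain a s where x: "a \<in> carrier A" "s \<in> T" "x = frac A T a s" by (rule LocE)
    note c = x(1,2) T_carrier[OF x(2)] one_T
    show "\<zero>\<^bsub>Loc\<^esub> \<oplus>\<^bsub>Loc\<^esub> x = x"
      using c by (simp add: x(3) Loc_zero Loc_add)
    have "frac A T (\<ominus> a) s \<oplus>\<^bsub>Loc\<^esub> x = frac A T \<zero> \<one>"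
      unfolding x(3) using c T_mult[OF x(2) x(2)]
      by (auto simp: Loc_add l_minus l_neg frac_eq_iff)
    then show "\<exists>y\<in>carrier Loc. y \<oplus>\<^bsub>Loc\<^esub> x = \<zero>\<^bsub>Loc\<^esub>"
      using c by (intro bexI[of _ "frac A T (\<ominus> a) s"]) (auto simp: Loc_zero frac_closed)
  qed (simp add: Loc_zero frac_closed one_T)
  show "comm_monoid Loc"
  proof (rule comm_monoidI)
    fix x y z assume xyz: "x \<in> carrier Loc" "y \<in> carrier Loc" "z \<in> carrier Loc"
    obtain a s where x: "a \<in> carrier A" "s \<in> T" "x = frac A T a s" using xyz(1) by (rule LocE)
    obtain b t where y: "b \<in> carrier A" "t \<in> T" "y = frac A T b t" using xyz(2) by (rule LocE)
    obtain c r where z: "c \<in> carrier A" "r \<in> T" "z = frac A T c r" using xyz(3) by (rule LocE)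
    note c = x(1,2) y(1,2) z(1,2) T_carrier[OF x(2)] T_carrier[OF y(2)] T_carrier[OF z(2)]
      T_mult[OF x(2) y(2)] T_mult[OF y(2) z(2)] T_mult[OF T_mult[OF x(2) y(2)] z(2)]
    show "x \<otimes>\<^bsub>Loc\<^esub> y \<in> carrier Loc"
      using c by (simp add: x(3) y(3) Loc_mult frac_closed)
    show "x \<otimes>\<^bsub>Loc\<^esub> y = y \<otimes>\<^bsub>Loc\<^esub> x"
      using c by (simp add: x(3) y(3) Loc_mult m_comm)
    show "x \<otimes>\<^bsub>Loc\<^esub> y \<otimes>\<^bsub>Loc\<^esub> z = x \<otimes>\<^bsub>Loc\<^esub> (y \<otimes>\<^bsub>Loc\<^esub> z)"
      using c by (simp add: x(3) y(3) z(3) Loc_mult m_assoc)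
    show "\<one>\<^bsub>Loc\<^esub> \<otimes>\<^bsub>Loc\<^esub> x = x"
      using c one_T by (simp add: x(3) Loc_one Loc_mult)
  qed (simp add: Loc_one frac_closed one_T)
  fix x y z assume xyz: "x \<in> carrier Loc" "y \<in> carrier Loc" "z \<in> carrier Loc"
  obtain a s where x: "a \<in> carrier A" "s \<in> T" "x = frac A T a s" using xyz(1) by (rule LocE)
  obtain b t where y: "b \<in> carrier A" "t \<in> T" "y = frac A T b t" using xyz(2) by (rule LocE)
  obtain c r where z: "c \<in> carrier A" "r \<in> T" "z = frac A T c r" using xyz(3) by (rule LocE)
  note c = x(1,2) y(1,2) z(1,2) T_carrier[OF x(2)] T_carrier[OF y(2)] T_carrier[OF z(2)]
    T_mult[OF x(2) y(2)] T_mult[OF y(2) z(2)] T_mult[OF x(2) z(2)] T_mult[OF T_mult[OF x(2) y(2)] z(2)]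
    T_mult[OF T_mult[OF x(2) z(2)] T_mult[OF y(2) z(2)]]
  show "(x \<oplus>\<^bsub>Loc\<^esub> y) \<otimes>\<^bsub>Loc\<^esub> z = x \<otimes>\<^bsub>Loc\<^esub> z \<oplus>\<^bsub>Loc\<^esub> y \<otimes>\<^bsub>Loc\<^esub> z"
    unfolding x(3) y(3) z(3) using c
    by (simp add: Loc_add Loc_mult) (rule frac_eqI, simp_all add: l_distr r_distr m_ac)
qed

text \<open>These are exactly the contractions of ideals of the localization, the whole ring
  included; they make the ideal theory of the localization visible inside \<open>A\<close>.\<close>

definition saturated :: "'a set \<Rightarrow> bool" where
  "saturated I \<longleftrightarrow> ideal I A \<and> (\<forall>t\<in>T. \<forall>a\<in>carrier A. t \<otimes> a \<in> I \<longrightarrow> a \<in> I)"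

definition contraction :: "('a \<times> 'a) set set \<Rightarrow> 'a set" where
  "contraction J = {a \<in> carrier A. frac A T a \<one> \<in> J}"

text \<open>Denominators become units, so membership in an ideal of the localization depends on the
  numerator alone.\<close>

lemma frac_mem_ideal_iff:
  assumes "ideal J Loc" "a \<in> carrier A" "s \<in> T"
  shows "frac A T a s \<in> J \<longleftrightarrow> frac A T a \<one> \<in> J"
proof
  note J = idealD[OF assms(1)]
  have s: "s \<in> carrier A" using assms(3) by (rule T_carrier)
  {
    assume "frac A T a s \<in> J"
    then have "frac A T s \<one> \<otimes>\<^bsub>Loc\<^esub> frac A T a s \<in> J"
      using s one_T by (intro J(7)) (auto intro: frac_closed)
    also have "frac A T s \<one> \<otimes>\<^bsub>Loc\<^esub> frac A T a s = frac A T a \<one>"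
      using assms s one_T by (simp add: Loc_mult) (rule frac_eqI, simp_all add: m_ac)
    finally show "frac A T a \<one> \<in> J" .
  }
  {
    assume "frac A T a \<one> \<in> J"
    then have "frac A T \<one> s \<otimes>\<^bsub>Loc\<^esub> frac A T a \<one> \<in> J"
      using assms by (intro J(7)) (auto intro: frac_closed)
    then show "frac A T a s \<in> J"
      using assms s one_T by (simp add: Loc_mult)
  }
qed

lemma contraction_saturated:
  assumes "ideal J Loc"
  shows "saturated (contraction J)"
  unfolding saturated_def
proof (intro conjI ballI impI ideal_memI)
  note J = idealD[OF assms]
  show "contraction J \<subseteq> carrier A" by (auto simp: contraction_def)
  show "\<zero> \<in> contraction J" using J(3) by (simp add: contraction_def Loc_zero)
  fix a b assume ab: "a \<in> contraction J" "b \<in> contraction J"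
  then have "frac A T a \<one> \<oplus>\<^bsub>Loc\<^esub> frac A T b \<one> \<in> J"
    using J(4) by (auto simp: contraction_def)
  then show "a \<oplus> b \<in> contraction J"
    using ab one_T by (simp add: contraction_def Loc_add)
next
  note J = idealD[OF assms]
  fix r a assume ra: "r \<in> carrier A" "a \<in> contraction J"
  then have "frac A T r \<one> \<otimes>\<^bsub>Loc\<^esub> frac A T a \<one> \<in> J"
    using one_T by (intro J(7)) (auto simp: contraction_def frac_closed)
  then show "r \<otimes> a \<in> contraction J"
    using ra one_T by (simp add: contraction_def Loc_mult)
next
  note J = idealD[OF assms]
  fix t a assume ta: "t \<in> T" "a \<in> carrier A" "t \<otimes> a \<in> contraction J"
  then have "frac A T (t \<otimes> a) t \<in> J"
    using frac_mem_ideal_iff[OF assms] by (simp add: contraction_def T_carrier)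
  also have "frac A T (t \<otimes> a) t = frac A T a \<one>"
    using ta one_T T_carrier by (intro frac_eqI) (auto simp: m_comm)
  finally show "a \<in> contraction J"
    using ta by (simp add: contraction_def)
qed

text \<open>Fractions with numerator in \<open>I\<close> are closed under addition by passing to a
  common denominator, so generating an ideal from them adds nothing.\<close>

lemma ext_ideal_eq:
  assumes "ideal I A"
  shows "ext_ideal A T I = {frac A T a s | a s. a \<in> I \<and> s \<in> T}" (is "_ = ?F")
    and "ideal (ext_ideal A T I) Loc"
proof -
  interpret L: cring Loc by (rule Loc_cring)
  note I = idealD[OF assms]
  have sub: "(\<lambda>a. frac A T a \<one>) ` I \<subseteq> carrier Loc"
    using I(2) one_T by (auto intro: frac_closed)
  show ext: "ideal (ext_ideal A T I) Loc"
    unfolding ext_ideal_def by (rule L.genideal_ideal[OF sub])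
  have F: "ideal ?F Loc"
  proof (rule L.ideal_memI)
    show "?F \<subseteq> carrier Loc" using I(2) by (auto intro: frac_closed)
    show "\<zero>\<^bsub>Loc\<^esub> \<in> ?F" using I(3) one_T by (auto simp: Loc_zero)
    fix x y assume "x \<in> ?F" "y \<in> ?F"
    then obtain a s b t where *: "a \<in> I" "s \<in> T" "b \<in> I" "t \<in> T"
      "x = frac A T a s" "y = frac A T b t"
      by blast
    have "x \<oplus>\<^bsub>Loc\<^esub> y = frac A T (a \<otimes> t \<oplus> b \<otimes> s) (s \<otimes> t)"
      using * I(2) by (simp add: Loc_add)
    moreover have "a \<otimes> t \<oplus> b \<otimes> s \<in> I" "s \<otimes> t \<in> T"
      using * I(4,8) T_carrier T_mult by auto
    ultimately show "x \<oplus>\<^bsub>Loc\<^esub> y \<in> ?F" by blast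
  next
    fix r x assume "r \<in> carrier Loc" "x \<in> ?F"
    then obtain a s b t where *: "a \<in> carrier A" "s \<in> T" "b \<in> I" "t \<in> T"
      "r = frac A T a s" "x = frac A T b t"
      by (auto elim!: LocE)
    have "r \<otimes>\<^bsub>Loc\<^esub> x = frac A T (a \<otimes> b) (s \<otimes> t)"
      using * I(2) by (simp add: Loc_mult)
    moreover have "a \<otimes> b \<in> I" "s \<otimes> t \<in> T"
      using * I(7) T_mult by auto
    ultimately show "r \<otimes>\<^bsub>Loc\<^esub> x \<in> ?F" by blast
  qed
  show "ext_ideal A T I = ?F"
  proof
    show "ext_ideal A T I \<subseteq> ?F"
      unfolding ext_ideal_def using F one_T by (intro L.genideal_minimal) auto
    show "?F \<subseteq> ext_ideal A T I"
      using L.genideal_self[OF sub] frac_mem_ideal_iff[OF ext] I(2)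
      by (auto simp: ext_ideal_def[symmetric])
  qed
qed

text \<open>From a/1 = b/t with b in \<open>I\<close> one gets (u t) a = u b in \<open>I\<close>,
  and saturation cancels u t, an element of \<open>T\<close>.\<close>

lemma contraction_ext_ideal:
  assumes "saturated I"
  shows "contraction (ext_ideal A T I) = I"
proof -
  have I: "ideal I A" and sat: "\<And>t a. t \<in> T \<Longrightarrow> a \<in> carrier A \<Longrightarrow> t \<otimes> a \<in> I \<Longrightarrow> a \<in> I"
    using assms by (auto simp: saturated_def)
  note Id = idealD[OF I]
  show ?thesis
  proof (intro equalityI subsetI)
    fix a assume "a \<in> contraction (ext_ideal A T I)"
    then obtain b t where b: "a \<in> carrier A" "b \<in> I" "t \<in> T" "frac A T a \<one> = frac A T b t"
      by (auto simp: contraction_def ext_ideal_eq[OF I])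
    then obtain u where u: "u \<in> T" "u \<otimes> (a \<otimes> t) = u \<otimes> (b \<otimes> \<one>)"
      using Id(2) one_T by (auto simp: frac_eq_iff)
    have "(u \<otimes> t) \<otimes> a = u \<otimes> b"
      using u b Id(2) T_carrier by (simp add: m_ac)
    then have "(u \<otimes> t) \<otimes> a \<in> I"
      using Id(7) u b T_carrier by simp
    then show "a \<in> I"
      using sat[of "u \<otimes> t" a] u b T_mult by simp
  next
    fix a assume "a \<in> I"
    then show "a \<in> contraction (ext_ideal A T I)"
      using Id(2) one_T by (auto simp: contraction_def ext_ideal_eq[OF I])
  qed
qed

lemma ext_ideal_contraction:
  assumes "ideal J Loc"
  shows "ext_ideal A T (contraction J) = J"
proof -
  have I: "ideal (contraction J) A"
    using contraction_saturated[OF assms] by (simp add: saturated_def)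
  have "x \<in> ext_ideal A T (contraction J) \<longleftrightarrow> x \<in> J" for x
  proof
    assume "x \<in> ext_ideal A T (contraction J)"
    then obtain a s where "a \<in> contraction J" "s \<in> T" "x = frac A T a s"
      unfolding ext_ideal_eq(1)[OF I] by blast
    then show "x \<in> J"
      using frac_mem_ideal_iff[OF assms] by (simp add: contraction_def)
  next
    assume x: "x \<in> J"
    then obtain a s where as: "a \<in> carrier A" "s \<in> T" "x = frac A T a s"
      using idealD(2)[OF assms] LocE by metis
    then have "a \<in> contraction J"
      using x frac_mem_ideal_iff[OF assms] by (simp add: contraction_def)
    then show "x \<in> ext_ideal A T (contraction J)"
      using as by (auto simp: ext_ideal_eq(1)[OF I])
  qed
  then show ?thesis by blast
qed

lemma ext_ideal_mono: "ideal I A \<Longrightarrow> ideal J A \<Longrightarrow> I \<subseteq> J \<Longrightarrow> ext_ideal A T I \<subseteq> ext_ideal A T J"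
  unfolding ext_ideal_eq(1) by blast

lemma ext_ideal_carrier: "ext_ideal A T (carrier A) = carrier Loc"
  by (simp add: ext_ideal_eq(1)[OF oneideal] carrier_Loc)

text \<open>Maximal among proper saturated ideals only; it need not be a maximal ideal of
  \<open>A\<close>, as zero in a domain shows when \<open>T\<close> consists of all nonzero
  elements.\<close>

definition maximal_saturated :: "'a set \<Rightarrow> bool" where
  "maximal_saturated I \<longleftrightarrow> saturated I \<and> I \<noteq> carrier A \<and>
     (\<forall>J. saturated J \<and> I \<subseteq> J \<longrightarrow> J = I \<or> J = carrier A)"

lemma contraction_carrier: "contraction (carrier Loc) = carrier A"
  using one_T by (auto simp: contraction_def frac_closed)

text \<open>Extension and contraction are mutually inverse and monotone between saturated ideals and
  ideals of the localization, and they match the two unit ideals.\<close>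

lemma maximalideal_ext_ideal_iff:
  assumes "saturated I"
  shows "maximalideal (ext_ideal A T I) Loc \<longleftrightarrow> maximal_saturated I"
proof
  have I: "ideal I A" using assms by (simp add: saturated_def)
  {
    assume "maximalideal (ext_ideal A T I) Loc"
    then interpret M: maximalideal "ext_ideal A T I" Loc .
    show "maximal_saturated I"
      unfolding maximal_saturated_def
    proof (intro conjI allI impI)
      show "saturated I" by fact
      show "I \<noteq> carrier A" using M.I_notcarr ext_ideal_carrier by auto
      fix J assume J: "saturated J \<and> I \<subseteq> J"
      then have "ideal J A" by (simp add: saturated_def)
      then have "ext_ideal A T J = ext_ideal A T I \<or> ext_ideal A T J = carrier Loc"
        using J I ext_ideal_mono idealD(1)[OF ext_ideal_eq(2)] by (intro M.I_maximal ext_ideal_eq(2)) auto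
      then show "J = I \<or> J = carrier A"
        using contraction_ext_ideal J assms contraction_carrier by metis
    qed
  }
  {
    assume ms: "maximal_saturated I"
    show "maximalideal (ext_ideal A T I) Loc"
    proof (rule maximalidealI)
      show "ideal (ext_ideal A T I) Loc" using I by (rule ext_ideal_eq)
      show "carrier Loc \<noteq> ext_ideal A T I"
        using ms contraction_ext_ideal[OF assms] contraction_carrier
        by (auto simp: maximal_saturated_def)
      fix J assume J: "ideal J Loc" "ext_ideal A T I \<subseteq> J"
      have "contraction (ext_ideal A T I) \<subseteq> contraction J"
        using J by (auto simp: contraction_def)
      then have "contraction J = I \<or> contraction J = carrier A"
        using ms contraction_saturated[OF J(1)] contraction_ext_ideal[OF assms]
        by (auto simp: maximal_saturated_def)
      then show "J = ext_ideal A T I \<or> J = carrier Loc"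
        using ext_ideal_contraction[OF J(1)] ext_ideal_carrier by metis
    qed
  }
qed

lemma prime_saturated:
  assumes "primeideal P A" "P \<inter> T = {}"
  shows "saturated P"
proof -
  interpret primeideal P A by fact
  show ?thesis
    unfolding saturated_def using is_ideal I_prime assms(2) T_carrier by blast
qed

end

section \<open>Annihilators\<close>

text \<open>Stated for any ring and module, so that the same facts serve R acting on E and the
  completion acting on E; over the completion they become \<open>ann_hat\<close> and
  \<open>ann_mod\<close>.\<close>

definition ann_ring :: "('a, 'b) ring_scheme \<Rightarrow> ('a, 'c, 'd) module_scheme \<Rightarrow> 'c set \<Rightarrow> 'a set" where
  "ann_ring R M N = {r \<in> carrier R. \<forall>e\<in>N. r \<odot>\<^bsub>M\<^esub> e = \<zero>\<^bsub>M\<^esub>}"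

definition ann_elems :: "('a, 'c, 'd) module_scheme \<Rightarrow> 'a set \<Rightarrow> 'c set" where
  "ann_elems M I = {e \<in> carrier M. \<forall>r\<in>I. r \<odot>\<^bsub>M\<^esub> e = \<zero>\<^bsub>M\<^esub>}"

context module
begin

lemma submodule_memI:
  assumes "N \<subseteq> carrier M" "\<zero>\<^bsub>M\<^esub> \<in> N"
    and "\<And>x y. x \<in> N \<Longrightarrow> y \<in> N \<Longrightarrow> x \<oplus>\<^bsub>M\<^esub> y \<in> N"
    and "\<And>r x. r \<in> carrier R \<Longrightarrow> x \<in> N \<Longrightarrow> r \<odot>\<^bsub>M\<^esub> x \<in> N"
  shows "submodule N R M"
proof (rule submoduleI)
  fix x assume "x \<in> N"
  then show "\<ominus>\<^bsub>M\<^esub> x \<in> N"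
    using assms(1) assms(4)[of "\<ominus> \<one>" x] by (auto simp: smult_l_minus)
qed (use assms in auto)

lemma submoduleD:
  assumes "submodule N R M"
  shows "\<And>x. x \<in> N \<Longrightarrow> x \<in> carrier M" "\<zero>\<^bsub>M\<^esub> \<in> N"
    and "\<And>x y. x \<in> N \<Longrightarrow> y \<in> N \<Longrightarrow> x \<oplus>\<^bsub>M\<^esub> y \<in> N"
    and "\<And>r x. r \<in> carrier R \<Longrightarrow> x \<in> N \<Longrightarrow> r \<odot>\<^bsub>M\<^esub> x \<in> N"
    and "\<And>x y. x \<in> N \<Longrightarrow> y \<in> N \<Longrightarrow> x \<ominus>\<^bsub>M\<^esub> y \<in> N"
proof -
  note N = submoduleE[OF assms]
  show "\<And>x. x \<in> N \<Longrightarrow> x \<in> carrier M" using N by auto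
  show add: "\<And>x y. x \<in> N \<Longrightarrow> y \<in> N \<Longrightarrow> x \<oplus>\<^bsub>M\<^esub> y \<in> N" by (rule N)
  show "\<And>r x. r \<in> carrier R \<Longrightarrow> x \<in> N \<Longrightarrow> r \<odot>\<^bsub>M\<^esub> x \<in> N" by (rule N)
  show "\<And>x y. x \<in> N \<Longrightarrow> y \<in> N \<Longrightarrow> x \<ominus>\<^bsub>M\<^esub> y \<in> N"
    unfolding a_minus_def by (intro add N(3))
  obtain x where x: "x \<in> N" using N(2) by auto
  then have "\<zero> \<odot>\<^bsub>M\<^esub> x \<in> N" by (intro N(4)) auto
  then show "\<zero>\<^bsub>M\<^esub> \<in> N" using x N(1) by auto
qed

lemma submodule_Int:
  assumes "submodule N R M" "submodule N' R M"
  shows "submodule (N \<inter> N') R M"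
  using submoduleD[OF assms(1)] submoduleD[OF assms(2)] by (intro submodule_memI) auto

lemma smult_minus_distr:
  "a \<in> carrier R \<Longrightarrow> b \<in> carrier R \<Longrightarrow> x \<in> carrier M \<Longrightarrow>
    (a \<ominus> b) \<odot>\<^bsub>M\<^esub> x = a \<odot>\<^bsub>M\<^esub> x \<ominus>\<^bsub>M\<^esub> b \<odot>\<^bsub>M\<^esub> x"
  by (simp add: a_minus_def smult_l_distr smult_l_minus)

lemma smult_commute:
  "a \<in> carrier R \<Longrightarrow> b \<in> carrier R \<Longrightarrow> x \<in> carrier M \<Longrightarrow>
    a \<odot>\<^bsub>M\<^esub> (b \<odot>\<^bsub>M\<^esub> x) = b \<odot>\<^bsub>M\<^esub> (a \<odot>\<^bsub>M\<^esub> x)"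
  by (simp add: smult_assoc1[symmetric] R.m_comm)

lemma smult_image_submodule:
  assumes N: "submodule N R M" and t: "t \<in> carrier R"
  shows "submodule ((\<lambda>f. t \<odot>\<^bsub>M\<^esub> f) ` N) R M" (is "submodule ?N' R M")
proof (rule submodule_memI)
  note Nd = submoduleD[OF N]
  show "?N' \<subseteq> carrier M" using Nd(1) t by auto
  show "\<zero>\<^bsub>M\<^esub> \<in> ?N'" using Nd(2) t by (auto intro!: image_eqI[of _ _ "\<zero>\<^bsub>M\<^esub>"])
  fix x y assume "x \<in> ?N'" "y \<in> ?N'"
  then obtain f g where fg: "f \<in> N" "g \<in> N" "x = t \<odot>\<^bsub>M\<^esub> f" "y = t \<odot>\<^bsub>M\<^esub> g"
    by auto
  then have "x \<oplus>\<^bsub>M\<^esub> y = t \<odot>\<^bsub>M\<^esub> (f \<oplus>\<^bsub>M\<^esub> g)"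
    using Nd(1) t by (simp add: smult_r_distr)
  then show "x \<oplus>\<^bsub>M\<^esub> y \<in> ?N'" using Nd(3) fg by simp
next
  note Nd = submoduleD[OF N]
  fix r x assume r: "r \<in> carrier R" and "x \<in> ?N'"
  then obtain f where f: "f \<in> N" "x = t \<odot>\<^bsub>M\<^esub> f"
    by auto
  then have "r \<odot>\<^bsub>M\<^esub> x = t \<odot>\<^bsub>M\<^esub> (r \<odot>\<^bsub>M\<^esub> f)"
    using Nd(1) t r by (simp add: smult_commute)
  then show "r \<odot>\<^bsub>M\<^esub> x \<in> ?N'" using Nd(4) r f by simp
qed

lemma ann_ring_ideal: "N \<subseteq> carrier M \<Longrightarrow> ideal (ann_ring R M N) R"
  by (rule R.ideal_memI) (auto simp: ann_ring_def smult_l_distr smult_assoc1 subset_iff)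

lemma ann_elems_submodule:
  assumes "I \<subseteq> carrier R"
  shows "submodule (ann_elems M I) R M"
proof (rule submodule_memI)
  fix r x assume r: "r \<in> carrier R" and x: "x \<in> ann_elems M I"
  have "a \<odot>\<^bsub>M\<^esub> (r \<odot>\<^bsub>M\<^esub> x) = \<zero>\<^bsub>M\<^esub>" if "a \<in> I" for a
    using that assms r x smult_commute[of a r x] by (auto simp: ann_elems_def)
  then show "r \<odot>\<^bsub>M\<^esub> x \<in> ann_elems M I"
    using r x by (auto simp: ann_elems_def)
qed (use assms in \<open>auto simp: ann_elems_def smult_r_distr subset_iff\<close>)

lemma ann_elems_adjoin:
  assumes "ideal I R" "a \<in> carrier R"
  shows "ann_elems M (adjoin R I a) = {e \<in> ann_elems M I. a \<odot>\<^bsub>M\<^esub> e = \<zero>\<^bsub>M\<^esub>}"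
proof (intro equalityI subsetI)
  fix e assume "e \<in> ann_elems M (adjoin R I a)"
  then show "e \<in> {e \<in> ann_elems M I. a \<odot>\<^bsub>M\<^esub> e = \<zero>\<^bsub>M\<^esub>}"
    using adjoin_superset[OF assms] adjoin_self[OF assms] by (auto simp: ann_elems_def)
next
  fix e assume "e \<in> {e \<in> ann_elems M I. a \<odot>\<^bsub>M\<^esub> e = \<zero>\<^bsub>M\<^esub>}"
  then show "e \<in> ann_elems M (adjoin R I a)"
    using assms(2) idealD(2)[OF assms(1)]
    by (auto simp: ann_elems_def adjoin_def smult_l_distr smult_assoc1)
qed

lemma ann_ring_antimono: "N \<subseteq> N' \<Longrightarrow> ann_ring R M N' \<subseteq> ann_ring R M N"
  by (auto simp: ann_ring_def)

lemma ann_elems_antimono: "I \<subseteq> I' \<Longrightarrow> ann_elems M I' \<subseteq> ann_elems M I"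
  by (auto simp: ann_elems_def)

lemma ann_ring_eq_carrier_iff:
  assumes "submodule N R M"
  shows "ann_ring R M N = carrier R \<longleftrightarrow> N = {\<zero>\<^bsub>M\<^esub>}"
proof
  assume "ann_ring R M N = carrier R"
  then have "\<one> \<in> ann_ring R M N" by simp
  then have "e = \<zero>\<^bsub>M\<^esub>" if "e \<in> N" for e
    using smult_one[OF submoduleD(1)[OF assms that]] that by (simp add: ann_ring_def)
  then show "N = {\<zero>\<^bsub>M\<^esub>}"
    using submoduleD(2)[OF assms] by blast
next
  assume "N = {\<zero>\<^bsub>M\<^esub>}"
  then show "ann_ring R M N = carrier R"
    by (auto simp: ann_ring_def)
qed

end

text \<open>Isolates what the correspondence takes from Matlis theory: annihilators in both
  directions are mutually inverse. The rest is lattice reasoning with saturated ideals;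
  \<open>completion_duality\<close> supplies the instance.\<close>

locale annihilator_duality = module A M + localized_ring A T
  for A (structure) and M (structure) and T +
  assumes ann_ring_ann_elems: "ideal I A \<Longrightarrow> ann_ring A M (ann_elems M I) = I"
    and ann_elems_ann_ring: "submodule N A M \<Longrightarrow> ann_elems M (ann_ring A M N) = N"
begin

text \<open>Divisibility by single elements, the form that meets colon ideals;
  \<open>FS_divisible_iff\<close> links it to divisibility by ideals.\<close>

definition divisible_submodule :: "'c set \<Rightarrow> bool" where
  "divisible_submodule N \<longleftrightarrow> submodule N A M \<and> (\<forall>t\<in>T. \<forall>e\<in>N. \<exists>f\<in>N. e = t \<odot>\<^bsub>M\<^esub> f)"

definition simple_divisible :: "'c set \<Rightarrow> bool" where
  "simple_divisible N \<longleftrightarrow> divisible_submodule N \<and> N \<noteq> {\<zero>\<^bsub>M\<^esub>} \<and>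
     \<not> (\<exists>V. divisible_submodule V \<and> V \<noteq> {\<zero>\<^bsub>M\<^esub>} \<and> V \<subset> N)"

text \<open>\<open>t N = N\<close> holds iff both sides have the same annihilator, and the annihilator of
  \<open>t N\<close> is the colon ideal \<open>(Ann N : t)\<close>.\<close>

lemma divisible_iff_saturated:
  assumes N: "submodule N A M"
  shows "divisible_submodule N \<longleftrightarrow> saturated (ann_ring A M N)"
proof
  note Nd = submoduleD[OF N]
  have ideal: "ideal (ann_ring A M N) A"
    using Nd by (intro ann_ring_ideal) auto
  {
    assume div: "divisible_submodule N"
    show "saturated (ann_ring A M N)"
      unfolding saturated_def
    proof (intro conjI ballI impI ideal)
      fix t a assume t: "t \<in> T" and a: "a \<in> carrier A" "t \<otimes> a \<in> ann_ring A M N"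
      have "a \<odot>\<^bsub>M\<^esub> e = \<zero>\<^bsub>M\<^esub>" if e: "e \<in> N" for e
      proof -
        obtain f where f: "f \<in> N" "e = t \<odot>\<^bsub>M\<^esub> f"
          using div t e unfolding divisible_submodule_def by blast
        then have "a \<odot>\<^bsub>M\<^esub> e = (t \<otimes> a) \<odot>\<^bsub>M\<^esub> f"
          using a t T_carrier Nd by (simp add: smult_assoc1 smult_commute)
        then show ?thesis
          using a f by (simp add: ann_ring_def)
      qed
      then show "a \<in> ann_ring A M N"
        using a by (simp add: ann_ring_def)
    qed
  }
  {
    assume sat: "saturated (ann_ring A M N)"
    have "\<exists>f\<in>N. e = t \<odot>\<^bsub>M\<^esub> f" if t: "t \<in> T" and e: "e \<in> N" for t e
    proof -
      have tc: "t \<in> carrier A" using t by (rule T_carrier)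
      define N' where "N' = (\<lambda>f. t \<odot>\<^bsub>M\<^esub> f) ` N"
      have N': "submodule N' A M"
        unfolding N'_def using N tc by (rule smult_image_submodule)
      have "ann_ring A M N' \<subseteq> ann_ring A M N"
      proof
        fix a assume a: "a \<in> ann_ring A M N'"
        then have ac: "a \<in> carrier A" by (simp add: ann_ring_def)
        have "(t \<otimes> a) \<odot>\<^bsub>M\<^esub> f = \<zero>\<^bsub>M\<^esub>" if "f \<in> N" for f
          using a that Nd(1) tc ac by (simp add: ann_ring_def N'_def smult_assoc1 smult_commute)
        then have "t \<otimes> a \<in> ann_ring A M N"
          using tc ac by (simp add: ann_ring_def)
        then show "a \<in> ann_ring A M N"
          using sat t ac by (simp add: saturated_def)
      qed
      then have "ann_elems M (ann_ring A M N) \<subseteq> ann_elems M (ann_ring A M N')"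
        by (rule ann_elems_antimono)
      then have "N \<subseteq> N'"
        using ann_elems_ann_ring N N' by simp
      then show ?thesis using e by (auto simp: N'_def)
    qed
    then show "divisible_submodule N"
      using N by (simp add: divisible_submodule_def)
  }
qed

lemma ann_elems_divisible:
  assumes "saturated I"
  shows "divisible_submodule (ann_elems M I)"
proof -
  have I: "ideal I A" using assms by (simp add: saturated_def)
  show ?thesis
    using divisible_iff_saturated[OF ann_elems_submodule[OF idealD(1)[OF I]]]
      ann_ring_ann_elems[OF I] assms by simp
qed

text \<open>Duality turns a divisible V inside N into a saturated ideal above Ann N, with the zero
  submodule matching the whole ring. Simplicity and maximality therefore exclude the same
  intermediate objects.\<close>

lemma simple_divisible_iff_maximal_saturated:
  assumes N: "submodule N A M"
  shows "simple_divisible N \<longleftrightarrow> maximal_saturated (ann_ring A M N)"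
proof
  assume sd: "simple_divisible N"
  show "maximal_saturated (ann_ring A M N)"
    unfolding maximal_saturated_def
  proof (intro conjI allI impI)
    show "saturated (ann_ring A M N)"
      using sd divisible_iff_saturated[OF N] by (simp add: simple_divisible_def)
    show "ann_ring A M N \<noteq> carrier A"
      using sd ann_ring_eq_carrier_iff[OF N] by (simp add: simple_divisible_def)
    fix J assume J: "saturated J \<and> ann_ring A M N \<subseteq> J"
    then have JI: "ideal J A" by (simp add: saturated_def)
    have "divisible_submodule (ann_elems M J)" "ann_elems M J \<subseteq> N"
      using J ann_elems_divisible ann_elems_antimono[of "ann_ring A M N" J]
      by (auto simp: ann_elems_ann_ring[OF N])
    then have "ann_elems M J = {\<zero>\<^bsub>M\<^esub>} \<or> ann_elems M J = N"
      using sd unfolding simple_divisible_def by blast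
    then show "J = ann_ring A M N \<or> J = carrier A"
      using ann_ring_ann_elems[OF JI]
        ann_ring_eq_carrier_iff[OF ann_elems_submodule[OF idealD(1)[OF JI]]] by auto
  qed
next
  assume ms: "maximal_saturated (ann_ring A M N)"
  show "simple_divisible N"
    unfolding simple_divisible_def
  proof (intro conjI notI)
    show "divisible_submodule N"
      using ms divisible_iff_saturated[OF N] by (simp add: maximal_saturated_def)
    show "N = {\<zero>\<^bsub>M\<^esub>} \<Longrightarrow> False"
      using ms ann_ring_eq_carrier_iff[OF N] by (simp add: maximal_saturated_def)
    assume "\<exists>V. divisible_submodule V \<and> V \<noteq> {\<zero>\<^bsub>M\<^esub>} \<and> V \<subset> N"
    then obtain V where V: "divisible_submodule V" "V \<noteq> {\<zero>\<^bsub>M\<^esub>}" "V \<subset> N" by blast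
    then have VS: "submodule V A M" by (simp add: divisible_submodule_def)
    have "saturated (ann_ring A M V)" "ann_ring A M N \<subseteq> ann_ring A M V"
      using V divisible_iff_saturated[OF VS] ann_ring_antimono by auto
    then have "ann_ring A M V = ann_ring A M N \<or> ann_ring A M V = carrier A"
      using ms by (simp add: maximal_saturated_def)
    then show False
      using V ann_ring_eq_carrier_iff[OF VS] ann_elems_ann_ring[OF N] ann_elems_ann_ring[OF VS] by auto
  qed
qed

text \<open>Composite of two bijections through the maximal saturated ideals: annihilator, then
  extension. The preimage of J is the set of module elements killed by the contraction of J.\<close>

theorem simple_divisible_bij_maximal_ideals:
  "bij_betw (\<lambda>N. ext_ideal A T (ann_ring A M N)) {N. simple_divisible N} {J. maximalideal J Loc}"
proof (rule bij_betwI')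
  have sub: "submodule N A M" if "simple_divisible N" for N
    using that by (simp add: simple_divisible_def divisible_submodule_def)
  have sat: "saturated (ann_ring A M N)" if "simple_divisible N" for N
    using simple_divisible_iff_maximal_saturated[OF sub[OF that]] that
    by (simp add: maximal_saturated_def)
  {
    fix N N' assume "N \<in> {N. simple_divisible N}" "N' \<in> {N. simple_divisible N}"
    then have "ext_ideal A T (ann_ring A M N) = ext_ideal A T (ann_ring A M N') \<longrightarrow> N = N'"
      using contraction_ext_ideal[OF sat] ann_elems_ann_ring[OF sub] by (metis mem_Collect_eq)
    then show "(ext_ideal A T (ann_ring A M N) = ext_ideal A T (ann_ring A M N')) = (N = N')"
      by blast
  }
  {
    fix N assume "N \<in> {N. simple_divisible N}"
    then show "ext_ideal A T (ann_ring A M N) \<in> {J. maximalideal J Loc}"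
      using maximalideal_ext_ideal_iff[OF sat] simple_divisible_iff_maximal_saturated[OF sub] by simp
  }
  {
    fix J assume "J \<in> {J. maximalideal J Loc}"
    then interpret J: maximalideal J Loc by simp
    have c: "saturated (contraction J)" using J.is_ideal by (rule contraction_saturated)
    then have I: "ideal (contraction J) A" by (simp add: saturated_def)
    have "maximal_saturated (contraction J)"
      using maximalideal_ext_ideal_iff[OF c] ext_ideal_contraction[OF J.is_ideal] J.is_maximalideal by simp
    then have "simple_divisible (ann_elems M (contraction J))"
      using simple_divisible_iff_maximal_saturated[OF ann_elems_submodule[OF idealD(1)[OF I]]]
        ann_ring_ann_elems[OF I] by simp
    then show "\<exists>N\<in>{N. simple_divisible N}. J = ext_ideal A T (ann_ring A M N)"
      using ann_ring_ann_elems[OF I] ext_ideal_contraction[OF J.is_ideal]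
      by (intro bexI[of _ "ann_elems M (contraction J)"]) auto
  }
qed

lemma simple_divisible_ann_elems_prime:
  assumes "primeideal P A" "P \<inter> T = {}" "maximalideal (ext_ideal A T P) Loc"
  shows "simple_divisible (ann_elems M P)"
proof -
  have I: "ideal P A" using assms(1) by (simp add: primeideal_def)
  show ?thesis
    using maximalideal_ext_ideal_iff[OF prime_saturated[OF assms(1,2)]] assms(3)
      simple_divisible_iff_maximal_saturated[OF ann_elems_submodule[OF idealD(1)[OF I]]]
      ann_ring_ann_elems[OF I] by simp
qed

end

section \<open>The injective hull of the residue field\<close>

lemma (in abelian_group) minus_eq_zero_iff:
  assumes "x \<in> carrier G" "y \<in> carrier G"
  shows "x \<ominus> y = \<zero> \<longleftrightarrow> x = y"
  using minus_equality[of x "\<ominus> y"] assms by (auto simp: a_minus_def r_neg)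

text \<open>The witness u hidden in \<open>injective_hull_residue\<close> becomes a parameter; R u
  is the copy of the residue field over which E is essential.\<close>

locale residue_hull = module R E for R (structure) and E (structure) +
  fixes u
  assumes noetherian: "noetherian_ring R" and local_ring: "local_ring R"
    and injective: "injective_module R E"
    and u_carrier: "u \<in> carrier E" and u_nonzero: "u \<noteq> \<zero>\<^bsub>E\<^esub>"
    and ann_u: "{r \<in> carrier R. r \<odot>\<^bsub>E\<^esub> u = \<zero>\<^bsub>E\<^esub>} = max_ideal R"
    and essential: "submodule U R E \<Longrightarrow> U \<noteq> {\<zero>\<^bsub>E\<^esub>} \<Longrightarrow>
      U \<inter> {r \<odot>\<^bsub>E\<^esub> u | r. r \<in> carrier R} \<noteq> {\<zero>\<^bsub>E\<^esub>}"
begin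

section \<open>Powers of the maximal ideal and the filtration they induce on the hull\<close>

abbreviation max_id ("\<mm>") where "\<mm> \<equiv> max_ideal R"

lemma max_ideal_maximal: "maximalideal \<mm> R"
proof -
  have "\<exists>!I. maximalideal I R" using local_ring by (simp add: local_ring_def)
  from theI'[OF this] show ?thesis by (simp add: max_ideal_def)
qed

lemma max_ideal_ideal: "ideal \<mm> R"
  using max_ideal_maximal by (simp add: maximalideal_def)

lemmas max_ideal_carrier = idealD(2)[OF max_ideal_ideal]

text \<open>Noetherian induction, in place of Zorn's lemma, finds a maximal ideal above
  \<open>I\<close>; locality says it is \<mm>.\<close>

lemma proper_ideal_subset_max_ideal:
  assumes "ideal I R" "I \<noteq> carrier R"
  shows "I \<subseteq> \<mm>"
proof -
  interpret noetherian_ring R by (rule noetherian)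
  have "I \<noteq> carrier R \<longrightarrow> (\<exists>M. maximalideal M R \<and> I \<subseteq> M)"
    using assms(1)
  proof (induction I rule: noetherian_induct)
    case (step I)
    show ?case
    proof (intro impI, cases "maximalideal I R")
      case False
      assume "I \<noteq> carrier R"
      then obtain J where "ideal J R" "I \<subseteq> J" "J \<noteq> I" "J \<noteq> carrier R"
        using False maximalidealI[OF step(1)] by metis
      then show "\<exists>M. maximalideal M R \<and> I \<subseteq> M"
        using step(2)[of J] by blast
    qed blast
  qed
  then obtain M where "maximalideal M R" "I \<subseteq> M"
    using assms(2) by blast
  moreover have "M = \<mm>" if "maximalideal M R" for M
    using that local_ring max_ideal_maximal unfolding local_ring_def by blast
  ultimately show ?thesis by simp
qed

lemma unit_if_notin_max_ideal:
  assumes "a \<in> carrier R" "a \<notin> \<mm>"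
  obtains b where "b \<in> carrier R" "b \<otimes> a = \<one>"
proof -
  have "PIdl a = carrier R"
    using proper_ideal_subset_max_ideal[OF cgenideal_ideal[OF assms(1)]]
      cgenideal_self[OF assms(1)] assms(2) by blast
  then have "\<one> \<in> PIdl a" by simp
  then show ?thesis using that by (auto simp: cgenideal_def)
qed

lemma mpow_ideal: "ideal (mpow R n) R"
  by (induction n) (auto intro: oneideal ideal_prod_is_ideal max_ideal_ideal)

lemmas mpow_carrier = idealD(2)[OF mpow_ideal]

lemma mpow_SucI: "a \<in> \<mm> \<Longrightarrow> b \<in> mpow R n \<Longrightarrow> a \<otimes> b \<in> mpow R (Suc n)"
  by (simp add: ideal_prod.prod)

lemma mpow_Suc_subset: "mpow R (Suc n) \<subseteq> mpow R n"
  using ideal_prod_inter[OF max_ideal_ideal mpow_ideal[of n]] by simp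

lemma mpow_mono: "k \<le> n \<Longrightarrow> mpow R n \<subseteq> mpow R k"
  using lift_Suc_antimono_le[of "mpow R", OF mpow_Suc_subset] by blast

lemma mpow_Suc_minimal:
  assumes "ideal J R" "\<And>a b. a \<in> \<mm> \<Longrightarrow> b \<in> mpow R n \<Longrightarrow> a \<otimes> b \<in> J"
  shows "mpow R (Suc n) \<subseteq> J"
proof
  fix x assume "x \<in> mpow R (Suc n)"
  then have "x \<in> \<mm> \<cdot> mpow R n" by simp
  then show "x \<in> J"
    by (induction rule: ideal_prod.induct) (auto intro: assms(2) idealD(4)[OF assms(1)])
qed

lemma pow_mem_mpow: "a \<in> \<mm> \<Longrightarrow> a [^] n \<in> mpow R n"
proof (induction n)
  case (Suc n)
  then have "a \<otimes> a [^] n \<in> mpow R (Suc n)" by (intro mpow_SucI) auto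
  then show ?case using Suc max_ideal_carrier by (simp add: m_comm)
qed simp

text \<open>Level 0 is zero because m^0 is the whole ring, and level 1 is the socle. By
  \<open>torsion\<close> the levels exhaust E.\<close>

abbreviation bounded ("\<E>") where "\<E> n \<equiv> ann_elems E (mpow R n)"

lemma bounded_submodule: "submodule (\<E> n) R E"
  by (rule ann_elems_submodule[OF idealD(1)[OF mpow_ideal]])

lemma bounded_mono: "k \<le> n \<Longrightarrow> \<E> k \<subseteq> \<E> n"
  by (intro ann_elems_antimono mpow_mono)

lemma bounded_SucI:
  assumes e: "e \<in> carrier E" and a: "\<And>a. a \<in> \<mm> \<Longrightarrow> a \<odot>\<^bsub>E\<^esub> e \<in> \<E> n"
  shows "e \<in> \<E> (Suc n)"
proof -
  have "mpow R (Suc n) \<subseteq> ann_ring R E {e}"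
  proof (rule mpow_Suc_minimal)
    show "ideal (ann_ring R E {e}) R" using e by (intro ann_ring_ideal) auto
    fix x b assume xb: "x \<in> \<mm>" "b \<in> mpow R n"
    then have "(x \<otimes> b) \<odot>\<^bsub>E\<^esub> e = b \<odot>\<^bsub>E\<^esub> (x \<odot>\<^bsub>E\<^esub> e)"
      using e max_ideal_carrier mpow_carrier by (simp add: smult_assoc1 smult_commute)
    then show "x \<otimes> b \<in> ann_ring R E {e}"
      using a[OF xb(1)] xb max_ideal_carrier mpow_carrier by (simp add: ann_ring_def ann_elems_def)
  qed
  then show ?thesis
    using e by (auto simp: ann_elems_def ann_ring_def)
qed

text \<open>Essentiality applied to the cyclic submodule R e. Both submodules contain zero, so an
  intersection different from the zero submodule has a nonzero element.\<close>

lemma essentialE: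
  assumes e: "e \<in> carrier E" "e \<noteq> \<zero>\<^bsub>E\<^esub>"
  obtains r s where "r \<in> carrier R" "s \<in> carrier R" "r \<odot>\<^bsub>E\<^esub> e = s \<odot>\<^bsub>E\<^esub> u" "r \<odot>\<^bsub>E\<^esub> e \<noteq> \<zero>\<^bsub>E\<^esub>"
proof -
  let ?U = "{r \<odot>\<^bsub>E\<^esub> e | r. r \<in> carrier R}"
  have "submodule ?U R E"
  proof (rule submodule_memI)
    show "?U \<subseteq> carrier E" using e by auto
    show "\<zero>\<^bsub>E\<^esub> \<in> ?U" using e by (auto intro!: exI[of _ \<zero>])
    fix x y assume "x \<in> ?U" "y \<in> ?U"
    then obtain r s where "r \<in> carrier R" "s \<in> carrier R" "x = r \<odot>\<^bsub>E\<^esub> e" "y = s \<odot>\<^bsub>E\<^esub> e" by blast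
    then show "x \<oplus>\<^bsub>E\<^esub> y \<in> ?U"
      using e by (auto intro!: exI[of _ "r \<oplus> s"] simp: smult_l_distr)
  next
    fix r x assume "r \<in> carrier R" "x \<in> ?U"
    then obtain s where "r \<in> carrier R" "s \<in> carrier R" "x = s \<odot>\<^bsub>E\<^esub> e" by blast
    then show "r \<odot>\<^bsub>E\<^esub> x \<in> ?U"
      using e by (auto intro!: exI[of _ "r \<otimes> s"] simp: smult_assoc1)
  qed
  moreover have "e \<in> ?U" using e by (auto intro!: exI[of _ \<one>])
  ultimately have "?U \<inter> {r \<odot>\<^bsub>E\<^esub> u | r. r \<in> carrier R} \<noteq> {\<zero>\<^bsub>E\<^esub>}"
    using e by (intro essential) auto
  moreover have "\<zero>\<^bsub>E\<^esub> \<in> ?U \<inter> {r \<odot>\<^bsub>E\<^esub> u | r. r \<in> carrier R}"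
    using e u_carrier by (auto intro!: exI[of _ \<zero>])
  ultimately obtain x where "x \<in> ?U" "x \<in> {r \<odot>\<^bsub>E\<^esub> u | r. r \<in> carrier R}" "x \<noteq> \<zero>\<^bsub>E\<^esub>"
    by blast
  then show ?thesis using that by auto
qed

lemma max_ideal_smult_u: "a \<in> \<mm> \<Longrightarrow> a \<odot>\<^bsub>E\<^esub> u = \<zero>\<^bsub>E\<^esub>"
  using ann_u by auto

lemma max_ideal_smult_multiple_u:
  "a \<in> \<mm> \<Longrightarrow> s \<in> carrier R \<Longrightarrow> a \<odot>\<^bsub>E\<^esub> (s \<odot>\<^bsub>E\<^esub> u) = \<zero>\<^bsub>E\<^esub>"
  using smult_commute[of a s u] max_ideal_smult_u max_ideal_carrier u_carrier by simp

text \<open>The scalars sending e into \<open>\<E> n\<close> form an ascending chain of ideals, so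
  compactness puts all of \<open>I\<close> into one of them.\<close>

lemma uniform_bound:
  assumes "fg_ideal R I" "e \<in> carrier E" "\<And>a. a \<in> I \<Longrightarrow> \<exists>n. a \<odot>\<^bsub>E\<^esub> e \<in> \<E> n"
  shows "\<exists>n. \<forall>a\<in>I. a \<odot>\<^bsub>E\<^esub> e \<in> \<E> n"
proof -
  define F where "F n = {a \<in> carrier R. a \<odot>\<^bsub>E\<^esub> e \<in> \<E> n}" for n
  have "\<exists>n. I \<subseteq> F n"
  proof (rule fg_ideal_in_directed_Union[OF assms(1)])
    show "I \<subseteq> (\<Union>n. F n)"
      using assms(3) idealD(2)[OF fg_ideal_imp_ideal[OF assms(1)]] by (auto simp: F_def)
    show "ideal (F n) R" for n
      using submoduleD[OF bounded_submodule[of n]] assms(2)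
      by (intro ideal_memI) (auto simp: F_def smult_l_distr smult_assoc1)
    show "F n \<subseteq> F (Suc n)" for n
      using bounded_mono[of n "Suc n"] by (auto simp: F_def)
  qed
  then show ?thesis by (auto simp: F_def)
qed

text \<open>Noetherian induction on the annihilator of \<open>e\<close>: if some \<open>a \<in> \<mm>\<close> does not enlarge it, then
  a nonzero multiple of \<open>e\<close> in \<open>R u\<close> is not killed by \<open>a\<close>, which is absurd.\<close>

lemma torsion:
  assumes "e \<in> carrier E"
  shows "\<exists>n. e \<in> \<E> n"
proof -
  interpret N: noetherian_ring R by (rule noetherian)
  have ann: "ideal (ann_ring R E {e}) R" if "e \<in> carrier E" for e
    using that by (intro ann_ring_ideal) auto
  have "\<forall>e\<in>carrier E. ann_ring R E {e} = I \<longrightarrow> (\<exists>n. e \<in> \<E> n)" if "ideal I R" for I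
    using that
  proof (induction I rule: N.noetherian_induct)
    case (step I)
    show ?case
    proof (intro ballI impI)
      fix e assume e: "e \<in> carrier E" and I: "ann_ring R E {e} = I"
      show "\<exists>n. e \<in> \<E> n"
      proof (cases "\<exists>a\<in>\<mm>. ann_ring R E {a \<odot>\<^bsub>E\<^esub> e} = I")
        case True
        then obtain a where a: "a \<in> \<mm>" "ann_ring R E {a \<odot>\<^bsub>E\<^esub> e} = I" by blast
        have "e = \<zero>\<^bsub>E\<^esub>"
        proof (rule ccontr)
          assume "e \<noteq> \<zero>\<^bsub>E\<^esub>"
          then obtain r s where rs: "r \<in> carrier R" "s \<in> carrier R"
            "r \<odot>\<^bsub>E\<^esub> e = s \<odot>\<^bsub>E\<^esub> u" "r \<odot>\<^bsub>E\<^esub> e \<noteq> \<zero>\<^bsub>E\<^esub>"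
            using essentialE[OF e] by metis
          have "r \<odot>\<^bsub>E\<^esub> (a \<odot>\<^bsub>E\<^esub> e) = a \<odot>\<^bsub>E\<^esub> (s \<odot>\<^bsub>E\<^esub> u)"
            using smult_commute[of r a e] rs a e max_ideal_carrier by simp
          then have "r \<in> ann_ring R E {e}"
            using a rs max_ideal_smult_multiple_u unfolding I by (auto simp: ann_ring_def)
          then show False using rs by (simp add: ann_ring_def)
        qed
        then show ?thesis
          using submoduleD(2)[OF bounded_submodule] by auto
      next
        \<comment> \<open>Now every multiple a e with a in \<mm> has a strictly larger annihilator,
          so induction bounds it. Finite generation of \<mm> makes the bounds uniform, and one more
          power of \<mm> kills e.\<close>
        case False
        have "\<exists>n. a \<odot>\<^bsub>E\<^esub> e \<in> \<E> n" if a: "a \<in> \<mm>" for a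
        proof -
          have "I \<subseteq> ann_ring R E {a \<odot>\<^bsub>E\<^esub> e}"
            using a e max_ideal_carrier smult_commute[of _ a e]
            unfolding I[symmetric] by (auto simp: ann_ring_def)
          then have "I \<subset> ann_ring R E {a \<odot>\<^bsub>E\<^esub> e}"
            using False a by blast
          then show ?thesis
            using a step(2)[OF ann, of "a \<odot>\<^bsub>E\<^esub> e"] e max_ideal_carrier by simp
        qed
        moreover have "fg_ideal R \<mm>"
          using N.finetely_gen[OF max_ideal_ideal] fg_ideal_Idl by auto
        ultimately obtain n where "\<forall>a\<in>\<mm>. a \<odot>\<^bsub>E\<^esub> e \<in> \<E> n"
          using uniform_bound e by blast
        then show ?thesis
          using bounded_SucI[OF e] by blast
      qed
    qed
  qed
  then show ?thesis
    using ann[OF assms] assms by blast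
qed

text \<open>For nonzero v, essentiality gives r v = s u nonzero. As \<mm> kills v, r is outside
  \<mm>, hence a unit that can be divided out.\<close>

lemma socle:
  assumes v: "v \<in> carrier E" "\<And>a. a \<in> \<mm> \<Longrightarrow> a \<odot>\<^bsub>E\<^esub> v = \<zero>\<^bsub>E\<^esub>"
  shows "\<exists>c\<in>carrier R. v = c \<odot>\<^bsub>E\<^esub> u"
proof (cases "v = \<zero>\<^bsub>E\<^esub>")
  case True
  then show ?thesis using u_carrier by (intro bexI[of _ \<zero>]) auto
next
  case False
  obtain r s where rs: "r \<in> carrier R" "s \<in> carrier R"
    "r \<odot>\<^bsub>E\<^esub> v = s \<odot>\<^bsub>E\<^esub> u" "r \<odot>\<^bsub>E\<^esub> v \<noteq> \<zero>\<^bsub>E\<^esub>"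
    using essentialE[OF v(1) False] by metis
  have "r \<notin> \<mm>" using rs v by auto
  then obtain b where b: "b \<in> carrier R" "b \<otimes> r = \<one>"
    using unit_if_notin_max_ideal rs by metis
  have "v = (b \<otimes> r) \<odot>\<^bsub>E\<^esub> v" using b v by simp
  also have "\<dots> = (b \<otimes> s) \<odot>\<^bsub>E\<^esub> u"
    using b(1) v rs u_carrier by (simp add: smult_assoc1)
  finally show ?thesis using b rs by auto
qed

text \<open>The socle is one-dimensional over the residue field, so any nonzero element generates
  it. Error terms below are absorbed through the coefficient c.\<close>

lemma socle_multiple:
  assumes v: "v \<in> carrier E" "\<And>a. a \<in> \<mm> \<Longrightarrow> a \<odot>\<^bsub>E\<^esub> v = \<zero>\<^bsub>E\<^esub>" "v \<noteq> \<zero>\<^bsub>E\<^esub>"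
    and w: "w \<in> carrier E" "\<And>a. a \<in> \<mm> \<Longrightarrow> a \<odot>\<^bsub>E\<^esub> w = \<zero>\<^bsub>E\<^esub>"
  obtains c where "c \<in> carrier R" "w = c \<odot>\<^bsub>E\<^esub> v"
proof -
  obtain c where c: "c \<in> carrier R" "v = c \<odot>\<^bsub>E\<^esub> u" using socle[OF v(1,2)] by blast
  obtain d where d: "d \<in> carrier R" "w = d \<odot>\<^bsub>E\<^esub> u" using socle[OF w] by blast
  have "c \<notin> \<mm>" using c v(3) max_ideal_smult_u by auto
  then obtain b where b: "b \<in> carrier R" "b \<otimes> c = \<one>"
    using unit_if_notin_max_ideal c by metis
  have "u = (b \<otimes> c) \<odot>\<^bsub>E\<^esub> u" using b u_carrier by simp
  also have "\<dots> = b \<odot>\<^bsub>E\<^esub> v" using b(1) c u_carrier by (simp add: smult_assoc1)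
  finally have "w = (d \<otimes> b) \<odot>\<^bsub>E\<^esub> v"
    using d b v(1) by (simp add: smult_assoc1)
  then show ?thesis using that b d by blast
qed

text \<open>The map i + a r |-> a u on I + R r is well defined because r is not in I: if (a - b) r
  lies in I then a - b is no unit, so it lies in \<mm> and kills u. Injectivity makes the map
  multiplication by some e, and then e is killed by I while r e = u.\<close>

lemma cogenerator:
  assumes I: "ideal I R" and r: "r \<in> carrier R" "r \<notin> I"
  shows "\<exists>e\<in>ann_elems E I. r \<odot>\<^bsub>E\<^esub> e \<noteq> \<zero>\<^bsub>E\<^esub>"
proof -
  note Id = idealD[OF I]
  define J where "J = adjoin R I r"
  have J: "ideal J R" unfolding J_def using I r by (intro adjoin_ideal)
  define P where "P x a \<longleftrightarrow> a \<in> carrier R \<and> x \<ominus> a \<otimes> r \<in> I" for x a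
  have ex: "\<exists>a. P x a" if x: "x \<in> J" for x
  proof -
    obtain i a where ia: "i \<in> I" "a \<in> carrier R" "x = i \<oplus> a \<otimes> r"
      using x by (auto simp: J_def adjoin_def)
    have "x \<ominus> a \<otimes> r = i"
      using ia(2) Id(2)[OF ia(1)] r unfolding ia(3) by algebra
    then show ?thesis using ia by (auto simp: P_def)
  qed
  have uniq: "a \<odot>\<^bsub>E\<^esub> u = b \<odot>\<^bsub>E\<^esub> u" if "P x a" "P x b" "x \<in> J" for x a b
  proof -
    have ab: "a \<in> carrier R" "b \<in> carrier R" using that by (auto simp: P_def)
    have x: "x \<in> carrier R" using that(3) idealD(2)[OF J] by simp
    have "(a \<ominus> b) \<otimes> r = (x \<ominus> b \<otimes> r) \<ominus> (x \<ominus> a \<otimes> r)"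
      using ab x r by algebra
    then have I': "(a \<ominus> b) \<otimes> r \<in> I"
      using that Id(6) by (simp add: P_def)
    have "a \<ominus> b \<in> \<mm>"
    proof (rule ccontr)
      assume "a \<ominus> b \<notin> \<mm>"
      then obtain c where c: "c \<in> carrier R" "c \<otimes> (a \<ominus> b) = \<one>"
        using unit_if_notin_max_ideal[of "a \<ominus> b"] ab by auto
      have "c \<otimes> ((a \<ominus> b) \<otimes> r) = r"
        using c ab r by (simp add: m_assoc[symmetric])
      then show False
        using Id(7)[OF c(1) I'] r by simp
    qed
    then have "(a \<ominus> b) \<odot>\<^bsub>E\<^esub> u = \<zero>\<^bsub>E\<^esub>" by (rule max_ideal_smult_u)
    then show ?thesis
      using ab u_carrier by (simp add: smult_minus_distr M.minus_eq_zero_iff)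
  qed
  define f where "f x = (SOME a. P x a) \<odot>\<^bsub>E\<^esub> u" for x
  have f: "f x = a \<odot>\<^bsub>E\<^esub> u" if "x \<in> J" "P x a" for x a
    unfolding f_def using uniq[OF someI_ex[OF ex[OF that(1)]] that(2,1)] .
  have "\<exists>e\<in>carrier E. \<forall>x\<in>J. f x = x \<odot>\<^bsub>E\<^esub> e"
  proof (rule injective[unfolded injective_module_def, rule_format], intro conjI ballI)
    show "ideal J R" by (rule J)
    fix x assume x: "x \<in> J"
    obtain a where a: "P x a" using ex[OF x] by blast
    then have ac: "a \<in> carrier R" by (simp add: P_def)
    have xc: "x \<in> carrier R" using x idealD(2)[OF J] by simp
    show "f x \<in> carrier E" using f[OF x a] ac u_carrier by simp
    {
      fix y assume y: "y \<in> J"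
      obtain b where b: "P y b" using ex[OF y] by blast
      then have bc: "b \<in> carrier R" by (simp add: P_def)
      have yc: "y \<in> carrier R" using y idealD(2)[OF J] by simp
      have "(x \<oplus> y) \<ominus> (a \<oplus> b) \<otimes> r = (x \<ominus> a \<otimes> r) \<oplus> (y \<ominus> b \<otimes> r)"
        using ac bc xc yc r by algebra
      then have "P (x \<oplus> y) (a \<oplus> b)"
        using a b Id(4) by (simp add: P_def)
      then show "f (x \<oplus> y) = f x \<oplus>\<^bsub>E\<^esub> f y"
        using f[OF x a] f[OF y b] f[OF idealD(4)[OF J x y]] ac bc u_carrier by (simp add: smult_l_distr)
    }
  next
    fix s x assume s: "s \<in> carrier R" and x: "x \<in> J"
    obtain a where a: "P x a" using ex[OF x] by blast
    then have ac: "a \<in> carrier R" by (simp add: P_def)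
    have xc: "x \<in> carrier R" using x idealD(2)[OF J] by simp
    have "s \<otimes> x \<ominus> (s \<otimes> a) \<otimes> r = s \<otimes> (x \<ominus> a \<otimes> r)"
      using ac xc r s by algebra
    then have "P (s \<otimes> x) (s \<otimes> a)"
      using a s Id(7) by (simp add: P_def)
    then show "f (s \<otimes> x) = s \<odot>\<^bsub>E\<^esub> f x"
      using f[OF x a] f[OF idealD(7)[OF J s x]] ac s u_carrier by (simp add: smult_assoc1)
  qed
  then obtain e where e: "e \<in> carrier E" "\<And>x. x \<in> J \<Longrightarrow> f x = x \<odot>\<^bsub>E\<^esub> e" by blast
  have "e \<in> ann_elems E I"
    unfolding ann_elems_def
  proof (intro CollectI conjI ballI e)
    fix x assume x: "x \<in> I"
    then have "x \<in> J" using adjoin_superset[OF I r(1)] by (auto simp: J_def)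
    moreover have "P x \<zero>" using x r Id(2) by (simp add: P_def a_minus_def)
    ultimately show "x \<odot>\<^bsub>E\<^esub> e = \<zero>\<^bsub>E\<^esub>" using e f u_carrier by auto
  qed
  moreover have "P r \<one>" using r Id(3) by (simp add: P_def a_minus_def R.r_neg)
  then have "r \<odot>\<^bsub>E\<^esub> e \<noteq> \<zero>\<^bsub>E\<^esub>"
    using f[of r \<one>] e(2)[of r] adjoin_self[OF I r(1)] u_carrier u_nonzero by (simp add: J_def)
  ultimately show ?thesis by blast
qed

end

section \<open>Endomorphisms and double annihilators over the base ring\<close>

context module
begin

definition linear_on :: "'c set \<Rightarrow> ('c \<Rightarrow> 'c) \<Rightarrow> bool" where
  "linear_on X \<phi> \<longleftrightarrow> (\<forall>x\<in>X. \<phi> x \<in> carrier M) \<and> (\<forall>x\<in>X. \<forall>y\<in>X. \<phi> (x \<oplus>\<^bsub>M\<^esub> y) = \<phi> x \<oplus>\<^bsub>M\<^esub> \<phi> y) \<and>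
     (\<forall>r\<in>carrier R. \<forall>x\<in>X. \<phi> (r \<odot>\<^bsub>M\<^esub> x) = r \<odot>\<^bsub>M\<^esub> \<phi> x)"

lemma linear_onD:
  assumes "linear_on X \<phi>"
  shows "\<And>x. x \<in> X \<Longrightarrow> \<phi> x \<in> carrier M"
    and "\<And>x y. x \<in> X \<Longrightarrow> y \<in> X \<Longrightarrow> \<phi> (x \<oplus>\<^bsub>M\<^esub> y) = \<phi> x \<oplus>\<^bsub>M\<^esub> \<phi> y"
    and "\<And>r x. r \<in> carrier R \<Longrightarrow> x \<in> X \<Longrightarrow> \<phi> (r \<odot>\<^bsub>M\<^esub> x) = r \<odot>\<^bsub>M\<^esub> \<phi> x"
  using assms by (auto simp: linear_on_def)

lemma linear_on_subset: "linear_on X \<phi> \<Longrightarrow> Y \<subseteq> X \<Longrightarrow> linear_on Y \<phi>"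
  unfolding linear_on_def by blast

text \<open>The two properties are carried together: extending the statement on homomorphisms by a
  simple factor generated by v needs an element of Ann Y that does not kill v, and the double
  annihilator of Y provides it.\<close>

definition reflexive_submodule :: "'c set \<Rightarrow> bool" where
  "reflexive_submodule Y \<longleftrightarrow> ann_elems M (ann_ring R M Y) \<subseteq> Y \<and>
     (\<forall>\<phi>. linear_on Y \<phi> \<longrightarrow> (\<exists>r\<in>carrier R. \<forall>y\<in>Y. \<phi> y = r \<odot>\<^bsub>M\<^esub> y))"

lemma smult_reorder:
  assumes "a \<in> carrier R" "b \<in> carrier R" "x \<in> carrier M" "a \<odot>\<^bsub>M\<^esub> x = \<zero>\<^bsub>M\<^esub>"
  shows "a \<odot>\<^bsub>M\<^esub> (b \<odot>\<^bsub>M\<^esub> x) = \<zero>\<^bsub>M\<^esub>"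
  using assms smult_commute[of a b x] by simp

end

context residue_hull
begin

text \<open>Here Z/Y is zero or simple, generated by v. In the simple case some a in Ann Y has a v
  nonzero, and a v lies in the socle since \<mm> v is inside Y. Thus every socle element is c a v
  for some c, so multiples of a can adjust behaviour at v without changing anything on Y.\<close>

lemma reflexive_submodule_step:
  assumes Y: "submodule Y R E" and Z: "submodule Z R E" "Y \<subseteq> Z" "v \<in> Z"
    and mv: "\<And>b. b \<in> \<mm> \<Longrightarrow> b \<odot>\<^bsub>E\<^esub> v \<in> Y"
    and gen: "\<And>z. z \<in> Z \<Longrightarrow> \<exists>y\<in>Y. \<exists>s\<in>carrier R. z = y \<oplus>\<^bsub>E\<^esub> s \<odot>\<^bsub>E\<^esub> v"
    and refl: "reflexive_submodule Y"
  shows "reflexive_submodule Z"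
proof (cases "v \<in> Y")
  case True
  then have "Z = Y"
    using gen Z(2) submoduleD(3,4)[OF Y] by blast
  then show ?thesis using refl by simp
next
  case False
  note Yd = submoduleD[OF Y] and Zd = submoduleD[OF Z(1)]
  have vc: "v \<in> carrier E" using Zd(1) Z(3) by simp
  note mc = max_ideal_carrier
  have "v \<notin> ann_elems E (ann_ring R E Y)"
    using False refl by (auto simp: reflexive_submodule_def)
  then obtain a where a: "a \<in> ann_ring R E Y" "a \<odot>\<^bsub>E\<^esub> v \<noteq> \<zero>\<^bsub>E\<^esub>"
    using vc by (auto simp: ann_elems_def)
  have ac: "a \<in> carrier R" using a(1) by (simp add: ann_ring_def)
  have aY: "a \<odot>\<^bsub>E\<^esub> y = \<zero>\<^bsub>E\<^esub>" if "y \<in> Y" for y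
    using a(1) that by (simp add: ann_ring_def)
  have av: "a \<odot>\<^bsub>E\<^esub> v \<in> carrier E" using ac vc by simp
  have b_av: "b \<odot>\<^bsub>E\<^esub> (a \<odot>\<^bsub>E\<^esub> v) = \<zero>\<^bsub>E\<^esub>" if "b \<in> \<mm>" for b
    using aY[OF mv[OF that]] ac vc mc[OF that] by (simp add: smult_commute)
  have multiple: "\<exists>c\<in>carrier R. w = c \<odot>\<^bsub>E\<^esub> (a \<odot>\<^bsub>E\<^esub> v)"
    if w: "w \<in> carrier E" "\<And>b. b \<in> \<mm> \<Longrightarrow> b \<odot>\<^bsub>E\<^esub> w = \<zero>\<^bsub>E\<^esub>" for w
    using socle_multiple[OF av b_av a(2) w] by blast
  have annZ: "r \<in> ann_ring R E Z"
    if r: "r \<in> carrier R" "\<And>y. y \<in> Y \<Longrightarrow> r \<odot>\<^bsub>E\<^esub> y = \<zero>\<^bsub>E\<^esub>" "r \<odot>\<^bsub>E\<^esub> v = \<zero>\<^bsub>E\<^esub>" for r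
  proof -
    have "r \<odot>\<^bsub>E\<^esub> z = \<zero>\<^bsub>E\<^esub>" if z: "z \<in> Z" for z
    proof -
      obtain y s where "y \<in> Y" "s \<in> carrier R" "z = y \<oplus>\<^bsub>E\<^esub> s \<odot>\<^bsub>E\<^esub> v"
        using gen[OF z] by blast
      then show ?thesis
        using r Yd(1) vc smult_reorder[OF r(1) _ vc r(3)] by (simp add: smult_r_distr)
    qed
    then show ?thesis using r(1) by (simp add: ann_ring_def)
  qed
  have "e \<in> Z" if e: "e \<in> ann_elems E (ann_ring R E Z)" for e
  proof -
    have ec: "e \<in> carrier E" using e by (simp add: ann_elems_def)
    have kill: "r \<odot>\<^bsub>E\<^esub> e = \<zero>\<^bsub>E\<^esub>" if "r \<in> ann_ring R E Z" for r
      using e that by (simp add: ann_elems_def)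
    have "b \<odot>\<^bsub>E\<^esub> (a \<odot>\<^bsub>E\<^esub> e) = \<zero>\<^bsub>E\<^esub>" if b: "b \<in> \<mm>" for b
    proof -
      have "b \<otimes> a \<in> ann_ring R E Z"
        using ac mc[OF b] vc b_av[OF b] aY Yd(1) by (intro annZ) (auto simp: smult_assoc1)
      then show ?thesis using kill ac mc[OF b] ec by (simp add: smult_assoc1[symmetric])
    qed
    then obtain c where c: "c \<in> carrier R" "a \<odot>\<^bsub>E\<^esub> e = c \<odot>\<^bsub>E\<^esub> (a \<odot>\<^bsub>E\<^esub> v)"
      using multiple[of "a \<odot>\<^bsub>E\<^esub> e"] ac ec by auto
    \<comment> \<open>The correction makes a kill d. Any r in Ann Y sends v into the socle, so r v =
      s a v and r - s a kills Z, hence e; therefore r d = s a d = 0 and d lies in the double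
      annihilator of Y.\<close>
    define d where "d = e \<ominus>\<^bsub>E\<^esub> c \<odot>\<^bsub>E\<^esub> v"
    have dc: "d \<in> carrier E" using ec c vc by (simp add: d_def)
    have smult_d: "r \<odot>\<^bsub>E\<^esub> d = r \<odot>\<^bsub>E\<^esub> e \<ominus>\<^bsub>E\<^esub> r \<odot>\<^bsub>E\<^esub> (c \<odot>\<^bsub>E\<^esub> v)" if "r \<in> carrier R" for r
      using that ec c vc by (simp add: d_def a_minus_def smult_r_distr smult_r_minus)
    have ad: "a \<odot>\<^bsub>E\<^esub> d = \<zero>\<^bsub>E\<^esub>"
      using smult_d[OF ac] c ac vc by (simp add: smult_commute[of a c v] M.minus_eq_zero_iff)
    have "d \<in> ann_elems E (ann_ring R E Y)"
      unfolding ann_elems_def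
    proof (intro CollectI conjI dc ballI)
      fix r assume "r \<in> ann_ring R E Y"
      then have r: "r \<in> carrier R" "\<And>y. y \<in> Y \<Longrightarrow> r \<odot>\<^bsub>E\<^esub> y = \<zero>\<^bsub>E\<^esub>"
        by (auto simp: ann_ring_def)
      have "b \<odot>\<^bsub>E\<^esub> (r \<odot>\<^bsub>E\<^esub> v) = \<zero>\<^bsub>E\<^esub>" if b: "b \<in> \<mm>" for b
        using r(2)[OF mv[OF b]] r(1) vc mc[OF b] by (simp add: smult_commute)
      then obtain s where s: "s \<in> carrier R" "r \<odot>\<^bsub>E\<^esub> v = s \<odot>\<^bsub>E\<^esub> (a \<odot>\<^bsub>E\<^esub> v)"
        using multiple[of "r \<odot>\<^bsub>E\<^esub> v"] r vc by auto
      have rs: "(r \<ominus> s \<otimes> a) \<odot>\<^bsub>E\<^esub> x = r \<odot>\<^bsub>E\<^esub> x \<ominus>\<^bsub>E\<^esub> s \<odot>\<^bsub>E\<^esub> (a \<odot>\<^bsub>E\<^esub> x)" if "x \<in> carrier E" for x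
        using that r s ac by (simp add: smult_minus_distr smult_assoc1)
      have v0: "(r \<ominus> s \<otimes> a) \<odot>\<^bsub>E\<^esub> v = \<zero>\<^bsub>E\<^esub>"
        using rs[OF vc] s r vc av ac by (simp add: M.minus_eq_zero_iff)
      have "r \<ominus> s \<otimes> a \<in> ann_ring R E Z"
      proof (rule annZ[OF _ _ v0])
        show "r \<ominus> s \<otimes> a \<in> carrier R" using r s ac by simp
        fix y assume "y \<in> Y"
        then show "(r \<ominus> s \<otimes> a) \<odot>\<^bsub>E\<^esub> y = \<zero>\<^bsub>E\<^esub>"
          using rs[OF Yd(1)] r(2) aY s by (simp add: M.minus_eq_zero_iff)
      qed
      then have "(r \<ominus> s \<otimes> a) \<odot>\<^bsub>E\<^esub> e = \<zero>\<^bsub>E\<^esub>"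
        by (rule kill)
      then have "r \<odot>\<^bsub>E\<^esub> e = s \<odot>\<^bsub>E\<^esub> (a \<odot>\<^bsub>E\<^esub> e)"
        unfolding rs[OF ec] using r(1) s(1) ac ec by (simp add: M.minus_eq_zero_iff)
      also have "\<dots> = s \<odot>\<^bsub>E\<^esub> (c \<odot>\<^bsub>E\<^esub> (a \<odot>\<^bsub>E\<^esub> v))"
        unfolding c(2) ..
      also have "\<dots> = r \<odot>\<^bsub>E\<^esub> (c \<odot>\<^bsub>E\<^esub> v)"
        using smult_commute[of s c "a \<odot>\<^bsub>E\<^esub> v"] smult_commute[of r c v] s c(1) r(1) av vc by simp
      finally show "r \<odot>\<^bsub>E\<^esub> d = \<zero>\<^bsub>E\<^esub>"
        using smult_d[OF r(1)] r c vc by (simp add: M.minus_eq_zero_iff)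
    qed
    then have "d \<in> Y" using refl by (auto simp: reflexive_submodule_def)
    then have "d \<oplus>\<^bsub>E\<^esub> c \<odot>\<^bsub>E\<^esub> v \<in> Z"
      using Z Zd(3,4) c by blast
    moreover have "d \<oplus>\<^bsub>E\<^esub> c \<odot>\<^bsub>E\<^esub> v = e"
      using ec c vc by (simp add: d_def a_minus_def M.a_assoc M.l_neg)
    ultimately show ?thesis by simp
  qed
  moreover have "\<exists>r\<in>carrier R. \<forall>z\<in>Z. \<phi> z = r \<odot>\<^bsub>E\<^esub> z" if lin: "linear_on Z \<phi>" for \<phi>
  proof -
    note lind = linear_onD[OF lin]
    obtain r where r: "r \<in> carrier R" "\<And>y. y \<in> Y \<Longrightarrow> \<phi> y = r \<odot>\<^bsub>E\<^esub> y"
      using refl linear_on_subset[OF lin Z(2)] by (auto simp: reflexive_submodule_def)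
    \<comment> \<open>The error of r at v is a socle element, since \<phi> and r agree on \<mm> v
      inside Y. Adding c a to r removes it and leaves the action on Y untouched.\<close>
    define w where "w = \<phi> v \<ominus>\<^bsub>E\<^esub> r \<odot>\<^bsub>E\<^esub> v"
    have wc: "w \<in> carrier E" using lind(1) Z(3) r(1) vc by (simp add: w_def)
    have "b \<odot>\<^bsub>E\<^esub> w = \<zero>\<^bsub>E\<^esub>" if b: "b \<in> \<mm>" for b
    proof -
      have "b \<odot>\<^bsub>E\<^esub> w = b \<odot>\<^bsub>E\<^esub> \<phi> v \<ominus>\<^bsub>E\<^esub> b \<odot>\<^bsub>E\<^esub> (r \<odot>\<^bsub>E\<^esub> v)"
        using lind(1)[OF Z(3)] r(1) vc mc[OF b] by (simp add: w_def a_minus_def smult_r_distr smult_r_minus)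
      also have "b \<odot>\<^bsub>E\<^esub> \<phi> v = r \<odot>\<^bsub>E\<^esub> (b \<odot>\<^bsub>E\<^esub> v)"
        using lind(3)[OF mc[OF b] Z(3)] r(2)[OF mv[OF b]] by simp
      finally show ?thesis
        using smult_commute[of r b v] r(1) mc[OF b] vc by (simp add: M.minus_eq_zero_iff)
    qed
    then obtain c where c: "c \<in> carrier R" "w = c \<odot>\<^bsub>E\<^esub> (a \<odot>\<^bsub>E\<^esub> v)"
      using multiple[OF wc] by blast
    have \<phi>v: "\<phi> v = (r \<oplus> c \<otimes> a) \<odot>\<^bsub>E\<^esub> v"
    proof -
      have "\<phi> v = r \<odot>\<^bsub>E\<^esub> v \<oplus>\<^bsub>E\<^esub> w"
        using lind(1)[OF Z(3)] r(1) vc by (simp add: w_def a_minus_def M.a_ac M.r_neg)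
      then show ?thesis
        using c r ac vc by (simp add: smult_l_distr smult_assoc1)
    qed
    have \<phi>y: "\<phi> y = (r \<oplus> c \<otimes> a) \<odot>\<^bsub>E\<^esub> y" if "y \<in> Y" for y
      using r that c(1) ac aY Yd(1) by (simp add: smult_l_distr smult_assoc1)
    have rc: "r \<oplus> c \<otimes> a \<in> carrier R" using r c ac by simp
    have "\<phi> z = (r \<oplus> c \<otimes> a) \<odot>\<^bsub>E\<^esub> z" if z: "z \<in> Z" for z
    proof -
      obtain y s where ys: "y \<in> Y" "s \<in> carrier R" "z = y \<oplus>\<^bsub>E\<^esub> s \<odot>\<^bsub>E\<^esub> v"
        using gen[OF z] by blast
      have "\<phi> z = \<phi> y \<oplus>\<^bsub>E\<^esub> s \<odot>\<^bsub>E\<^esub> \<phi> v"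
        unfolding ys(3) using lind(2,3) ys Z Zd(4) by (simp add: subset_iff)
      also have "\<dots> = (r \<oplus> c \<otimes> a) \<odot>\<^bsub>E\<^esub> z"
        unfolding \<phi>y[OF ys(1)] \<phi>v ys(3)
        using rc Yd(1)[OF ys(1)] ys(2) vc by (simp add: smult_r_distr smult_commute[of s])
      finally show ?thesis .
    qed
    then show ?thesis using rc by blast
  qed
  ultimately show ?thesis by (auto simp: reflexive_submodule_def)
qed

lemma reflexive_submodule_zero: "reflexive_submodule {\<zero>\<^bsub>E\<^esub>}"
  unfolding reflexive_submodule_def
proof (intro conjI allI impI)
  have "e = \<zero>\<^bsub>E\<^esub>" if "e \<in> ann_elems E (ann_ring R E {\<zero>\<^bsub>E\<^esub>})" for e
  proof -
    have "\<one> \<odot>\<^bsub>E\<^esub> e = \<zero>\<^bsub>E\<^esub>" "e \<in> carrier E" using that by (auto simp: ann_elems_def ann_ring_def)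
    then show ?thesis by simp
  qed
  then show "ann_elems E (ann_ring R E {\<zero>\<^bsub>E\<^esub>}) \<subseteq> {\<zero>\<^bsub>E\<^esub>}" by blast
  fix \<phi> assume lin: "linear_on {\<zero>\<^bsub>E\<^esub>} \<phi>"
  have "\<phi> (\<zero> \<odot>\<^bsub>E\<^esub> \<zero>\<^bsub>E\<^esub>) = \<zero> \<odot>\<^bsub>E\<^esub> \<phi> \<zero>\<^bsub>E\<^esub>"
    using linear_onD(3)[OF lin] by blast
  then show "\<exists>r\<in>carrier R. \<forall>y\<in>{\<zero>\<^bsub>E\<^esub>}. \<phi> y = r \<odot>\<^bsub>E\<^esub> y"
    using linear_onD(1)[OF lin] by (intro bexI[of _ \<zero>]) auto
qed

text \<open>Enlarging I by an element a with \<mm> a inside I removes at most one simple factor from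
  the elements killed by I, because a maps them into the socle. Intersecting with X lets any
  submodule be truncated to a level of the filtration.\<close>

lemma reflexive_submodule_Int_ann_elems:
  assumes X: "submodule X R E" and "ideal I R" "mpow R k \<subseteq> I"
  shows "reflexive_submodule (X \<inter> ann_elems E I)"
proof -
  interpret N: noetherian_ring R by (rule noetherian)
  note Xd = submoduleD[OF X]
  have "mpow R k \<subseteq> I \<longrightarrow> reflexive_submodule (X \<inter> ann_elems E I)"
    using assms(2)
  proof (induction I rule: N.noetherian_induct)
    case (step I)
    note Id = idealD[OF step(1)]
    show ?case
    proof (intro impI, cases "I = carrier R")
      case True
      have "e = \<zero>\<^bsub>E\<^esub>" if "e \<in> ann_elems E I" for e
      proof -
        have "\<one> \<odot>\<^bsub>E\<^esub> e = \<zero>\<^bsub>E\<^esub>" "e \<in> carrier E" using that True by (auto simp: ann_elems_def)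
        then show ?thesis by simp
      qed
      then have "X \<inter> ann_elems E I = {\<zero>\<^bsub>E\<^esub>}"
        using Xd(2) submoduleD(2)[OF ann_elems_submodule[OF Id(1)]] by blast
      then show "reflexive_submodule (X \<inter> ann_elems E I)"
        by (simp add: reflexive_submodule_zero)
    next
      case False
      assume k: "mpow R k \<subseteq> I"
      \<comment> \<open>Since m^0 is the whole ring and I is proper, there is a last power not
        contained in I. An element of it outside I is a nonzero socle element of R/I.\<close>
      have "\<exists>j. \<not> mpow R j \<subseteq> I \<and> mpow R (Suc j) \<subseteq> I"
      proof (rule ccontr)
        assume "\<nexists>j. \<not> mpow R j \<subseteq> I \<and> mpow R (Suc j) \<subseteq> I"
        then have "\<not> mpow R n \<subseteq> I" for n
          using False Id(1) by (induction n) auto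
        then show False using k by blast
      qed
      then obtain j a where j: "mpow R (Suc j) \<subseteq> I" and a: "a \<in> mpow R j" "a \<notin> I" by blast
      have ac: "a \<in> carrier R" using a mpow_carrier by blast
      have ba: "b \<otimes> a \<in> I" if "b \<in> \<mm>" for b
        using mpow_SucI[OF that a(1)] j by blast
      define J where "J = adjoin R I a"
      define Z where "Z = X \<inter> ann_elems E I"
      define Y where "Y = X \<inter> ann_elems E J"
      have J: "ideal J R" unfolding J_def using step(1) ac by (rule adjoin_ideal)
      have "I \<subset> J" unfolding J_def using adjoin_superset[OF step(1) ac] adjoin_self[OF step(1) ac] a by blast
      then have refl: "reflexive_submodule Y"
        using step(2)[OF J] k by (auto simp: Y_def)
      have Z: "submodule Z R E" unfolding Z_def
        using X ann_elems_submodule[OF Id(1)] by (rule submodule_Int)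
      have Y: "submodule Y R E" unfolding Y_def
        using X ann_elems_submodule[OF idealD(1)[OF J]] by (rule submodule_Int)
      have Y_iff: "y \<in> Y \<longleftrightarrow> y \<in> Z \<and> a \<odot>\<^bsub>E\<^esub> y = \<zero>\<^bsub>E\<^esub>" for y
        unfolding Y_def Z_def J_def ann_elems_adjoin[OF step(1) ac] by blast
      note Zd = submoduleD[OF Z]
      have kill: "b \<odot>\<^bsub>E\<^esub> (a \<odot>\<^bsub>E\<^esub> z) = \<zero>\<^bsub>E\<^esub>" if "b \<in> \<mm>" "z \<in> Z" for b z
      proof -
        have "(b \<otimes> a) \<odot>\<^bsub>E\<^esub> z = \<zero>\<^bsub>E\<^esub>"
          using ba[OF that(1)] that(2) by (simp add: Z_def ann_elems_def)
        then show ?thesis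
          using Zd(1)[OF that(2)] max_ideal_carrier[OF that(1)] ac by (simp add: smult_assoc1)
      qed
      show "reflexive_submodule (X \<inter> ann_elems E I)"
      proof (cases "Z \<subseteq> Y")
        case True
        then have "Z = Y" using Y_iff by blast
        then show ?thesis using refl by (simp add: Z_def)
      next
        case False
        then obtain v where v: "v \<in> Z" "a \<odot>\<^bsub>E\<^esub> v \<noteq> \<zero>\<^bsub>E\<^esub>" using Y_iff by blast
        have vc: "v \<in> carrier E" using Zd(1) v by simp
        have "reflexive_submodule Z"
        proof (rule reflexive_submodule_step[OF Y Z _ v(1) _ _ refl])
          show "Y \<subseteq> Z" using Y_iff by blast
          show "b \<odot>\<^bsub>E\<^esub> v \<in> Y" if "b \<in> \<mm>" for b
            using kill[OF that v(1)] smult_commute[of a b v] max_ideal_carrier[OF that] ac vc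
              Zd(4)[OF _ v(1)] by (simp add: Y_iff)
          fix z assume z: "z \<in> Z"
          have zc: "z \<in> carrier E" using Zd(1) z by simp
          \<comment> \<open>Multiplication by a has kernel Y on Z and lands in the socle, which a v
            generates; so subtracting a multiple of v moves z into Y.\<close>
          obtain c where c: "c \<in> carrier R" "a \<odot>\<^bsub>E\<^esub> z = c \<odot>\<^bsub>E\<^esub> (a \<odot>\<^bsub>E\<^esub> v)"
            using socle_multiple[of "a \<odot>\<^bsub>E\<^esub> v" "a \<odot>\<^bsub>E\<^esub> z"] kill v z ac vc zc by auto
          have "a \<odot>\<^bsub>E\<^esub> (z \<ominus>\<^bsub>E\<^esub> c \<odot>\<^bsub>E\<^esub> v) = a \<odot>\<^bsub>E\<^esub> z \<ominus>\<^bsub>E\<^esub> a \<odot>\<^bsub>E\<^esub> (c \<odot>\<^bsub>E\<^esub> v)"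
            using ac zc c(1) vc by (simp add: a_minus_def smult_r_distr smult_r_minus)
          also have "\<dots> = \<zero>\<^bsub>E\<^esub>"
            using smult_commute[of a c v] c ac vc by (simp add: M.minus_eq_zero_iff)
          finally have "z \<ominus>\<^bsub>E\<^esub> c \<odot>\<^bsub>E\<^esub> v \<in> Y"
            using Zd(5)[OF z Zd(4)[OF c(1) v(1)]] by (simp add: Y_iff)
          moreover have "z = (z \<ominus>\<^bsub>E\<^esub> c \<odot>\<^bsub>E\<^esub> v) \<oplus>\<^bsub>E\<^esub> c \<odot>\<^bsub>E\<^esub> v"
            using zc c vc by (simp add: a_minus_def M.a_assoc M.l_neg)
          ultimately show "\<exists>y\<in>Y. \<exists>s\<in>carrier R. z = y \<oplus>\<^bsub>E\<^esub> s \<odot>\<^bsub>E\<^esub> v"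
            using c(1) by blast
        qed
        then show ?thesis by (simp add: Z_def)
      qed
    qed
  qed
  then show ?thesis using assms(3) by blast
qed

text \<open>The lifting step for all passages to the limit: an annihilator of level k can be changed
  modulo m^k into one of level k + 1. Otherwise \<open>cogenerator\<close> yields e with r e
  nonzero, killed by m^k and by the annihilator of level k + 1; the former puts e into
  \<open>\<E> k\<close> and the double annihilator puts it into X, so r kills it.\<close>

lemma ann_ring_bounded_step:
  assumes X: "submodule X R E" and r: "r \<in> ann_ring R E (X \<inter> \<E> k)"
  shows "\<exists>a\<in>ann_ring R E (X \<inter> \<E> (Suc k)). r \<ominus> a \<in> mpow R k"
proof -
  define J where "J n = ann_ring R E (X \<inter> \<E> n)" for n
  have J: "ideal (J n) R" for n
    unfolding J_def by (rule ann_ring_ideal) (auto simp: ann_elems_def)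
  have rc: "r \<in> carrier R" using r by (simp add: ann_ring_def)
  have I: "ideal (J (Suc k) <+>\<^bsub>R\<^esub> mpow R k) R"
    using J mpow_ideal by (rule add_ideals)
  have "r \<in> J (Suc k) <+>\<^bsub>R\<^esub> mpow R k"
  proof (rule ccontr)
    assume "r \<notin> J (Suc k) <+>\<^bsub>R\<^esub> mpow R k"
    then obtain e where e: "e \<in> ann_elems E (J (Suc k) <+>\<^bsub>R\<^esub> mpow R k)" "r \<odot>\<^bsub>E\<^esub> e \<noteq> \<zero>\<^bsub>E\<^esub>"
      using cogenerator[OF I rc] by blast
    have "J (Suc k) \<subseteq> J (Suc k) <+>\<^bsub>R\<^esub> mpow R k"
    proof
      fix x assume "x \<in> J (Suc k)"
      then show "x \<in> J (Suc k) <+>\<^bsub>R\<^esub> mpow R k"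
        using idealD(3)[OF mpow_ideal[of k]] idealD(2)[OF J]
        unfolding set_add_def' by (intro UN_I[of x] UN_I[of \<zero>]) auto
    qed
    then have "e \<in> ann_elems E (J (Suc k))" using e ann_elems_antimono by blast
    then have "e \<in> X"
      using reflexive_submodule_Int_ann_elems[OF X mpow_ideal subset_refl, of "Suc k"]
      unfolding reflexive_submodule_def J_def by blast
    moreover have "mpow R k \<subseteq> J (Suc k) <+>\<^bsub>R\<^esub> mpow R k"
    proof
      fix x assume "x \<in> mpow R k"
      then show "x \<in> J (Suc k) <+>\<^bsub>R\<^esub> mpow R k"
        using idealD(3)[OF J[of "Suc k"]] mpow_carrier
        unfolding set_add_def' by (intro UN_I[of \<zero>] UN_I[of x]) auto
    qed
    then have "e \<in> \<E> k" using e ann_elems_antimono by blast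
    ultimately show False using r e by (simp add: ann_ring_def)
  qed
  then obtain a b where ab: "a \<in> J (Suc k)" "b \<in> mpow R k" "r = a \<oplus> b"
    unfolding set_add_def' by blast
  have "r \<ominus> a = b"
    using idealD(2)[OF J ab(1)] mpow_carrier[OF ab(2)] unfolding ab(3) by algebra
  then show ?thesis
    using ab unfolding J_def by (intro bexI[of _ a]) simp_all
qed

text \<open>On every level \<phi> is multiplication by some ring element; these are chosen
  successively so that they converge.\<close>

lemma linear_on_coherent_sequence:
  assumes X: "submodule X R E" and lin: "linear_on X \<phi>"
  obtains s where "\<And>k. s k \<in> carrier R" "\<And>k. s (Suc k) \<ominus> s k \<in> mpow R k"
    and "\<And>k x. x \<in> X \<Longrightarrow> x \<in> \<E> k \<Longrightarrow> \<phi> x = s k \<odot>\<^bsub>E\<^esub> x"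
proof -
  define P where "P k r \<longleftrightarrow> r \<in> carrier R \<and> (\<forall>x\<in>X \<inter> \<E> k. \<phi> x = r \<odot>\<^bsub>E\<^esub> x)" for k r
  have ex: "\<exists>r. P k r" for k
    using reflexive_submodule_Int_ann_elems[OF X mpow_ideal subset_refl, of k]
      linear_on_subset[OF lin, of "X \<inter> \<E> k"]
    unfolding reflexive_submodule_def P_def by blast
  have "\<exists>s. \<forall>k. P k (s k) \<and> s (Suc k) \<ominus> s k \<in> mpow R k"
  proof (rule dependent_nat_choice)
    show "\<exists>r. P 0 r" by (rule ex)
    fix r k assume r: "P k r"
    obtain q where q: "P (Suc k) q" using ex by blast
    have rq: "r \<in> carrier R" "q \<in> carrier R" using r q by (auto simp: P_def)
    have "(q \<ominus> r) \<odot>\<^bsub>E\<^esub> x = \<zero>\<^bsub>E\<^esub>" if x: "x \<in> X \<inter> \<E> k" for x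
    proof -
      have "x \<in> X \<inter> \<E> (Suc k)" "x \<in> carrier E"
        using x bounded_mono[of k "Suc k"] by (auto simp: ann_elems_def)
      moreover from this have "r \<odot>\<^bsub>E\<^esub> x = q \<odot>\<^bsub>E\<^esub> x"
        using r q x unfolding P_def by metis
      ultimately show ?thesis
        using rq by (simp add: smult_minus_distr M.minus_eq_zero_iff)
    qed
    \<comment> \<open>The next multiplier q may differ from r by any element killing level k.
      Subtracting from q a suitable a that kills level k + 1 keeps its action there and brings it
      close to r.\<close>
    then have "q \<ominus> r \<in> ann_ring R E (X \<inter> \<E> k)"
      using rq by (simp add: ann_ring_def)
    then obtain a where a: "a \<in> ann_ring R E (X \<inter> \<E> (Suc k))" "(q \<ominus> r) \<ominus> a \<in> mpow R k"
      using ann_ring_bounded_step[OF X] by blast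
    have ac: "a \<in> carrier R" using a by (simp add: ann_ring_def)
    have "(q \<ominus> a) \<ominus> r = (q \<ominus> r) \<ominus> a" using ac rq by algebra
    moreover have "\<phi> x = (q \<ominus> a) \<odot>\<^bsub>E\<^esub> x" if x: "x \<in> X \<inter> \<E> (Suc k)" for x
    proof -
      have "x \<in> carrier E" "a \<odot>\<^bsub>E\<^esub> x = \<zero>\<^bsub>E\<^esub>"
        using x a by (auto simp: ann_elems_def ann_ring_def)
      then have "(q \<ominus> a) \<odot>\<^bsub>E\<^esub> x = q \<odot>\<^bsub>E\<^esub> x \<ominus>\<^bsub>E\<^esub> \<zero>\<^bsub>E\<^esub>"
        using rq ac by (simp add: smult_minus_distr)
      also have "\<dots> = q \<odot>\<^bsub>E\<^esub> x"
        using \<open>x \<in> carrier E\<close> rq by (simp add: a_minus_def)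
      finally show ?thesis
        using q x by (simp add: P_def)
    qed
    ultimately show "\<exists>y. P (Suc k) y \<and> y \<ominus> r \<in> mpow R k"
      using a rq ac by (intro exI[of _ "q \<ominus> a"]) (auto simp: P_def)
  qed
  then obtain s where "\<And>k. P k (s k)" "\<And>k. s (Suc k) \<ominus> s k \<in> mpow R k" by blast
  then show ?thesis using that[of s] by (simp add: P_def)
qed

end

section \<open>The completion and its action on the injective hull\<close>

lemma (in ring) mem_a_r_coset_iff:
  assumes "ideal I R" "a \<in> carrier R"
  shows "x \<in> I +> a \<longleftrightarrow> x \<in> carrier R \<and> x \<ominus> a \<in> I"
proof
  assume "x \<in> I +> a"
  then obtain i where i: "i \<in> I" "x = i \<oplus> a" by (auto simp: a_r_coset_def')
  then have ic: "i \<in> carrier R" using idealD(2)[OF assms(1)] by simp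
  have "x \<ominus> a = i" using ic assms(2) by (simp add: i(2) a_minus_def a_assoc r_neg)
  then show "x \<in> carrier R \<and> x \<ominus> a \<in> I" using i ic assms(2) by simp
next
  assume x: "x \<in> carrier R \<and> x \<ominus> a \<in> I"
  then have "x = (x \<ominus> a) \<oplus> a" using assms(2) by (simp add: a_minus_def a_assoc l_neg)
  then show "x \<in> I +> a" using x by (auto simp: a_r_coset_def')
qed

context residue_hull
begin

abbreviation Rhat ("\<RR>") where "\<RR> \<equiv> completion R"

text \<open>Sequences of representatives for the sequences of cosets forming the completion, so that
  ring operations are termwise in R. Index 0 imposes no condition, since m^0 is the whole
  ring.\<close>

definition coherent :: "(nat \<Rightarrow> 'a) \<Rightarrow> bool" where
  "coherent s \<longleftrightarrow> (\<forall>n. s n \<in> carrier R) \<and> (\<forall>n. s (Suc n) \<ominus> s n \<in> mpow R n)"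

definition limit :: "(nat \<Rightarrow> 'a) \<Rightarrow> nat \<Rightarrow> 'a set" where
  "limit s = (\<lambda>n. mpow R n +> s n)"

lemma coherent_carrier: "coherent s \<Longrightarrow> s n \<in> carrier R"
  by (simp add: coherent_def)

lemma coherent_diff:
  assumes "coherent s" "k \<le> n"
  shows "s n \<ominus> s k \<in> mpow R k"
  using assms(2)
proof (induction n rule: dec_induct)
  case base
  have "s k \<ominus> s k = \<zero>" using coherent_carrier[OF assms(1)] by (simp add: a_minus_def R.r_neg)
  then show ?case using idealD(3)[OF mpow_ideal] by simp
next
  case (step n)
  note c = coherent_carrier[OF assms(1)]
  have "s (Suc n) \<ominus> s k = (s (Suc n) \<ominus> s n) \<oplus> (s n \<ominus> s k)"
    using c[of n] c[of k] c[of "Suc n"] by algebra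
  moreover have "s (Suc n) \<ominus> s n \<in> mpow R k"
    using assms(1) mpow_mono[OF step(1)] by (auto simp: coherent_def)
  ultimately show ?case using idealD(4)[OF mpow_ideal] step by simp
qed

lemma mem_limit_iff: "coherent s \<Longrightarrow> x \<in> limit s n \<longleftrightarrow> x \<in> carrier R \<and> x \<ominus> s n \<in> mpow R n"
  by (simp add: limit_def mem_a_r_coset_iff[OF mpow_ideal] coherent_carrier del: ideal_pow.simps)

lemma limit_self: "coherent s \<Longrightarrow> s n \<in> limit s n"
  using coherent_diff[of s n n] by (simp add: mem_limit_iff coherent_carrier)

lemma limit_eqI:
  assumes "coherent s" "coherent t" "\<And>n. s n \<ominus> t n \<in> mpow R n"
  shows "limit s = limit t"
  using quotient_eq_iff_same_a_r_cos[OF mpow_ideal] assms by (auto simp: limit_def coherent_carrier)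

lemma carrier_Quot_mpow: "carrier (R Quot mpow R n) = {mpow R n +> r | r. r \<in> carrier R}"
  by (auto simp: FactRing_def A_RCOSETS_def')

lemma limit_closed:
  assumes "coherent s"
  shows "limit s \<in> carrier \<RR>"
proof -
  have "limit s (Suc n) \<subseteq> limit s n" for n
  proof
    fix x assume "x \<in> limit s (Suc n)"
    then have x: "x \<in> carrier R" "x \<ominus> s (Suc n) \<in> mpow R n"
      using assms mpow_Suc_subset[of n] by (auto simp: mem_limit_iff simp del: ideal_pow.simps)
    have "x \<ominus> s n = (x \<ominus> s (Suc n)) \<oplus> (s (Suc n) \<ominus> s n)"
      using x(1) coherent_carrier[OF assms, of n] coherent_carrier[OF assms, of "Suc n"] by algebra
    then show "x \<in> limit s n"
      using x idealD(4)[OF mpow_ideal] assms by (simp add: mem_limit_iff coherent_def)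
  qed
  moreover have "limit s n \<in> carrier (R Quot mpow R n)" for n
    using coherent_carrier[OF assms] by (auto simp: carrier_Quot_mpow limit_def)
  ultimately show ?thesis
    by (simp add: completion_def compl_carrier_def)
qed

lemma completionE:
  assumes "x \<in> carrier \<RR>"
  obtains s where "coherent s" "x = limit s"
proof -
  have x: "\<And>n. x n \<in> carrier (R Quot mpow R n)" "\<And>n. x (Suc n) \<subseteq> x n"
    using assms by (auto simp: completion_def compl_carrier_def)
  have "\<forall>n. \<exists>r. r \<in> carrier R \<and> x n = mpow R n +> r"
    using x(1) unfolding carrier_Quot_mpow by blast
  then obtain s where s: "\<And>n. s n \<in> carrier R" "\<And>n. x n = mpow R n +> s n"
    by metis
  have mem: "r \<in> x n \<longleftrightarrow> r \<in> carrier R \<and> r \<ominus> s n \<in> mpow R n" for r n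
    unfolding s(2) by (rule mem_a_r_coset_iff[OF mpow_ideal s(1)])
  have "s (Suc n) \<in> x (Suc n)" for n
    unfolding mem using s(1)[of "Suc n"] idealD(3)[OF mpow_ideal[of "Suc n"]]
    by (simp add: a_minus_def R.r_neg del: ideal_pow.simps)
  then have "coherent s"
    using x(2) mem s(1) unfolding coherent_def by blast
  then show ?thesis
    using that s(2) by (auto simp: limit_def)
qed

lemma coherent_const: "r \<in> carrier R \<Longrightarrow> coherent (\<lambda>_. r)"
  using idealD(3)[OF mpow_ideal] by (simp add: coherent_def a_minus_def R.r_neg)

lemma coherent_add:
  assumes "coherent s" "coherent t"
  shows "coherent (\<lambda>n. s n \<oplus> t n)"
  unfolding coherent_def
proof (intro conjI allI)
  fix n
  note c = coherent_carrier[OF assms(1)] coherent_carrier[OF assms(2)]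
  show "s n \<oplus> t n \<in> carrier R" using c by simp
  have "(s (Suc n) \<oplus> t (Suc n)) \<ominus> (s n \<oplus> t n) = (s (Suc n) \<ominus> s n) \<oplus> (t (Suc n) \<ominus> t n)"
    using c(1)[of n] c(1)[of "Suc n"] c(2)[of n] c(2)[of "Suc n"] by algebra
  then show "(s (Suc n) \<oplus> t (Suc n)) \<ominus> (s n \<oplus> t n) \<in> mpow R n"
    using assms idealD(4)[OF mpow_ideal] by (simp add: coherent_def)
qed

lemma coherent_mult:
  assumes "coherent s" "coherent t"
  shows "coherent (\<lambda>n. s n \<otimes> t n)"
  unfolding coherent_def
proof (intro conjI allI)
  fix n
  note c = coherent_carrier[OF assms(1)] coherent_carrier[OF assms(2)]
  show "s n \<otimes> t n \<in> carrier R" using c by simp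
  have "(s (Suc n) \<otimes> t (Suc n)) \<ominus> (s n \<otimes> t n)
      = s (Suc n) \<otimes> (t (Suc n) \<ominus> t n) \<oplus> t n \<otimes> (s (Suc n) \<ominus> s n)"
    using c(1)[of n] c(1)[of "Suc n"] c(2)[of n] c(2)[of "Suc n"] by algebra
  then show "(s (Suc n) \<otimes> t (Suc n)) \<ominus> (s n \<otimes> t n) \<in> mpow R n"
    using assms c idealD(4,7)[OF mpow_ideal] by (simp add: coherent_def)
qed

lemma coherent_neg: "coherent s \<Longrightarrow> coherent (\<lambda>n. \<ominus> s n)"
  using coherent_mult[OF coherent_const[of "\<ominus> \<one>"], of s] coherent_carrier[of s]
  by (simp add: l_minus)

lemma limit_add: "coherent s \<Longrightarrow> coherent t \<Longrightarrow> limit s \<oplus>\<^bsub>\<RR>\<^esub> limit t = limit (\<lambda>n. s n \<oplus> t n)"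
  using ideal.a_rcos_sum[OF mpow_ideal]
  by (simp add: completion_def compl_add_def limit_def FactRing_def coherent_carrier)

lemma limit_mult: "coherent s \<Longrightarrow> coherent t \<Longrightarrow> limit s \<otimes>\<^bsub>\<RR>\<^esub> limit t = limit (\<lambda>n. s n \<otimes> t n)"
  using ideal.rcoset_mult_add[OF mpow_ideal]
  by (simp add: completion_def compl_mult_def limit_def FactRing_def coherent_carrier)

lemma canon_limit: "canon R r = limit (\<lambda>_. r)"
  by (simp add: canon_def limit_def)

lemma completion_one: "\<one>\<^bsub>\<RR>\<^esub> = limit (\<lambda>_. \<one>)"
  by (simp add: completion_def compl_one_def limit_def FactRing_def)

lemma completion_zero: "\<zero>\<^bsub>\<RR>\<^esub> = limit (\<lambda>_. \<zero>)"
  using a_rcos_zero[OF mpow_ideal idealD(3)[OF mpow_ideal]]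
  by (simp add: completion_def compl_zero_def limit_def FactRing_def)

lemma completion_cring: "cring \<RR>"
proof (rule cringI)
  show "abelian_group \<RR>"
  proof (rule abelian_groupI)
    fix x y z assume xyz: "x \<in> carrier \<RR>" "y \<in> carrier \<RR>" "z \<in> carrier \<RR>"
    obtain s where s: "coherent s" "x = limit s" using xyz(1) by (rule completionE)
    obtain t where t: "coherent t" "y = limit t" using xyz(2) by (rule completionE)
    obtain r where r: "coherent r" "z = limit r" using xyz(3) by (rule completionE)
    note c = s(1) t(1) r(1) coherent_carrier[OF s(1)] coherent_carrier[OF t(1)] coherent_carrier[OF r(1)]
    show "x \<oplus>\<^bsub>\<RR>\<^esub> y \<in> carrier \<RR>"
      using c by (simp add: s(2) t(2) limit_add limit_closed coherent_add)
    show "x \<oplus>\<^bsub>\<RR>\<^esub> y = y \<oplus>\<^bsub>\<RR>\<^esub> x"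
      using c by (simp add: s(2) t(2) limit_add R.a_comm)
    show "x \<oplus>\<^bsub>\<RR>\<^esub> y \<oplus>\<^bsub>\<RR>\<^esub> z = x \<oplus>\<^bsub>\<RR>\<^esub> (y \<oplus>\<^bsub>\<RR>\<^esub> z)"
      using c by (simp add: s(2) t(2) r(2) limit_add coherent_add R.a_assoc)
  next
    fix x assume "x \<in> carrier \<RR>"
    then obtain s where s: "coherent s" "x = limit s" by (rule completionE)
    note c = s(1) coherent_carrier[OF s(1)] coherent_const
    show "\<zero>\<^bsub>\<RR>\<^esub> \<oplus>\<^bsub>\<RR>\<^esub> x = x"
      using c by (simp add: s(2) completion_zero limit_add)
    show "\<exists>y\<in>carrier \<RR>. y \<oplus>\<^bsub>\<RR>\<^esub> x = \<zero>\<^bsub>\<RR>\<^esub>"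
      using c by (intro bexI[of _ "limit (\<lambda>n. \<ominus> s n)"])
        (simp_all add: s(2) completion_zero limit_add coherent_neg limit_closed R.l_neg)
  qed (simp add: completion_zero limit_closed coherent_const)
  show "comm_monoid \<RR>"
  proof (rule comm_monoidI)
    fix x y z assume xyz: "x \<in> carrier \<RR>" "y \<in> carrier \<RR>" "z \<in> carrier \<RR>"
    obtain s where s: "coherent s" "x = limit s" using xyz(1) by (rule completionE)
    obtain t where t: "coherent t" "y = limit t" using xyz(2) by (rule completionE)
    obtain r where r: "coherent r" "z = limit r" using xyz(3) by (rule completionE)
    note c = s(1) t(1) r(1) coherent_carrier[OF s(1)] coherent_carrier[OF t(1)] coherent_carrier[OF r(1)]
    show "x \<otimes>\<^bsub>\<RR>\<^esub> y \<in> carrier \<RR>"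
      using c by (simp add: s(2) t(2) limit_mult limit_closed coherent_mult)
    show "x \<otimes>\<^bsub>\<RR>\<^esub> y = y \<otimes>\<^bsub>\<RR>\<^esub> x"
      using c by (simp add: s(2) t(2) limit_mult R.m_comm)
    show "x \<otimes>\<^bsub>\<RR>\<^esub> y \<otimes>\<^bsub>\<RR>\<^esub> z = x \<otimes>\<^bsub>\<RR>\<^esub> (y \<otimes>\<^bsub>\<RR>\<^esub> z)"
      using c by (simp add: s(2) t(2) r(2) limit_mult coherent_mult R.m_assoc)
    show "\<one>\<^bsub>\<RR>\<^esub> \<otimes>\<^bsub>\<RR>\<^esub> x = x"
      using c by (simp add: s(2) completion_one limit_mult coherent_const)
  qed (simp add: completion_one limit_closed coherent_const)
  fix x y z assume xyz: "x \<in> carrier \<RR>" "y \<in> carrier \<RR>" "z \<in> carrier \<RR>"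
  obtain s where s: "coherent s" "x = limit s" using xyz(1) by (rule completionE)
  obtain t where t: "coherent t" "y = limit t" using xyz(2) by (rule completionE)
  obtain r where r: "coherent r" "z = limit r" using xyz(3) by (rule completionE)
  note c = s(1) t(1) r(1) coherent_carrier[OF s(1)] coherent_carrier[OF t(1)] coherent_carrier[OF r(1)]
  show "(x \<oplus>\<^bsub>\<RR>\<^esub> y) \<otimes>\<^bsub>\<RR>\<^esub> z = x \<otimes>\<^bsub>\<RR>\<^esub> z \<oplus>\<^bsub>\<RR>\<^esub> y \<otimes>\<^bsub>\<RR>\<^esub> z"
    using c by (simp add: s(2) t(2) r(2) limit_add limit_mult coherent_add coherent_mult R.l_distr)
qed

text \<open>The representative chosen by \<open>SOME\<close> may come from any level k with m^k e =
  0. It acts like \<open>s n\<close>, because both agree on e with the representative at the larger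
  of the levels k and n.\<close>

lemma hat_smult_limit:
  assumes s: "coherent s" and e: "e \<in> \<E> n"
  shows "hat_smult R E (limit s) e = s n \<odot>\<^bsub>E\<^esub> e"
proof -
  have ec: "e \<in> carrier E" using e by (simp add: ann_elems_def)
  have congr: "r \<odot>\<^bsub>E\<^esub> e = q \<odot>\<^bsub>E\<^esub> e"
    if rq: "r \<in> carrier R" "q \<in> carrier R" "r \<ominus> q \<in> mpow R k" "\<And>a. a \<in> mpow R k \<Longrightarrow> a \<odot>\<^bsub>E\<^esub> e = \<zero>\<^bsub>E\<^esub>" for r q k
  proof -
    have "(r \<ominus> q) \<odot>\<^bsub>E\<^esub> e = \<zero>\<^bsub>E\<^esub>" using rq(3) by (rule rq(4))
    then show ?thesis using rq(1,2) ec by (simp add: smult_minus_distr M.minus_eq_zero_iff)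
  qed
  define Q where "Q r k \<longleftrightarrow> r \<in> limit s k \<and> (\<forall>a\<in>mpow R k. a \<odot>\<^bsub>E\<^esub> e = \<zero>\<^bsub>E\<^esub>)" for r k
  define r where "r = (SOME r. \<exists>k. Q r k)"
  have "\<exists>k. Q r k"
    unfolding r_def
    by (rule someI_ex[of "\<lambda>r. \<exists>k. Q r k"]) (use limit_self[OF s, of n] e in \<open>auto simp: Q_def ann_elems_def\<close>)
  then obtain k where k: "Q r k" by blast
  have r: "r \<in> carrier R" "r \<ominus> s k \<in> mpow R k" "\<And>a. a \<in> mpow R k \<Longrightarrow> a \<odot>\<^bsub>E\<^esub> e = \<zero>\<^bsub>E\<^esub>"
    using k mem_limit_iff[OF s, of r k] by (simp_all add: Q_def)
  have "r \<odot>\<^bsub>E\<^esub> e = s k \<odot>\<^bsub>E\<^esub> e"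
    using r coherent_carrier[OF s] by (intro congr[of r "s k" k]) auto
  also have "\<dots> = s (max k n) \<odot>\<^bsub>E\<^esub> e"
    using r(3) coherent_diff[OF s, of k "max k n"] coherent_carrier[OF s]
    by (intro congr[of "s (max k n)" "s k" k, symmetric]) auto
  also have "\<dots> = s n \<odot>\<^bsub>E\<^esub> e"
    using e coherent_diff[OF s, of n "max k n"] coherent_carrier[OF s]
    by (intro congr[of "s (max k n)" "s n" n]) (auto simp: ann_elems_def)
  finally show ?thesis
    by (simp add: hat_smult_def r_def Q_def)
qed

text \<open>Rebuilt as a record because the type of scalars changes; the additive group is that of E
  itself, so submodules over both rings can be compared as sets.\<close>

definition Ehat :: "(nat \<Rightarrow> 'a set, 'c) module" where
  "Ehat = \<lparr>partial_object.carrier = carrier E, monoid.mult = monoid.mult E, monoid.one = monoid.one E,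
     ring.zero = ring.zero E, ring.add = ring.add E, module.smult = hat_smult R E\<rparr>"

lemma Ehat_simps [simp]:
  "carrier Ehat = carrier E" "\<zero>\<^bsub>Ehat\<^esub> = \<zero>\<^bsub>E\<^esub>" "ring.add Ehat = ring.add E" "module.smult Ehat = hat_smult R E"
  by (simp_all add: Ehat_def)

lemma hat_smult_canon:
  assumes "r \<in> carrier R" "e \<in> carrier E"
  shows "hat_smult R E (canon R r) e = r \<odot>\<^bsub>E\<^esub> e"
proof -
  obtain n where "e \<in> \<E> n" using torsion[OF assms(2)] by blast
  then show ?thesis
    using hat_smult_limit[OF coherent_const[OF assms(1)]] by (simp add: canon_limit)
qed

text \<open>One level contains the two module elements involved, and there each scalar acts through
  its representative in R, so the axioms are inherited from E.\<close>

lemma Ehat_module: "module \<RR> Ehat"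
proof (rule moduleI)
  show "cring \<RR>" by (rule completion_cring)
  show "abelian_group Ehat"
  proof (rule abelian_groupI)
    fix x assume "x \<in> carrier Ehat"
    then show "\<exists>y\<in>carrier Ehat. y \<oplus>\<^bsub>Ehat\<^esub> x = \<zero>\<^bsub>Ehat\<^esub>"
      by (intro bexI[of _ "\<ominus>\<^bsub>E\<^esub> x"]) (simp_all add: M.l_neg)
  qed (simp_all add: M.a_ac)
  fix x y e f assume xy: "x \<in> carrier \<RR>" "y \<in> carrier \<RR>" and ef: "e \<in> carrier Ehat" "f \<in> carrier Ehat"
  obtain s where s: "coherent s" "x = limit s" using xy(1) by (rule completionE)
  obtain t where t: "coherent t" "y = limit t" using xy(2) by (rule completionE)
  obtain i j where ij: "e \<in> \<E> i" "f \<in> \<E> j" using torsion[of e] torsion[of f] ef by auto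
  define n where "n = max i j"
  have n: "e \<in> \<E> n" "f \<in> \<E> n"
    using ij bounded_mono[of i n] bounded_mono[of j n] by (auto simp: n_def)
  note Ed = submoduleD[OF bounded_submodule[of n]]
  note c = s(1) t(1) coherent_carrier[OF s(1)] coherent_carrier[OF t(1)] n ef[simplified]
  show "x \<odot>\<^bsub>Ehat\<^esub> e \<in> carrier Ehat"
    using c by (simp add: s(2) hat_smult_limit)
  show "(x \<oplus>\<^bsub>\<RR>\<^esub> y) \<odot>\<^bsub>Ehat\<^esub> e = x \<odot>\<^bsub>Ehat\<^esub> e \<oplus>\<^bsub>Ehat\<^esub> y \<odot>\<^bsub>Ehat\<^esub> e"
    using c by (simp add: s(2) t(2) limit_add hat_smult_limit[where n=n] coherent_add smult_l_distr)
  show "x \<odot>\<^bsub>Ehat\<^esub> (e \<oplus>\<^bsub>Ehat\<^esub> f) = x \<odot>\<^bsub>Ehat\<^esub> e \<oplus>\<^bsub>Ehat\<^esub> x \<odot>\<^bsub>Ehat\<^esub> f"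
    using c Ed(3) by (simp add: s(2) hat_smult_limit[where n=n] smult_r_distr)
  show "(x \<otimes>\<^bsub>\<RR>\<^esub> y) \<odot>\<^bsub>Ehat\<^esub> e = x \<odot>\<^bsub>Ehat\<^esub> (y \<odot>\<^bsub>Ehat\<^esub> e)"
    using c Ed(4) by (simp add: s(2) t(2) limit_mult hat_smult_limit[where n=n] coherent_mult smult_assoc1)
next
  fix e assume "e \<in> carrier Ehat"
  then show "\<one>\<^bsub>\<RR>\<^esub> \<odot>\<^bsub>Ehat\<^esub> e = e"
    using hat_smult_canon[of \<one> e] by (simp add: completion_one canon_limit)
qed

lemma canon_closed: "r \<in> carrier R \<Longrightarrow> canon R r \<in> carrier \<RR>"
  by (simp add: canon_limit limit_closed coherent_const)

text \<open>On each single element a scalar of the completion acts as some element of R, so closure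
  under R suffices; conversely R acts through \<open>canon\<close>.\<close>

lemma submodule_Ehat_iff: "submodule N \<RR> Ehat \<longleftrightarrow> submodule N R E"
proof
  interpret H: module \<RR> Ehat by (rule Ehat_module)
  {
    assume N: "submodule N \<RR> Ehat"
    note Nd = H.submoduleD[OF N]
    show "submodule N R E"
    proof (rule submodule_memI)
      fix r x assume rx: "r \<in> carrier R" "x \<in> N"
      then have "canon R r \<odot>\<^bsub>Ehat\<^esub> x \<in> N" by (intro Nd(4) canon_closed)
      then show "r \<odot>\<^bsub>E\<^esub> x \<in> N" using rx Nd(1) by (simp add: hat_smult_canon)
    qed (use Nd in auto)
  }
  {
    assume N: "submodule N R E"
    note Nd = submoduleD[OF N]
    show "submodule N \<RR> Ehat"
    proof (rule H.submodule_memI)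
      fix x e assume x: "x \<in> carrier \<RR>" and e: "e \<in> N"
      obtain s where s: "coherent s" "x = limit s" using x by (rule completionE)
      obtain n where n: "e \<in> \<E> n" using torsion Nd(1)[OF e] by blast
      show "x \<odot>\<^bsub>Ehat\<^esub> e \<in> N"
        using hat_smult_limit[OF s(1) n] Nd(4)[OF coherent_carrier[OF s(1)] e] by (simp add: s(2))
    qed (use Nd in auto)
  }
qed

lemma ann_hat_eq: "ann_hat R E N = ann_ring \<RR> Ehat N"
  by (simp add: ann_hat_def ann_ring_def)

lemma ann_mod_eq: "ann_mod R E P = ann_elems Ehat P"
  by (simp add: ann_mod_def ann_elems_def)

end

section \<open>Matlis duality over the completion\<close>

context residue_hull
begin

text \<open>The coherent multipliers define one element of the completion, and every x lies on some
  level, where that element acts as the corresponding multiplier.\<close>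

lemma linear_on_hat_smult:
  assumes "submodule X R E" "linear_on X \<phi>"
  shows "\<exists>c\<in>carrier \<RR>. \<forall>x\<in>X. \<phi> x = hat_smult R E c x"
proof -
  obtain s where s: "\<And>k. s k \<in> carrier R" "\<And>k. s (Suc k) \<ominus> s k \<in> mpow R k"
    "\<And>k x. x \<in> X \<Longrightarrow> x \<in> \<E> k \<Longrightarrow> \<phi> x = s k \<odot>\<^bsub>E\<^esub> x"
    using linear_on_coherent_sequence[OF assms] by blast
  have c: "coherent s" using s by (simp add: coherent_def)
  have "\<phi> x = hat_smult R E (limit s) x" if x: "x \<in> X" for x
  proof -
    obtain n where "x \<in> \<E> n" using torsion submoduleD(1)[OF assms(1) x] by blast
    then show ?thesis using s(3) x hat_smult_limit[OF c] by simp
  qed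
  then show ?thesis using limit_closed[OF c] by blast
qed

text \<open>An e outside N is separated from N on its own level n by some r in R. Lifting r through
  the higher levels gives an element of the completion that kills all of N but still acts on e as
  r.\<close>

lemma ann_elems_ann_ring_hat:
  assumes N: "submodule N \<RR> Ehat"
  shows "ann_elems Ehat (ann_ring \<RR> Ehat N) = N"
proof
  have NR: "submodule N R E" using N by (simp add: submodule_Ehat_iff)
  note Nd = submoduleD[OF NR]
  show "N \<subseteq> ann_elems Ehat (ann_ring \<RR> Ehat N)"
    using Nd(1) by (auto simp: ann_elems_def ann_ring_def)
  show "ann_elems Ehat (ann_ring \<RR> Ehat N) \<subseteq> N"
  proof (rule ccontr)
    assume "\<not> ann_elems Ehat (ann_ring \<RR> Ehat N) \<subseteq> N"
    then obtain e where e: "e \<in> ann_elems Ehat (ann_ring \<RR> Ehat N)" "e \<notin> N" by blast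
    have ec: "e \<in> carrier E" using e by (simp add: ann_elems_def)
    obtain n where n: "e \<in> \<E> n" using torsion[OF ec] by blast
    have "e \<notin> ann_elems E (ann_ring R E (N \<inter> \<E> n))"
      using reflexive_submodule_Int_ann_elems[OF NR mpow_ideal subset_refl, of n] e
      unfolding reflexive_submodule_def by blast
    then obtain r where r: "r \<in> ann_ring R E (N \<inter> \<E> n)" "r \<odot>\<^bsub>E\<^esub> e \<noteq> \<zero>\<^bsub>E\<^esub>"
      using ec by (auto simp: ann_elems_def)
    have "\<exists>t. \<forall>j. (t j \<in> ann_ring R E (N \<inter> \<E> (n + j)) \<and> (j = 0 \<longrightarrow> t j = r)) \<and>
        t (Suc j) \<ominus> t j \<in> mpow R (n + j)"
    proof (rule dependent_nat_choice)
      show "\<exists>x. x \<in> ann_ring R E (N \<inter> \<E> (n + 0)) \<and> (0 = (0::nat) \<longrightarrow> x = r)"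
        using r by simp
      fix x j assume "x \<in> ann_ring R E (N \<inter> \<E> (n + j)) \<and> (j = 0 \<longrightarrow> x = r)"
      then obtain a where a: "a \<in> ann_ring R E (N \<inter> \<E> (n + Suc j))" "x \<ominus> a \<in> mpow R (n + j)"
        using ann_ring_bounded_step[OF NR, of x "n + j"] by auto
      have "x \<in> carrier R" "a \<in> carrier R"
        using a \<open>x \<in> _ \<and> _\<close> by (auto simp: ann_ring_def)
      then have "a \<ominus> x = \<ominus> (x \<ominus> a)" by algebra
      then have "a \<ominus> x \<in> mpow R (n + j)"
        using a idealD(5)[OF mpow_ideal] by simp
      then show "\<exists>y. (y \<in> ann_ring R E (N \<inter> \<E> (n + Suc j)) \<and> (Suc j = 0 \<longrightarrow> y = r)) \<and>
          y \<ominus> x \<in> mpow R (n + j)"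
        using a by auto
    qed
    then obtain t where t: "\<And>j. t j \<in> ann_ring R E (N \<inter> \<E> (n + j))" "t 0 = r"
      "\<And>j. t (Suc j) \<ominus> t j \<in> mpow R (n + j)"
      by blast
    \<comment> \<open>Truncated subtraction makes the sequence constantly r up to index n, so
      coherence is trivial there, and \<open>s (n + k)\<close> is \<open>t k\<close>.\<close>
    define s where "s k = t (k - n)" for k
    have tc: "t j \<in> carrier R" for j using t(1)[of j] by (simp add: ann_ring_def)
    have "s (Suc k) \<ominus> s k \<in> mpow R k" for k
    proof (cases "n \<le> k")
      case True
      then show ?thesis using t(3)[of "k - n"] by (simp add: s_def Suc_diff_le)
    next
      case False
      then have "s (Suc k) \<ominus> s k = \<zero>" using tc by (simp add: s_def a_minus_def R.r_neg)
      then show ?thesis using idealD(3)[OF mpow_ideal] by simp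
    qed
    then have s: "coherent s" using tc by (simp add: coherent_def s_def)
    have "limit s \<in> ann_ring \<RR> Ehat N"
      unfolding ann_ring_def
    proof (intro CollectI conjI ballI limit_closed[OF s])
      fix x assume x: "x \<in> N"
      obtain k where k: "x \<in> \<E> k" using torsion Nd(1)[OF x] by blast
      then have xk: "x \<in> \<E> (n + k)" using bounded_mono[of k "n + k"] by auto
      then show "limit s \<odot>\<^bsub>Ehat\<^esub> x = \<zero>\<^bsub>Ehat\<^esub>"
        using hat_smult_limit[OF s xk] t(1)[of k] x by (simp add: s_def ann_ring_def)
    qed
    then have "hat_smult R E (limit s) e = \<zero>\<^bsub>E\<^esub>"
      using e by (simp add: ann_elems_def)
    then show False using hat_smult_limit[OF s n] r t(2) by (simp add: s_def)
  qed
qed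

text \<open>In the base case, y kills all of E; then \<open>cogenerator\<close>, applied to every
  power of \<mm>, forces each representative \<open>s n\<close> into m^n, so y is zero.\<close>

lemma ann_ring_ann_elems_fg:
  assumes "fg_ideal \<RR> J"
  shows "ann_ring \<RR> Ehat (ann_elems Ehat J) \<subseteq> J"
  using assms
proof (induction rule: fg_ideal.induct)
  case fg_zero
  interpret H: module \<RR> Ehat by (rule Ehat_module)
  show ?case
  proof
    fix y assume y: "y \<in> ann_ring \<RR> Ehat (ann_elems Ehat {\<zero>\<^bsub>\<RR>\<^esub>})"
    then have "y \<in> carrier \<RR>" by (simp add: ann_ring_def)
    then obtain s where s: "coherent s" "y = limit s" by (rule completionE)
    have kill: "hat_smult R E y e = \<zero>\<^bsub>E\<^esub>" if "e \<in> carrier E" for e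
      using y H.smult_l_null[of e] that by (simp add: ann_ring_def ann_elems_def)
    have "s n \<in> mpow R n" for n
    proof (rule ccontr)
      assume "s n \<notin> mpow R n"
      then obtain e where e: "e \<in> \<E> n" "s n \<odot>\<^bsub>E\<^esub> e \<noteq> \<zero>\<^bsub>E\<^esub>"
        using cogenerator[OF mpow_ideal coherent_carrier[OF s(1)]] by blast
      then show False
        using kill[of e] hat_smult_limit[OF s(1) e(1)] s(2) by (simp add: ann_elems_def)
    qed
    then have "y = \<zero>\<^bsub>\<RR>\<^esub>"
      unfolding s(2) completion_zero using s(1) coherent_carrier[OF s(1)]
      by (intro limit_eqI coherent_const) (simp_all add: a_minus_def)
    then show "y \<in> {\<zero>\<^bsub>\<RR>\<^esub>}" by simp
  qed
next
  case (fg_adjoin J x)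
  interpret H: module \<RR> Ehat by (rule Ehat_module)
  have J: "ideal J \<RR>" using fg_adjoin.hyps(1) by (rule H.R.fg_ideal_imp_ideal)
  note x = fg_adjoin.hyps(2)
  define N where "N = ann_elems Ehat J"
  have N: "submodule N \<RR> Ehat" unfolding N_def by (rule H.ann_elems_submodule[OF idealD(1)[OF J]])
  note Nd = H.submoduleD[OF N]
  define X where "X = (\<lambda>e. x \<odot>\<^bsub>Ehat\<^esub> e) ` N"
  have X: "submodule X R E"
    unfolding submodule_Ehat_iff[symmetric] X_def using N x by (rule H.smult_image_submodule)
  show ?case
  proof
    fix y assume y: "y \<in> ann_ring \<RR> Ehat (ann_elems Ehat (adjoin \<RR> J x))"
    then have yc: "y \<in> carrier \<RR>" by (simp add: ann_ring_def)
    \<comment> \<open>Well-definedness of x e |-> y e: the difference of e and f is killed by J and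
      by x, hence by y.\<close>
    have ker: "y \<odot>\<^bsub>Ehat\<^esub> e = y \<odot>\<^bsub>Ehat\<^esub> f"
      if ef: "e \<in> N" "f \<in> N" "x \<odot>\<^bsub>Ehat\<^esub> e = x \<odot>\<^bsub>Ehat\<^esub> f" for e f
    proof -
      note efc = Nd(1)[OF ef(1)] Nd(1)[OF ef(2)]
      have diff: "z \<odot>\<^bsub>Ehat\<^esub> (e \<ominus>\<^bsub>Ehat\<^esub> f) = z \<odot>\<^bsub>Ehat\<^esub> e \<ominus>\<^bsub>Ehat\<^esub> z \<odot>\<^bsub>Ehat\<^esub> f" if "z \<in> carrier \<RR>" for z
        using that efc H.smult_r_distr[of z e "\<ominus>\<^bsub>Ehat\<^esub> f"] H.smult_r_minus[of z f]
          H.M.a_inv_closed[of f] unfolding a_minus_def by metis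
      have "x \<odot>\<^bsub>Ehat\<^esub> (e \<ominus>\<^bsub>Ehat\<^esub> f) = \<zero>\<^bsub>Ehat\<^esub>"
        unfolding diff[OF x] using ef(3) H.M.minus_eq_zero_iff H.smult_closed[OF x] efc by metis
      then have "e \<ominus>\<^bsub>Ehat\<^esub> f \<in> ann_elems Ehat (adjoin \<RR> J x)"
        unfolding H.ann_elems_adjoin[OF J x] using Nd(5)[OF ef(1,2)] by (simp add: N_def)
      then have "y \<odot>\<^bsub>Ehat\<^esub> (e \<ominus>\<^bsub>Ehat\<^esub> f) = \<zero>\<^bsub>Ehat\<^esub>"
        using y unfolding ann_ring_def by blast
      then show ?thesis
        unfolding diff[OF yc] using H.M.minus_eq_zero_iff H.smult_closed[OF yc] efc by metis
    qed
    define \<phi> where "\<phi> w = y \<odot>\<^bsub>Ehat\<^esub> (SOME e. e \<in> N \<and> w = x \<odot>\<^bsub>Ehat\<^esub> e)" for w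
    have \<phi>: "\<phi> (x \<odot>\<^bsub>Ehat\<^esub> e) = y \<odot>\<^bsub>Ehat\<^esub> e" if e: "e \<in> N" for e
    proof -
      define f where "f = (SOME f. f \<in> N \<and> x \<odot>\<^bsub>Ehat\<^esub> e = x \<odot>\<^bsub>Ehat\<^esub> f)"
      have "f \<in> N \<and> x \<odot>\<^bsub>Ehat\<^esub> e = x \<odot>\<^bsub>Ehat\<^esub> f"
        unfolding f_def by (rule someI[of _ e]) (use e in simp)
      then have "y \<odot>\<^bsub>Ehat\<^esub> e = y \<odot>\<^bsub>Ehat\<^esub> f" using ker e by blast
      then show ?thesis by (simp add: \<phi>_def f_def)
    qed
    have "linear_on X \<phi>"
      unfolding linear_on_def
    proof (intro conjI ballI)
      fix w assume "w \<in> X"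
      then obtain e where e: "e \<in> N" "w = x \<odot>\<^bsub>Ehat\<^esub> e" by (auto simp: X_def)
      show "\<phi> w \<in> carrier E"
        using H.smult_closed[OF yc Nd(1)[OF e(1)]] \<phi>[OF e(1)] e(2) by simp
      {
        fix v assume "v \<in> X"
        then obtain f where f: "f \<in> N" "v = x \<odot>\<^bsub>Ehat\<^esub> f" by (auto simp: X_def)
        have "w \<oplus>\<^bsub>Ehat\<^esub> v = x \<odot>\<^bsub>Ehat\<^esub> (e \<oplus>\<^bsub>Ehat\<^esub> f)"
          unfolding e(2) f(2) by (rule H.smult_r_distr[symmetric]) (use x Nd(1) e f in auto)
        then have "\<phi> (w \<oplus>\<^bsub>Ehat\<^esub> v) = y \<odot>\<^bsub>Ehat\<^esub> (e \<oplus>\<^bsub>Ehat\<^esub> f)"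
          using \<phi> Nd(3)[OF e(1) f(1)] by simp
        also have "\<dots> = \<phi> w \<oplus>\<^bsub>Ehat\<^esub> \<phi> v"
          unfolding e(2) f(2) \<phi>[OF e(1)] \<phi>[OF f(1)]
          by (rule H.smult_r_distr) (use yc Nd(1) e f in auto)
        finally show "\<phi> (w \<oplus>\<^bsub>E\<^esub> v) = \<phi> w \<oplus>\<^bsub>E\<^esub> \<phi> v" by simp
      }
    next
      \<comment> \<open>Linearity over R is seen by letting r act through the completion, where its
        action commutes with those of x and y.\<close>
      fix r w assume r: "r \<in> carrier R" and "w \<in> X"
      then obtain e where e: "e \<in> N" "w = x \<odot>\<^bsub>Ehat\<^esub> e" by (auto simp: X_def)
      note rc = canon_closed[OF r]
      have canon: "canon R r \<odot>\<^bsub>Ehat\<^esub> z = r \<odot>\<^bsub>E\<^esub> z" if "z \<in> carrier E" for z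
        using hat_smult_canon[OF r that] by simp
      have "r \<odot>\<^bsub>E\<^esub> w = canon R r \<odot>\<^bsub>Ehat\<^esub> (x \<odot>\<^bsub>Ehat\<^esub> e)"
        using canon[of w] H.smult_closed[OF x Nd(1)[OF e(1)]] e(2) by simp
      also have "\<dots> = x \<odot>\<^bsub>Ehat\<^esub> (canon R r \<odot>\<^bsub>Ehat\<^esub> e)"
        using rc x Nd(1)[OF e(1)] by (rule H.smult_commute)
      finally have "\<phi> (r \<odot>\<^bsub>E\<^esub> w) = y \<odot>\<^bsub>Ehat\<^esub> (canon R r \<odot>\<^bsub>Ehat\<^esub> e)"
        using \<phi>[OF Nd(4)[OF rc e(1)]] by simp
      also have "\<dots> = canon R r \<odot>\<^bsub>Ehat\<^esub> (y \<odot>\<^bsub>Ehat\<^esub> e)"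
        using yc rc Nd(1)[OF e(1)] by (rule H.smult_commute)
      also have "\<dots> = r \<odot>\<^bsub>E\<^esub> \<phi> w"
        using canon[of "y \<odot>\<^bsub>Ehat\<^esub> e"] H.smult_closed[OF yc Nd(1)[OF e(1)]] \<phi>[OF e(1)] e(2) by simp
      finally show "\<phi> (r \<odot>\<^bsub>E\<^esub> w) = r \<odot>\<^bsub>E\<^esub> \<phi> w" .
    qed
    then obtain c where c: "c \<in> carrier \<RR>" "\<And>w. w \<in> X \<Longrightarrow> \<phi> w = c \<odot>\<^bsub>Ehat\<^esub> w"
      using linear_on_hat_smult[OF X] unfolding Ehat_simps by metis
    have "y \<ominus>\<^bsub>\<RR>\<^esub> c \<otimes>\<^bsub>\<RR>\<^esub> x \<in> ann_ring \<RR> Ehat N"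
      unfolding ann_ring_def
    proof (intro CollectI conjI ballI)
      show "y \<ominus>\<^bsub>\<RR>\<^esub> c \<otimes>\<^bsub>\<RR>\<^esub> x \<in> carrier \<RR>" using yc c x by (intro H.R.minus_closed H.R.m_closed)
      fix e assume e: "e \<in> N"
      note ec = Nd(1)[OF e]
      have "(y \<ominus>\<^bsub>\<RR>\<^esub> c \<otimes>\<^bsub>\<RR>\<^esub> x) \<odot>\<^bsub>Ehat\<^esub> e = y \<odot>\<^bsub>Ehat\<^esub> e \<ominus>\<^bsub>Ehat\<^esub> (c \<otimes>\<^bsub>\<RR>\<^esub> x) \<odot>\<^bsub>Ehat\<^esub> e"
        by (rule H.smult_minus_distr[OF yc H.R.m_closed[OF c(1) x] ec])
      moreover have "(c \<otimes>\<^bsub>\<RR>\<^esub> x) \<odot>\<^bsub>Ehat\<^esub> e = y \<odot>\<^bsub>Ehat\<^esub> e"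
        using H.smult_assoc1[OF c(1) x ec] c(2)[of "x \<odot>\<^bsub>Ehat\<^esub> e"] \<phi>[OF e] e unfolding X_def by simp
      ultimately show "(y \<ominus>\<^bsub>\<RR>\<^esub> c \<otimes>\<^bsub>\<RR>\<^esub> x) \<odot>\<^bsub>Ehat\<^esub> e = \<zero>\<^bsub>Ehat\<^esub>"
        using H.M.minus_eq_zero_iff H.smult_closed[OF yc ec] by metis
    qed
    then have j: "y \<ominus>\<^bsub>\<RR>\<^esub> c \<otimes>\<^bsub>\<RR>\<^esub> x \<in> J" using fg_adjoin.IH by (auto simp: N_def)
    have "y = (y \<ominus>\<^bsub>\<RR>\<^esub> c \<otimes>\<^bsub>\<RR>\<^esub> x) \<oplus>\<^bsub>\<RR>\<^esub> c \<otimes>\<^bsub>\<RR>\<^esub> x"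
      using yc H.R.m_closed[OF c(1) x] by (simp add: a_minus_def H.R.a_assoc H.R.l_neg)
    then show "y \<in> adjoin \<RR> J x" using j c(1) by (auto simp: adjoin_def)
  qed
qed

section \<open>Noetherianity of the completion\<close>

lemma canon_zero: "canon R \<zero> = \<zero>\<^bsub>\<RR>\<^esub>"
  by (simp add: canon_limit completion_zero)

lemma canon_one: "canon R \<one> = \<one>\<^bsub>\<RR>\<^esub>"
  by (simp add: canon_limit completion_one)

lemma canon_add: "a \<in> carrier R \<Longrightarrow> b \<in> carrier R \<Longrightarrow> canon R (a \<oplus> b) = canon R a \<oplus>\<^bsub>\<RR>\<^esub> canon R b"
  by (simp add: canon_limit limit_add coherent_const)

lemma canon_mult: "a \<in> carrier R \<Longrightarrow> b \<in> carrier R \<Longrightarrow> canon R (a \<otimes> b) = canon R a \<otimes>\<^bsub>\<RR>\<^esub> canon R b"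
  by (simp add: canon_limit limit_mult coherent_const)

lemma canon_pow: "a \<in> carrier R \<Longrightarrow> canon R (a [^] (n::nat)) = canon R a [^]\<^bsub>\<RR>\<^esub> n"
  by (induction n) (simp_all add: canon_one canon_mult)

text \<open>An element e killed by G is also killed by some power a^n; writing y = g + a^n b for
  that n shows that y kills e. So y lies in the double annihilator of G, which is G.\<close>

lemma completion_fg_closed:
  assumes a: "a \<in> \<mm>" and G: "fg_ideal \<RR> G" and y: "y \<in> carrier \<RR>"
    and approx: "\<And>n. \<exists>g\<in>G. \<exists>b\<in>carrier \<RR>. y = g \<oplus>\<^bsub>\<RR>\<^esub> canon R a [^]\<^bsub>\<RR>\<^esub> (n::nat) \<otimes>\<^bsub>\<RR>\<^esub> b"
  shows "y \<in> G"
proof -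
  interpret H: module \<RR> Ehat by (rule Ehat_module)
  have GI: "ideal G \<RR>" using G by (rule H.R.fg_ideal_imp_ideal)
  have ac: "a \<in> carrier R" using a by (rule max_ideal_carrier)
  have "y \<odot>\<^bsub>Ehat\<^esub> e = \<zero>\<^bsub>Ehat\<^esub>" if e: "e \<in> ann_elems Ehat G" for e
  proof -
    have ec: "e \<in> carrier Ehat" using e by (simp add: ann_elems_def)
    obtain n where n: "e \<in> \<E> n" using torsion ec by auto
    obtain g b where gb: "g \<in> G" "b \<in> carrier \<RR>"
      "y = g \<oplus>\<^bsub>\<RR>\<^esub> canon R (a [^] n) \<otimes>\<^bsub>\<RR>\<^esub> b"
      using approx[of n] unfolding canon_pow[OF ac, symmetric] by blast
    have ap: "a [^] n \<in> carrier R" using ac by simp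
    note pc = canon_closed[OF ap]
    have "canon R (a [^] n) \<odot>\<^bsub>Ehat\<^esub> e = \<zero>\<^bsub>Ehat\<^esub>"
      using hat_smult_canon[OF ap] ec n pow_mem_mpow[OF a, of n] by (simp add: ann_elems_def)
    then have "(canon R (a [^] n) \<otimes>\<^bsub>\<RR>\<^esub> b) \<odot>\<^bsub>Ehat\<^esub> e = \<zero>\<^bsub>Ehat\<^esub>"
      using H.smult_assoc1[OF pc gb(2) ec] H.smult_reorder[OF pc gb(2) ec] by simp
    moreover have "g \<odot>\<^bsub>Ehat\<^esub> e = \<zero>\<^bsub>Ehat\<^esub>"
      using e gb(1) unfolding ann_elems_def by blast
    ultimately show ?thesis
      unfolding gb(3) using H.smult_l_distr[OF idealD(2)[OF GI gb(1)] H.R.m_closed[OF pc gb(2)] ec]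
      by simp
  qed
  then have "y \<in> ann_ring \<RR> Ehat (ann_elems Ehat G)"
    using y by (simp add: ann_ring_def)
  then show ?thesis using ann_ring_ann_elems_fg[OF G] by blast
qed

text \<open>\<open>K\<close> is the extension of \<open>I\<close> to the completion, built from the
  images of the generators and described by minimality.\<close>

lemma fg_ideal_canon_image:
  assumes "fg_ideal R I"
  shows "\<exists>K. fg_ideal \<RR> K \<and> canon R ` I \<subseteq> K \<and> (\<forall>J. ideal J \<RR> \<and> canon R ` I \<subseteq> J \<longrightarrow> K \<subseteq> J)"
  using assms
proof (induction rule: fg_ideal.induct)
  case fg_zero
  have "\<zero>\<^bsub>\<RR>\<^esub> \<in> J" if "ideal J \<RR>" for J using that by (rule idealD(3))
  then show ?case
    by (intro exI[of _ "{\<zero>\<^bsub>\<RR>\<^esub>}"]) (simp add: fg_ideal.fg_zero canon_zero)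
next
  case (fg_adjoin I x)
  interpret C: cring \<RR> by (rule completion_cring)
  have I: "ideal I R" using fg_adjoin.hyps(1) by (rule R.fg_ideal_imp_ideal)
  obtain K where "fg_ideal \<RR> K \<and> canon R ` I \<subseteq> K \<and> (\<forall>J. ideal J \<RR> \<and> canon R ` I \<subseteq> J \<longrightarrow> K \<subseteq> J)"
    using fg_adjoin.IH ..
  then have K: "fg_ideal \<RR> K" "canon R ` I \<subseteq> K" "\<And>J. ideal J \<RR> \<Longrightarrow> canon R ` I \<subseteq> J \<Longrightarrow> K \<subseteq> J"
    by simp_all
  have x: "x \<in> carrier R" "canon R x \<in> carrier \<RR>" using fg_adjoin.hyps(2) canon_closed by auto
  show ?case
  proof (intro exI[of _ "adjoin \<RR> K (canon R x)"] conjI allI impI)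
    show "fg_ideal \<RR> (adjoin \<RR> K (canon R x))" using K(1) x(2) by (rule fg_ideal.fg_adjoin)
    show "canon R ` adjoin R I x \<subseteq> adjoin \<RR> K (canon R x)"
    proof
      fix z assume "z \<in> canon R ` adjoin R I x"
      then obtain i a where "i \<in> I" "a \<in> carrier R" "z = canon R (i \<oplus> a \<otimes> x)"
        unfolding adjoin_def by blast
      then show "z \<in> adjoin \<RR> K (canon R x)"
        using K(2) x idealD(2)[OF I] by (intro adjoinI) (auto simp: canon_add canon_mult canon_closed)
    qed
    fix J assume J: "ideal J \<RR> \<and> canon R ` adjoin R I x \<subseteq> J"
    then have "canon R ` I \<subseteq> J" "canon R x \<in> J"
      using R.adjoin_superset[OF I x(1)] R.adjoin_self[OF I x(1)] by auto
    then show "adjoin \<RR> K (canon R x) \<subseteq> J"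
      using J K(3) by (intro C.adjoin_minimal) auto
  qed
qed

lemma fg_max_ideal: "fg_ideal R \<mm>"
  using noetherian_ring.finetely_gen[OF noetherian max_ideal_ideal] fg_ideal_Idl by auto

text \<open>With \<open>K\<close> the extension of \<mm>, nothing lies strictly between
  \<open>K\<close> and the completion: an element outside \<open>K\<close> has a first
  representative that is a unit, hence is invertible modulo \<open>K\<close>.\<close>

lemma fg_ideal_above_max_ideal:
  assumes J: "ideal J \<RR>" "canon R ` \<mm> \<subseteq> J"
  shows "fg_ideal \<RR> J"
proof -
  interpret H: module \<RR> Ehat by (rule Ehat_module)
  obtain K where "fg_ideal \<RR> K \<and> canon R ` \<mm> \<subseteq> K \<and> (\<forall>J. ideal J \<RR> \<and> canon R ` \<mm> \<subseteq> J \<longrightarrow> K \<subseteq> J)"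
    using fg_ideal_canon_image[OF fg_max_ideal] ..
  then have K: "fg_ideal \<RR> K" "canon R ` \<mm> \<subseteq> K" "K \<subseteq> J"
    using J by simp_all
  \<comment> \<open>The kernel of the projection to the residue field lies in K: elements killed by
    K are killed by \<mm>, so they lie on level 1, where \<open>limit s\<close> acts as
    \<open>s 1\<close>. The double annihilator of K then applies.\<close>
  have KI: "limit s \<in> K" if s: "coherent s" "s 1 \<in> \<mm>" for s
  proof -
    have "limit s \<odot>\<^bsub>Ehat\<^esub> e = \<zero>\<^bsub>Ehat\<^esub>" if e: "e \<in> ann_elems Ehat K" for e
    proof -
      have ec: "e \<in> carrier E" using e by (simp add: ann_elems_def)
      have kill: "a \<odot>\<^bsub>E\<^esub> e = \<zero>\<^bsub>E\<^esub>" if a: "a \<in> \<mm>" for a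
      proof -
        have "canon R a \<odot>\<^bsub>Ehat\<^esub> e = \<zero>\<^bsub>Ehat\<^esub>" using e a K(2) unfolding ann_elems_def by blast
        then show ?thesis using hat_smult_canon[OF max_ideal_carrier[OF a] ec] by simp
      qed
      have "e \<in> \<E> (Suc 0)"
        using kill submoduleD(2)[OF bounded_submodule[of 0]] by (intro bounded_SucI[OF ec]) metis
      then show ?thesis
        using hat_smult_limit[OF s(1), of e "Suc 0"] kill[OF s(2)] by simp
    qed
    then have "limit s \<in> ann_ring \<RR> Ehat (ann_elems Ehat K)"
      using limit_closed[OF s(1)] by (simp add: ann_ring_def)
    then show ?thesis using ann_ring_ann_elems_fg[OF K(1)] by blast
  qed
  show ?thesis
  proof (cases "J \<subseteq> K")
    case True
    then show ?thesis using K by (simp add: subset_antisym)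
  next
    case False
    then obtain y where y: "y \<in> J" "y \<notin> K" by blast
    obtain s where s: "coherent s" "y = limit s"
      using completionE idealD(2)[OF J(1) y(1)] by metis
    have "s 1 \<notin> \<mm>" using KI s y by blast
    then obtain b where b: "b \<in> carrier R" "b \<otimes> s 1 = \<one>"
      using unit_if_notin_max_ideal coherent_carrier[OF s(1)] by metis
    \<comment> \<open>This is 1 - b s, written with sums and products so that coherence is
      immediate. Its entry at index 1 vanishes, so its limit lies in K, and 1 = limit t + b y lies
      in J.\<close>
    define t where "t n = \<one> \<oplus> \<ominus> \<one> \<otimes> (b \<otimes> s n)" for n
    have t: "coherent t"
      unfolding t_def using s(1) b(1) by (intro coherent_add coherent_mult coherent_const) auto
    have "t 1 = \<zero>" using b(2) by (simp add: t_def R.r_neg)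
    then have tJ: "limit t \<in> J"
      using KI[OF t] idealD(3)[OF max_ideal_ideal] K(3) by auto
    have "limit t \<oplus>\<^bsub>\<RR>\<^esub> canon R b \<otimes>\<^bsub>\<RR>\<^esub> y = limit (\<lambda>n. t n \<oplus> b \<otimes> s n)"
      using s b(1) t by (simp add: canon_limit limit_mult limit_add coherent_mult coherent_const)
    also have "(\<lambda>n. t n \<oplus> b \<otimes> s n) = (\<lambda>_. \<one>)"
      using b(1) coherent_carrier[OF s(1)] by (auto simp: t_def R.l_minus R.a_assoc R.l_neg)
    finally have "\<one>\<^bsub>\<RR>\<^esub> \<in> J"
      using idealD(4)[OF J(1) tJ idealD(7)[OF J(1) canon_closed[OF b(1)] y(1)]]
      by (simp add: completion_one)
    then have "J = carrier \<RR>" by (rule idealD(9)[OF J(1)])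
    also have "\<dots> = adjoin \<RR> {\<zero>\<^bsub>\<RR>\<^esub>} \<one>\<^bsub>\<RR>\<^esub>"
      using idealD(9)[OF H.R.adjoin_ideal[OF H.R.zeroideal H.R.one_closed]]
        H.R.adjoin_self[OF H.R.zeroideal H.R.one_closed] by simp
    finally show ?thesis
      using fg_ideal.fg_adjoin[OF fg_ideal.fg_zero H.R.one_closed] by simp
  qed
qed

text \<open>Induction on the generators of \<open>\<mm>\<close>: the claim holds for ideals above the image of all
  of them, and each one is dropped from the bound by \<open>fg_ideal_if_fg_above\<close>.\<close>

lemma completion_noetherian:
  assumes "ideal J \<RR>"
  shows "fg_ideal \<RR> J"
proof -
  interpret C: cring \<RR> by (rule completion_cring)
  \<comment> \<open>Phrased as an implication, so that an induction adjoining generators can be used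
    to remove them: the base case is immediate because every ideal contains zero, and
    \<open>fg_ideal_above_max_ideal\<close> enters only at the end, for I = \<mm>.\<close>
  have "I \<subseteq> \<mm> \<longrightarrow> (\<forall>J. ideal J \<RR> \<and> canon R ` I \<subseteq> J \<longrightarrow> fg_ideal \<RR> J) \<longrightarrow>
      (\<forall>J. ideal J \<RR> \<longrightarrow> fg_ideal \<RR> J)" if "fg_ideal R I" for I
    using that
  proof (induction rule: fg_ideal.induct)
    case fg_zero
    then show ?case using idealD(3)[of _ \<RR>] by (auto simp: canon_zero)
  next
    case (fg_adjoin I x)
    have I: "ideal I R" using fg_adjoin.hyps(1) by (rule R.fg_ideal_imp_ideal)
    note x = fg_adjoin.hyps(2)
    show ?case
    proof (rule impI, rule impI)
      assume sub: "adjoin R I x \<subseteq> \<mm>"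
        and above: "\<forall>J. ideal J \<RR> \<and> canon R ` adjoin R I x \<subseteq> J \<longrightarrow> fg_ideal \<RR> J"
      have xm: "x \<in> \<mm>" and Im: "I \<subseteq> \<mm>"
        using sub R.adjoin_self[OF I x] R.adjoin_superset[OF I x] by auto
      have "fg_ideal \<RR> J" if J: "ideal J \<RR>" "canon R ` I \<subseteq> J" for J
      proof (rule C.fg_ideal_if_fg_above[OF J(1) canon_closed[OF x]])
        fix G y assume "fg_ideal \<RR> G" "y \<in> carrier \<RR>"
          "\<And>n. \<exists>g\<in>G. \<exists>a\<in>carrier \<RR>. y = g \<oplus>\<^bsub>\<RR>\<^esub> canon R x [^]\<^bsub>\<RR>\<^esub> (n::nat) \<otimes>\<^bsub>\<RR>\<^esub> a"
        then show "y \<in> G" by (rule completion_fg_closed[OF xm])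
      next
        fix J' assume J': "ideal J' \<RR>" "J \<subseteq> J'" "canon R x \<in> J'"
        have "canon R ` adjoin R I x \<subseteq> J'"
        proof
          fix z assume "z \<in> canon R ` adjoin R I x"
          then obtain i a where ia: "i \<in> I" "a \<in> carrier R" "z = canon R (i \<oplus> a \<otimes> x)"
            unfolding adjoin_def by blast
          then have "z = canon R i \<oplus>\<^bsub>\<RR>\<^esub> canon R a \<otimes>\<^bsub>\<RR>\<^esub> canon R x"
            using x idealD(2)[OF I] by (simp add: canon_add canon_mult)
          moreover have "canon R i \<in> J'" using ia(1) J(2) J'(2) by blast
          ultimately show "z \<in> J'"
            using idealD(4)[OF J'(1)] idealD(7)[OF J'(1) canon_closed[OF ia(2)] J'(3)] by simp
        qed
        then show "fg_ideal \<RR> J'" using above J'(1) by blast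
      qed
      then show "\<forall>J. ideal J \<RR> \<longrightarrow> fg_ideal \<RR> J" using fg_adjoin.IH Im by blast
    qed
  qed
  from this[OF fg_max_ideal] show ?thesis
    using fg_ideal_above_max_ideal assms by blast
qed

section \<open>The duality for the completion and the translation of divisibility\<close>

lemma canon_mult_subset: "mult_subset R S \<Longrightarrow> mult_subset \<RR> (canon R ` S)"
  unfolding mult_subset_def by (auto simp: canon_closed canon_one[symmetric] canon_mult[symmetric] subset_iff)

lemma completion_duality:
  assumes "mult_subset R S"
  shows "annihilator_duality \<RR> Ehat (canon R ` S)"
proof -
  interpret H: module \<RR> Ehat by (rule Ehat_module)
  interpret L: localized_ring \<RR> "canon R ` S"
    by unfold_locales (rule canon_mult_subset[OF assms])
  show ?thesis
  proof unfold_locales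
    fix I assume I: "ideal I \<RR>"
    have "I \<subseteq> ann_ring \<RR> Ehat (ann_elems Ehat I)"
      using idealD(2)[OF I] by (auto simp: ann_ring_def ann_elems_def)
    then show "ann_ring \<RR> Ehat (ann_elems Ehat I) = I"
      using ann_ring_ann_elems_fg[OF completion_noetherian[OF I]] by blast
  qed (rule ann_elems_ann_ring_hat)
qed

text \<open>For the principal ideal of s the product with N is contained in s N. Conversely an ideal
  meeting \<open>S\<close> contains some s in \<open>S\<close>, and s N already exhausts N.\<close>

lemma FS_divisible_iff:
  assumes S: "S \<subseteq> carrier R" and N: "submodule N R E"
  shows "FS_divisible R S E N \<longleftrightarrow> (\<forall>s\<in>S. \<forall>e\<in>N. \<exists>f\<in>N. e = s \<odot>\<^bsub>E\<^esub> f)"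
proof
  note Nd = submoduleD[OF N]
  {
    assume div: "FS_divisible R S E N"
    show "\<forall>s\<in>S. \<forall>e\<in>N. \<exists>f\<in>N. e = s \<odot>\<^bsub>E\<^esub> f"
    proof (intro ballI)
      fix s e assume s: "s \<in> S" and e: "e \<in> N"
      have sc: "s \<in> carrier R" using s S by blast
      have "PIdl s \<inter> S \<noteq> {}" using s cgenideal_self[OF sc] by blast
      then have "ideal_smult R E (PIdl s) N = N"
        using div cgenideal_ideal[OF sc] by (simp add: FS_divisible_def)
      moreover have "ideal_smult R E (PIdl s) N \<subseteq> (\<lambda>f. s \<odot>\<^bsub>E\<^esub> f) ` N"
        unfolding ideal_smult_def
      proof (rule Inter_lower, intro CollectI conjI)
        show "submodule ((\<lambda>f. s \<odot>\<^bsub>E\<^esub> f) ` N) R E" using N sc by (rule smult_image_submodule)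
        show "{r \<odot>\<^bsub>E\<^esub> x | r x. r \<in> PIdl s \<and> x \<in> N} \<subseteq> (\<lambda>f. s \<odot>\<^bsub>E\<^esub> f) ` N"
        proof
          fix z assume "z \<in> {r \<odot>\<^bsub>E\<^esub> x | r x. r \<in> PIdl s \<and> x \<in> N}"
          then obtain a x where ax: "a \<in> carrier R" "x \<in> N" "z = (a \<otimes> s) \<odot>\<^bsub>E\<^esub> x"
            by (auto simp: cgenideal_def)
          then have "z = s \<odot>\<^bsub>E\<^esub> (a \<odot>\<^bsub>E\<^esub> x)"
            using sc Nd(1) by (simp add: smult_assoc1 smult_commute)
          then show "z \<in> (\<lambda>f. s \<odot>\<^bsub>E\<^esub> f) ` N" using ax Nd(4) by blast
        qed
      qed
      ultimately show "\<exists>f\<in>N. e = s \<odot>\<^bsub>E\<^esub> f" using e by blast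
    qed
  }
  {
    assume div: "\<forall>s\<in>S. \<forall>e\<in>N. \<exists>f\<in>N. e = s \<odot>\<^bsub>E\<^esub> f"
    show "FS_divisible R S E N"
      unfolding FS_divisible_def
    proof (intro allI impI)
      fix I assume I: "ideal I R \<and> I \<inter> S \<noteq> {}"
      then obtain s where s: "s \<in> I" "s \<in> S" by blast
      show "ideal_smult R E I N = N"
      proof
        show "ideal_smult R E I N \<subseteq> N"
          unfolding ideal_smult_def
          using N Nd(4) idealD(2)[of I R] I by (intro Inter_lower) auto
        show "N \<subseteq> ideal_smult R E I N"
          unfolding ideal_smult_def using div s by blast
      qed
    qed
  }
qed

end

text \<open>As the first conjunct makes the map bijective, an ideal extended from P has exactly one
  preimage; the second exhibits it as the annihilator of P in E.\<close>

theorem theorem4p3: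
  fixes R :: "('a, 'b) ring_scheme" and E :: "('a, 'c, 'd) module_scheme" and S :: "'a set"
  assumes "noetherian_ring R" and "local_ring R"
    and "module R E" and "injective_hull_residue R E"
    and "mult_subset R S"
  shows "bij_betw (\<lambda>N. ext_ideal (completion R) (canon R ` S) (ann_hat R E N))
           {N. simple_FS_divisible R S E N}
           {J. maximalideal J (localization (completion R) (canon R ` S))}
       \<and> (\<forall>P. primeideal P (completion R) \<and> P \<inter> canon R ` S = {}
              \<and> maximalideal (ext_ideal (completion R) (canon R ` S) P)
                              (localization (completion R) (canon R ` S))
            \<longrightarrow> simple_FS_divisible R S E (ann_mod R E P)
              \<and> ext_ideal (completion R) (canon R ` S) (ann_hat R E (ann_mod R E P))
                 = ext_ideal (completion R) (canon R ` S) P)"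
proof -
  obtain u where u: "u \<in> carrier E" "u \<noteq> \<zero>\<^bsub>E\<^esub>"
    "{r \<in> carrier R. r \<odot>\<^bsub>E\<^esub> u = \<zero>\<^bsub>E\<^esub>} = max_ideal R"
    "\<And>U. submodule U R E \<Longrightarrow> U \<noteq> {\<zero>\<^bsub>E\<^esub>} \<Longrightarrow> U \<inter> {r \<odot>\<^bsub>E\<^esub> u | r. r \<in> carrier R} \<noteq> {\<zero>\<^bsub>E\<^esub>}"
    using assms(4) unfolding injective_hull_residue_def by blast
  have inj: "injective_module R E"
    using assms(4) by (simp add: injective_hull_residue_def)
  interpret residue_hull R E u
    by (rule residue_hull.intro[OF assms(3) residue_hull_axioms.intro])
      (fact assms(1) assms(2) inj u)+
  interpret D: annihilator_duality "completion R" Ehat "canon R ` S"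
    using assms(5) by (rule completion_duality)
  have SR: "S \<subseteq> carrier R" using assms(5) by (simp add: mult_subset_def)
  \<comment> \<open>The two notions of divisibility agree since \<open>canon R s\<close> acts on E
    as s does, and both rings have the same submodules of E.\<close>
  have div: "D.divisible_submodule N \<longleftrightarrow> submodule N R E \<and> FS_divisible R S E N" for N
  proof (cases "submodule N R E")
    case True
    have "hat_smult R E (canon R s) f = s \<odot>\<^bsub>E\<^esub> f" if "s \<in> S" "f \<in> N" for s f
      using hat_smult_canon that SR submoduleD(1)[OF True] by blast
    then show ?thesis
      using True FS_divisible_iff[OF SR True]
      by (simp add: D.divisible_submodule_def submodule_Ehat_iff)
  qed (simp add: D.divisible_submodule_def submodule_Ehat_iff)
  have simple: "simple_FS_divisible R S E N \<longleftrightarrow> D.simple_divisible N" for N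
    unfolding simple_FS_divisible_def D.simple_divisible_def div Ehat_simps by blast
  show ?thesis
    unfolding simple ann_hat_eq ann_mod_eq
  proof (intro conjI allI impI D.simple_divisible_bij_maximal_ideals)
    fix P assume P: "primeideal P (completion R) \<and> P \<inter> canon R ` S = {} \<and>
      maximalideal (ext_ideal (completion R) (canon R ` S) P) (localization (completion R) (canon R ` S))"
    then show "D.simple_divisible (ann_elems Ehat P)"
      using D.simple_divisible_ann_elems_prime by blast
    \<comment> \<open>The double annihilator identity holds for every ideal of the completion, so
      here only the ideal property of P is used.\<close>
    have "ideal P (completion R)" using P by (simp add: primeideal_def)
    then show "ext_ideal (completion R) (canon R ` S) (ann_ring (completion R) Ehat (ann_elems Ehat P)) =
        ext_ideal (completion R) (canon R ` S) P"
      by (simp add: D.ann_ring_ann_elems)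
  qed
qed

end
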